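(* For $\alpha\in(-1,1)$ and $X_0\in\mathbb{R}$, the process $$X^0_t=\left((1-\alpha)B_t+(X_0)^{1-\alpha}\right)^{\frac1{1-\alpha}},\quad t\ge0,$$ is a strong solution to $X_t=X_0+\int_0^t|X_s|^\alpha\circ\mathrm{d}B_s$.
   Context: $B$ is a standard continuous Brownian motion ($B_0=0$) on a filtered probability space satisfying the usual assumptions. Powers: $\operatorname{sign}0=0$; for $\alpha\in\mathbb{R}$, $|x|^\alpha$ is the usual power for $x\ne0$ and $|0|^\alpha:=0$ (so $|x|^0=\mathbf 1_{x\neq 0}$); the signed power is $(x)^\gamma:=|x|^\gamma\operatorname{sign}x$. Powers of signed quantities written with parentheses are signed powers. Integrals: let $D_n=\{0=t_0^n<t_1^n<\dots\}$ be partitions of $[0,\infty)$ with finitely many points in each $[0,t]$ and mesh tending to $0$. Limits are in u.c.p. (uniformly on compact time intervals in probability). The It\^o integral is $\int_0^t X_s\,\mathrm{d}Y_s=\lim_n\sum_{t_k<t}X_{t_k}(Y_{t_{k+1}}-Y_{t_k})$; the covariation is $[X,Y]_t=\lim_n\sum_{t_k<t}(X_{t_{k+1}}-X_{t_k})(Y_{t_{k+1}}-Y_{t_k})$; the Stratonovich integral is $\int_0^tX_s\circ \mathrm{d}Y_s=\int_0^tX_s\,\mathrm{d}Y_s+\frac12[X,Y]_t$, provided both exist. A strong solution of $X_t=X_0+\int_0^t|X_s|^\alpha\circ\mathrm{d}B_s$ is a continuous process $X$, adapted to the augmented natural filtration of $B$, such that for every $t\ge0$ the It\^o integral $\int_0^t|X_s|^\alpha\,\mathrm{d}B_s$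 and the covariation $[|X|^\alpha,B]_t$ exist and the equation holds $\mathbf{P}$-a.s.
   Formalization: For α<0 and X_0=0 the partitions D_n are also assumed to satisfy sup over n and k≥1 of t^n_{k+1}/t^n_k < ∞; without it the Itô sums can diverge (e.g. t^n_1=e^{-n}, t^n_2=1/n) and the claim fails. *)

theory Defs
  imports "HOL-Probability.Probability"
begin

text \<open>Stochastic processes are functions \<open>X t \<omega>\<close> with real time \<open>t\<close>; only times \<open>t \<ge> 0\<close> are relevant,
  and nothing is assumed or claimed about negative times.

  The convention \<open>0 powr a = 0\<close> for every \<open>a\<close>, including \<open>a = 0\<close>, is the one wanted here, so the power
  of the absolute value of \<open>x\<close> with exponent \<open>a\<close> is \<open>\<bar>x\<bar> powr a\<close>.\<close>

definition signed_powr :: "real \<Rightarrow> real \<Rightarrow> real" where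
  "signed_powr x a = \<bar>x\<bar> powr a * sgn x"


subsection \<open>Filtrations and Brownian motion\<close>

locale usual_filtered_prob_space = prob_space M + complete_measure M
  for M :: "'a measure" +
  fixes F :: "real \<Rightarrow> 'a measure"
  assumes subalgebra_F: "0 \<le> t \<Longrightarrow> subalgebra M (F t)"
    and F_mono: "0 \<le> s \<Longrightarrow> s \<le> t \<Longrightarrow> sets (F s) \<subseteq> sets (F t)"
    and null_sets_F: "null_sets M \<subseteq> sets (F 0)"
    and F_right_continuous: "0 \<le> t \<Longrightarrow> sets (F t) = (\<Inter>s\<in>{t<..}. sets (F s))"

definition continuous_process :: "'a measure \<Rightarrow> (real \<Rightarrow> 'a \<Rightarrow> real) \<Rightarrow> bool" where
  "continuous_process M X \<longleftrightarrow> (\<forall>\<omega>\<in>space M. continuous_on {0..} (\<lambda>t. X t \<omega>))"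

definition adapted_process :: "(real \<Rightarrow> 'a measure) \<Rightarrow> (real \<Rightarrow> 'a \<Rightarrow> real) \<Rightarrow> bool" where
  "adapted_process F X \<longleftrightarrow> (\<forall>t\<ge>0. X t \<in> borel_measurable (F t))"

text \<open>The second argument of \<^const>\<open>normal_density\<close> is the standard deviation.\<close>

definition brownian_motion ::
    "'a measure \<Rightarrow> (real \<Rightarrow> 'a measure) \<Rightarrow> (real \<Rightarrow> 'a \<Rightarrow> real) \<Rightarrow> bool" where
  "brownian_motion M F B \<longleftrightarrow>
     (\<forall>\<omega>\<in>space M. B 0 \<omega> = 0) \<and>
     continuous_process M B \<and>
     adapted_process F B \<and>
     (\<forall>s t. 0 \<le> s \<and> s < t \<longrightarrow>
        distributed M lborel (\<lambda>\<omega>. B t \<omega> - B s \<omega>) (normal_density 0 (sqrt (t - s))) \<and>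
        prob_space.indep_set M (sets (F s))
          (sets (vimage_algebra (space M) (\<lambda>\<omega>. B t \<omega> - B s \<omega>) borel)))"

text \<open>On a complete probability space \<^term>\<open>null_sets M\<close> contains all subsets of null events.\<close>

definition augmented_natural_filtration ::
    "'a measure \<Rightarrow> (real \<Rightarrow> 'a \<Rightarrow> real) \<Rightarrow> real \<Rightarrow> 'a measure" where
  "augmented_natural_filtration M B t =
     sigma (space M) ({B s -` A \<inter> space M | s A. 0 \<le> s \<and> s \<le> t \<and> A \<in> sets borel} \<union> null_sets M)"


subsection \<open>Partitions and limits uniformly on compacts in probability\<close>

text \<open>\<open>D n k\<close> is the \<open>k\<close>-th point of the \<open>n\<close>-th partition. The mesh is taken in the extended reals,
  as it may be infinite for individual \<open>n\<close>.\<close>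

definition partition_sequence :: "(nat \<Rightarrow> nat \<Rightarrow> real) \<Rightarrow> bool" where
  "partition_sequence D \<longleftrightarrow>
     (\<forall>n. D n 0 = 0 \<and> strict_mono (D n) \<and> (\<forall>t. finite {k. D n k \<le> t})) \<and>
     (\<lambda>n. SUP k. ereal (D n (Suc k) - D n k)) \<longlonglongrightarrow> 0"

text \<open>Regularity of the partitions near time \<open>0\<close>: the ratios of consecutive positive partition points
  are bounded. Without it, Ito sums of an integrand that is singular at the starting point of the
  Brownian motion may diverge: if \<open>D n 1\<close> is very small compared to \<open>D n 2\<close>, the summand belonging
  to \<open>D n 1\<close> need not vanish in the limit.\<close>

definition ratio_bounded :: "(nat \<Rightarrow> nat \<Rightarrow> real) \<Rightarrow> bool" where
  "ratio_bounded D \<longleftrightarrow> (\<exists>C. \<forall>n k. D n (Suc (Suc k)) \<le> C * D n (Suc k))"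

text \<open>The outer measure of the event that the supremum of \<open>\<bar>S n t - Z t\<bar>\<close> over \<open>0 \<le> t \<le> T\<close> exceeds
  \<open>e\<close> tends to \<open>0\<close>. The outer measure avoids that a non-measurable event would count as a null event.\<close>

definition ucp_limit ::
    "'a measure \<Rightarrow> (nat \<Rightarrow> real \<Rightarrow> 'a \<Rightarrow> real) \<Rightarrow> (real \<Rightarrow> 'a \<Rightarrow> real) \<Rightarrow> bool" where
  "ucp_limit M S Z \<longleftrightarrow>
     (\<forall>T\<ge>0. \<forall>e>0.
        (\<lambda>n. outer_measure_of M {\<omega> \<in> space M. \<exists>t\<in>{0..T}. e < \<bar>S n t \<omega> - Z t \<omega>\<bar>}) \<longlonglongrightarrow> 0)"


subsection \<open>Integrals, covariation and strong solutions\<close>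

text \<open>The processes \<open>I\<close>, \<open>Q\<close>, \<open>J\<close> below are determined up to indistinguishability by the limits, so
  integral and covariation are treated as relations; existence is existence of a related process.\<close>

definition has_ito_integral ::
    "'a measure \<Rightarrow> (nat \<Rightarrow> nat \<Rightarrow> real) \<Rightarrow> (real \<Rightarrow> 'a \<Rightarrow> real) \<Rightarrow> (real \<Rightarrow> 'a \<Rightarrow> real) \<Rightarrow>
       (real \<Rightarrow> 'a \<Rightarrow> real) \<Rightarrow> bool" where
  "has_ito_integral M D X Y I \<longleftrightarrow>
     ucp_limit M
       (\<lambda>n t \<omega>. \<Sum>k | D n k < t. X (D n k) \<omega> * (Y (D n (Suc k)) \<omega> - Y (D n k) \<omega>)) I"

definition has_covariation ::
    "'a measure \<Rightarrow> (nat \<Rightarrow> nat \<Rightarrow> real) \<Rightarrow> (real \<Rightarrow> 'a \<Rightarrow> real) \<Rightarrow> (real \<Rightarrow> 'a \<Rightarrow> real) \<Rightarrow>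
       (real \<Rightarrow> 'a \<Rightarrow> real) \<Rightarrow> bool" where
  "has_covariation M D X Y Q \<longleftrightarrow>
     ucp_limit M
       (\<lambda>n t \<omega>. \<Sum>k | D n k < t.
          (X (D n (Suc k)) \<omega> - X (D n k) \<omega>) * (Y (D n (Suc k)) \<omega> - Y (D n k) \<omega>)) Q"

definition has_stratonovich_integral ::
    "'a measure \<Rightarrow> (nat \<Rightarrow> nat \<Rightarrow> real) \<Rightarrow> (real \<Rightarrow> 'a \<Rightarrow> real) \<Rightarrow> (real \<Rightarrow> 'a \<Rightarrow> real) \<Rightarrow>
       (real \<Rightarrow> 'a \<Rightarrow> real) \<Rightarrow> bool" where
  "has_stratonovich_integral M D X Y J \<longleftrightarrow>
     (\<exists>I Q. has_ito_integral M D X Y I \<and> has_covariation M D X Y Q \<and>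
        J = (\<lambda>t \<omega>. I t \<omega> + 1 / 2 * Q t \<omega>))"

text \<open>\<open>X\<close> is a strong solution of \<open>X t = x0 + (Stratonovich integral of \<bar>X\<bar> powr \<alpha> against B up to t)\<close>,
  where limits are taken along the partitions \<open>D\<close>.\<close>

definition strong_solution ::
    "'a measure \<Rightarrow> (nat \<Rightarrow> nat \<Rightarrow> real) \<Rightarrow> (real \<Rightarrow> 'a \<Rightarrow> real) \<Rightarrow> real \<Rightarrow> real \<Rightarrow>
       (real \<Rightarrow> 'a \<Rightarrow> real) \<Rightarrow> bool" where
  "strong_solution M D B \<alpha> x0 X \<longleftrightarrow>
     continuous_process M X \<and>
     adapted_process (augmented_natural_filtration M B) X \<and>
     (\<exists>J. has_stratonovich_integral M D (\<lambda>s \<omega>. \<bar>X s \<omega>\<bar> powr \<alpha>) B J \<and>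
        (\<forall>t\<ge>0. AE \<omega> in M. X t \<omega> = x0 + J t \<omega>))"

end

theory Submission
  imports Defs
begin

text \<open>With \<open>\<beta> = \<alpha> / (1 - \<alpha>)\<close>, \<open>a = signed_powr X0 (1 - \<alpha>) / (1 - \<alpha>)\<close> and \<open>W = B + a\<close>, the integrand is a multiple of
  \<open>f W\<close> for \<open>f y = \<bar>y\<bar> powr \<beta>\<close>, and \<open>\<beta> > - 1/2\<close> makes \<open>f\<close> locally square integrable. The Ito sums and half of the
  covariation sums add up to trapezoidal sums, so it suffices that the Ito sums converge at all and that the
  trapezoidal sums converge to the increment of the antiderivative of \<open>f\<close>. For a continuously differentiable
  replacement of \<open>f\<close> near \<open>0\<close> both follow from Taylor expansion along the path. The error \<open>g\<close> of the replacement
  has small \<open>L\<^sup>2\<close> norm: sums of \<open>g W\<close> over left endpoints are martingales, and sums over right endpoints are,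
  up to a drift, martingales in reversed time, because the bridge values
  \<open>B s - s / t * B t\<close> are independent of the values of \<open>B\<close> from time \<open>t\<close> on. A maximal inequality bounds both.\<close>

section \<open>Limits uniformly on compacts in probability\<close>

text \<open>The condition \<alpha> > -1 is precisely \<beta> > -1/2. For \<beta> < 0 the derivative
  of f is not integrable at 0, so the Ito correction cannot simply be written as an integral of
  f'(W). The Ito integral and the covariation are therefore only shown to exist; just their
  combination gets a closed form. The smoothing radius \<epsilon> is fixed by the error and
  probability tolerances before n tends to infinity, so the bounds for g must be uniform in the
  partition. What decides is the singularity of the density of \<open>B t\<close> at t = 0. Right
  endpoints lead to sums of \<open>(\<tau> (Suc k) - \<tau> k) * \<tau> (Suc k) powr (-1/2)\<close>,
  lower Riemann sums of an integrable function, bounded for every partition. Left endpoints lead to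
  upper Riemann sums, which can be arbitrarily large. This is where \<open>ratio_bounded\<close>, a
  starting point off the singularity, or boundedness of f near 0 enters.\<close>

definition holds_up_to :: "'a measure \<Rightarrow> real \<Rightarrow> ('a \<Rightarrow> bool) \<Rightarrow> bool" where
  "holds_up_to M p P \<longleftrightarrow> (\<exists>A\<in>sets M. measure M A \<le> p \<and> (\<forall>\<omega>\<in>space M - A. P \<omega>))"

lemma holds_up_to_mono:
  assumes "holds_up_to M p P" "p \<le> q" "\<And>\<omega>. \<omega> \<in> space M \<Longrightarrow> P \<omega> \<Longrightarrow> Q \<omega>"
  shows "holds_up_to M q Q"
  using assms unfolding holds_up_to_def by (meson DiffD1 order_trans)

lemma (in prob_space) holds_up_to_conj:
  assumes "holds_up_to M p P" "holds_up_to M q Q"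
  shows "holds_up_to M (p + q) (\<lambda>\<omega>. P \<omega> \<and> Q \<omega>)"
proof -
  obtain A where A: "A \<in> events" "prob A \<le> p" "\<forall>\<omega>\<in>space M - A. P \<omega>"
    using assms(1) unfolding holds_up_to_def by blast
  obtain C where C: "C \<in> events" "prob C \<le> q" "\<forall>\<omega>\<in>space M - C. Q \<omega>"
    using assms(2) unfolding holds_up_to_def by blast
  have "prob (A \<union> C) \<le> p + q"
    using measure_Un_le[OF A(1) C(1)] A(2) C(2) by simp
  then show ?thesis
    unfolding holds_up_to_def using A C by (intro bexI[of _ "A \<union> C"]) auto
qed

lemma holds_up_to_Markov:
  fixes X :: "'a \<Rightarrow> real"
  assumes "integrable M X" "\<And>\<omega>. 0 \<le> X \<omega>" "0 < c" "(\<integral>\<omega>. X \<omega> \<partial>M) \<le> p * c"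
  shows "holds_up_to M p (\<lambda>\<omega>. X \<omega> \<le> c)"
proof -
  have "measure M {\<omega> \<in> space M. X \<omega> \<ge> c} \<le> (\<integral>\<omega>. X \<omega> \<partial>M) / c"
    using assms by (intro integral_Markov_inequality_measure[where A="space M", simplified]) auto
  also have "\<dots> \<le> p"
    using assms by (simp add: divide_le_eq)
  finally show ?thesis
    unfolding holds_up_to_def using assms(1)
    by (intro bexI[of _ "{\<omega> \<in> space M. X \<omega> \<ge> c}"]) auto
qed

text \<open>Small outer measure means a measurable cover of small measure, which is the exceptional
  set in \<open>holds_up_to\<close>. In this form exceptional events are merged by a union bound,
  and no supremum over uncountably many t has to be measurable.\<close>

lemma (in prob_space) ucp_limit_iff:
  "ucp_limit M S Z \<longleftrightarrow>
     (\<forall>T\<ge>0. \<forall>e>0. \<forall>p>0. \<forall>\<^sub>F n in sequentially.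
        holds_up_to M p (\<lambda>\<omega>. \<forall>t\<in>{0..T}. \<bar>S n t \<omega> - Z t \<omega>\<bar> \<le> e))"
proof -
  define E where "E T e n = {\<omega> \<in> space M. \<exists>t\<in>{0..T}. e < \<bar>S n t \<omega> - Z t \<omega>\<bar>}" for T e n
  have main: "((\<lambda>n. outer_measure_of M (E T e n)) \<longlonglongrightarrow> 0) \<longleftrightarrow>
      (\<forall>p>0. \<forall>\<^sub>F n in sequentially. holds_up_to M p (\<lambda>\<omega>. \<forall>t\<in>{0..T}. \<bar>S n t \<omega> - Z t \<omega>\<bar> \<le> e))"
    (is "?L \<longleftrightarrow> ?R") for T e
  proof
    assume L: ?L
    show ?R
    proof (intro allI impI)
      fix p :: real assume p: "0 < p"
      then have "\<forall>\<^sub>F n in sequentially. outer_measure_of M (E T e n) < ennreal p"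
        using L by (intro order_tendstoD) auto
      then show "\<forall>\<^sub>F n in sequentially.
          holds_up_to M p (\<lambda>\<omega>. \<forall>t\<in>{0..T}. \<bar>S n t \<omega> - Z t \<omega>\<bar> \<le> e)"
      proof eventually_elim
        case (elim n)
        then obtain A where A: "A \<in> events" "E T e n \<subseteq> A" "emeasure M A < ennreal p"
          unfolding outer_measure_of_def INF_less_iff by blast
        then have "prob A \<le> p"
          using p by (simp add: emeasure_eq_measure ennreal_less_iff)
        moreover have "\<forall>\<omega>\<in>space M - A. \<forall>t\<in>{0..T}. \<bar>S n t \<omega> - Z t \<omega>\<bar> \<le> e"
          using A(2) unfolding E_def by (blast intro: leI)
        ultimately show ?case
          unfolding holds_up_to_def using A(1) by blast
      qed
    qed
  next
    assume R: ?R
    show ?L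
    proof (rule order_tendstoI)
      fix a :: ennreal assume "0 < a"
      then obtain r where r: "0 < r" "r < a" by (rule dense[THEN exE]) auto
      then obtain p where "r = ennreal p" "0 \<le> p" by (cases r) auto
      with r have p: "0 < p" "ennreal p < a" by (auto simp: less_le)
      show "\<forall>\<^sub>F n in sequentially. outer_measure_of M (E T e n) < a"
        using R[rule_format, OF p(1)]
      proof eventually_elim
        case (elim n)
        then obtain A where A: "A \<in> events" "prob A \<le> p"
            "\<forall>\<omega>\<in>space M - A. \<forall>t\<in>{0..T}. \<bar>S n t \<omega> - Z t \<omega>\<bar> \<le> e"
          unfolding holds_up_to_def by blast
        then have "E T e n \<subseteq> A"
          unfolding E_def by (blast dest: leD)
        then have "outer_measure_of M (E T e n) \<le> emeasure M A"
          using A(1) by (metis outer_measure_of_eq outer_measure_of_mono)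
        also have "\<dots> \<le> ennreal p"
          using A by (simp add: emeasure_eq_measure ennreal_leI)
        finally show ?case using p by simp
      qed
    qed simp
  qed
  show ?thesis
    unfolding ucp_limit_def by (simp only: main[unfolded E_def])
qed

lemma (in prob_space) ucp_limit_lincomb:
  fixes c d :: real
  assumes "ucp_limit M S Z" "ucp_limit M S' Z'"
  shows "ucp_limit M (\<lambda>n t \<omega>. c * S n t \<omega> + d * S' n t \<omega>) (\<lambda>t \<omega>. c * Z t \<omega> + d * Z' t \<omega>)"
  unfolding ucp_limit_iff
proof (intro allI impI)
  fix T e p :: real assume T: "0 \<le> T" and e: "0 < e" and p: "0 < p"
  \<comment> \<open>The added 1 keeps the divisor positive when c = d = 0.\<close>
  define e' where "e' = e / (\<bar>c\<bar> + \<bar>d\<bar> + 1)"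
  have e': "0 < e'" "(\<bar>c\<bar> + \<bar>d\<bar>) * e' \<le> e"
    using e by (auto simp: e'_def field_simps)
  have 1: "\<forall>\<^sub>F n in sequentially. holds_up_to M (p/2) (\<lambda>\<omega>. \<forall>t\<in>{0..T}. \<bar>S n t \<omega> - Z t \<omega>\<bar> \<le> e')"
    using assms(1) T e' p unfolding ucp_limit_iff by simp
  have 2: "\<forall>\<^sub>F n in sequentially. holds_up_to M (p/2) (\<lambda>\<omega>. \<forall>t\<in>{0..T}. \<bar>S' n t \<omega> - Z' t \<omega>\<bar> \<le> e')"
    using assms(2) T e' p unfolding ucp_limit_iff by simp
  show "\<forall>\<^sub>F n in sequentially. holds_up_to M p
      (\<lambda>\<omega>. \<forall>t\<in>{0..T}. \<bar>c * S n t \<omega> + d * S' n t \<omega> - (c * Z t \<omega> + d * Z' t \<omega>)\<bar> \<le> e)"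
    using 1 2
  proof eventually_elim
    case (elim n)
    show ?case
    proof (rule holds_up_to_mono[OF holds_up_to_conj[OF elim]])
      fix \<omega> assume *: "(\<forall>t\<in>{0..T}. \<bar>S n t \<omega> - Z t \<omega>\<bar> \<le> e') \<and> (\<forall>t\<in>{0..T}. \<bar>S' n t \<omega> - Z' t \<omega>\<bar> \<le> e')"
      show "\<forall>t\<in>{0..T}. \<bar>c * S n t \<omega> + d * S' n t \<omega> - (c * Z t \<omega> + d * Z' t \<omega>)\<bar> \<le> e"
      proof
        fix t assume t: "t \<in> {0..T}"
        have "c * S n t \<omega> + d * S' n t \<omega> - (c * Z t \<omega> + d * Z' t \<omega>)
            = c * (S n t \<omega> - Z t \<omega>) + d * (S' n t \<omega> - Z' t \<omega>)"
          by (simp add: algebra_simps)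
        also have "\<bar>\<dots>\<bar> \<le> \<bar>c\<bar> * \<bar>S n t \<omega> - Z t \<omega>\<bar> + \<bar>d\<bar> * \<bar>S' n t \<omega> - Z' t \<omega>\<bar>"
          by (metis abs_mult abs_triangle_ineq)
        also have "\<dots> \<le> \<bar>c\<bar> * e' + \<bar>d\<bar> * e'"
          using * t by (intro add_mono mult_left_mono) auto
        finally show "\<bar>c * S n t \<omega> + d * S' n t \<omega> - (c * Z t \<omega> + d * Z' t \<omega>)\<bar> \<le> e"
          using e'(2) by (simp add: algebra_simps)
      qed
    qed simp
  qed
qed

text \<open>Completeness of u.c.p. convergence. The approximant Z may depend on T, e and p and need
  not be explicit. With tolerance \<open>(1/2) ^ j\<close> on the horizon j, consecutive
  approximants are close off events of summable probability, and a Borel-Cantelli argument makes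
  them converge uniformly on compacts.\<close>

lemma (in prob_space) ucp_limit_exists:
  assumes approx: "\<And>T e p. 0 \<le> T \<Longrightarrow> 0 < e \<Longrightarrow> 0 < p \<Longrightarrow>
    \<exists>Z. \<forall>\<^sub>F n in sequentially. holds_up_to M p (\<lambda>\<omega>. \<forall>t\<in>{0..T}. \<bar>S n t \<omega> - Z t \<omega>\<bar> \<le> e)"
  shows "\<exists>I. ucp_limit M S I"
proof -
  let ?h = "\<lambda>j::nat. (1/2::real) ^ j"
  have "\<exists>Z. \<forall>j::nat. \<forall>\<^sub>F n in sequentially. holds_up_to M (?h j)
      (\<lambda>\<omega>. \<forall>t\<in>{0..real j}. \<bar>S n t \<omega> - Z j t \<omega>\<bar> \<le> ?h j)"
    by (intro choice allI approx) auto
  then obtain Z where Z: "\<And>j. \<forall>\<^sub>F n in sequentially. holds_up_to M (?h j)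
      (\<lambda>\<omega>. \<forall>t\<in>{0..real j}. \<bar>S n t \<omega> - Z j t \<omega>\<bar> \<le> ?h j)"
    by blast
  \<comment> \<open>One n that is good for both j and \<open>Suc j\<close> suffices:
    \<open>S n\<close> is only the intermediate point of a triangle inequality.\<close>
  have "holds_up_to M (2 * ?h j) (\<lambda>\<omega>. \<forall>t\<in>{0..real j}. \<bar>Z (Suc j) t \<omega> - Z j t \<omega>\<bar> \<le> 2 * ?h j)" for j
  proof -
    have "\<forall>\<^sub>F n in sequentially. holds_up_to M (?h j + ?h (Suc j)) (\<lambda>\<omega>.
        (\<forall>t\<in>{0..real j}. \<bar>S n t \<omega> - Z j t \<omega>\<bar> \<le> ?h j) \<and>
        (\<forall>t\<in>{0..real (Suc j)}. \<bar>S n t \<omega> - Z (Suc j) t \<omega>\<bar> \<le> ?h (Suc j)))"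
      using Z[of j] Z[of "Suc j"] by eventually_elim (rule holds_up_to_conj)
    then obtain n where n: "holds_up_to M (?h j + ?h (Suc j)) (\<lambda>\<omega>.
        (\<forall>t\<in>{0..real j}. \<bar>S n t \<omega> - Z j t \<omega>\<bar> \<le> ?h j) \<and>
        (\<forall>t\<in>{0..real (Suc j)}. \<bar>S n t \<omega> - Z (Suc j) t \<omega>\<bar> \<le> ?h (Suc j)))"
      using eventually_happens'[OF sequentially_bot] by blast
    show ?thesis
    proof (rule holds_up_to_mono[OF n])
      fix \<omega> assume *: "(\<forall>t\<in>{0..real j}. \<bar>S n t \<omega> - Z j t \<omega>\<bar> \<le> ?h j) \<and>
        (\<forall>t\<in>{0..real (Suc j)}. \<bar>S n t \<omega> - Z (Suc j) t \<omega>\<bar> \<le> ?h (Suc j))"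
      show "\<forall>t\<in>{0..real j}. \<bar>Z (Suc j) t \<omega> - Z j t \<omega>\<bar> \<le> 2 * ?h j"
      proof
        fix t assume "t \<in> {0..real j}"
        then have "\<bar>S n t \<omega> - Z j t \<omega>\<bar> \<le> ?h j" "\<bar>S n t \<omega> - Z (Suc j) t \<omega>\<bar> \<le> ?h (Suc j)"
          using * by auto
        moreover have "?h (Suc j) \<le> ?h j" by simp
        ultimately show "\<bar>Z (Suc j) t \<omega> - Z j t \<omega>\<bar> \<le> 2 * ?h j" by linarith
      qed
    qed simp
  qed
  then have "\<exists>A. \<forall>j. A j \<in> events \<and> prob (A j) \<le> 2 * ?h j \<and>
      (\<forall>\<omega>\<in>space M - A j. \<forall>t\<in>{0..real j}. \<bar>Z (Suc j) t \<omega> - Z j t \<omega>\<bar> \<le> 2 * ?h j)"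
    unfolding holds_up_to_def by (intro choice) blast
  then obtain A where A: "\<And>j. A j \<in> events" "\<And>j. prob (A j) \<le> 2 * ?h j"
      "\<And>j \<omega> t. \<omega> \<in> space M - A j \<Longrightarrow> t \<in> {0..real j} \<Longrightarrow> \<bar>Z (Suc j) t \<omega> - Z j t \<omega>\<bar> \<le> 2 * ?h j"
    by blast
  \<comment> \<open>Off \<open>U j\<close> all steps from j on are controlled at once, so the
    telescoping series starting at j converges with a geometric tail.\<close>
  define U where "U j = (\<Union>i. A (i + j))" for j
  have U_events: "U j \<in> events" for j unfolding U_def using A(1) by auto
  have geom: "(\<lambda>i. 2 * ?h (i + j)) sums (4 * ?h j)" for j
    using sums_mult[OF geometric_sums[of "1/2::real"], of "2 * ?h j"]
    by (simp add: power_add mult_ac)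
  have U_prob: "prob (U j) \<le> 4 * ?h j" for j
  proof -
    have "prob (U j) \<le> (\<Sum>i. prob (A (i + j)))"
      unfolding U_def using A(1,2)
      by (intro finite_measure_subadditive_countably) (auto intro!: summable_comparison_test[OF _ sums_summable[OF geom[of j]]])
    also have "\<dots> \<le> (\<Sum>i. 2 * ?h (i + j))"
      using A(1,2) by (intro suminf_le)
        (auto intro!: sums_summable[OF geom[of j]] summable_comparison_test[OF _ sums_summable[OF geom[of j]]])
    also have "\<dots> = 4 * ?h j" using geom by (rule sums_unique[symmetric])
    finally show ?thesis .
  qed
  \<comment> \<open>For t up to j the limit exists off \<open>U j\<close>. Where the sequence
    diverges, \<open>lim\<close> is an unspecified value, and such points stay in the exceptional
    event.\<close>
  define I where "I t \<omega> = lim (\<lambda>j. Z j t \<omega>)" for t \<omega>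
  have close: "\<bar>I t \<omega> - Z j t \<omega>\<bar> \<le> 4 * ?h j" if "\<omega> \<in> space M - U j" "t \<in> {0..real j}" for \<omega> t j
  proof -
    have d: "\<bar>Z (Suc (i + j)) t \<omega> - Z (i + j) t \<omega>\<bar> \<le> 2 * ?h (i + j)" for i
      using that A(3)[of \<omega> "i + j" t] unfolding U_def by auto
    have summ: "summable (\<lambda>i. \<bar>Z (Suc (i + j)) t \<omega> - Z (i + j) t \<omega>\<bar>)"
      by (rule summable_comparison_test[OF _ sums_summable[OF geom[of j]]]) (use d in auto)
    have tele: "(\<Sum>i<n. Z (Suc (i + j)) t \<omega> - Z (i + j) t \<omega>) = Z (n + j) t \<omega> - Z j t \<omega>" for n
      by (induction n) auto
    have "(\<lambda>n. Z (n + j) t \<omega> - Z j t \<omega>) \<longlonglongrightarrow> (\<Sum>i. Z (Suc (i + j)) t \<omega> - Z (i + j) t \<omega>)"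
      using summable_LIMSEQ[OF summable_rabs_cancel[OF summ]] by (simp add: tele)
    from tendsto_add[OF this tendsto_const[of "Z j t \<omega>"]]
    have "(\<lambda>n. Z n t \<omega>) \<longlonglongrightarrow> (\<Sum>i. Z (Suc (i + j)) t \<omega> - Z (i + j) t \<omega>) + Z j t \<omega>"
      by (simp add: LIMSEQ_offset)
    then have "I t \<omega> = (\<Sum>i. Z (Suc (i + j)) t \<omega> - Z (i + j) t \<omega>) + Z j t \<omega>"
      unfolding I_def by (rule limI)
    then have "\<bar>I t \<omega> - Z j t \<omega>\<bar> = \<bar>\<Sum>i. Z (Suc (i + j)) t \<omega> - Z (i + j) t \<omega>\<bar>" by simp
    also have "\<dots> \<le> (\<Sum>i. \<bar>Z (Suc (i + j)) t \<omega> - Z (i + j) t \<omega>\<bar>)"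
      by (rule summable_rabs[OF summ])
    also have "\<dots> \<le> (\<Sum>i. 2 * ?h (i + j))"
      by (rule suminf_le[OF d summ sums_summable[OF geom[of j]]])
    also have "\<dots> = 4 * ?h j" using geom by (rule sums_unique[symmetric])
    finally show ?thesis .
  qed
  have "ucp_limit M S I"
    unfolding ucp_limit_iff
  proof (intro allI impI)
    fix T e p :: real assume T: "0 \<le> T" and e: "0 < e" and p: "0 < p"
    have "\<forall>\<^sub>F j in sequentially. ?h j < min e p / 5"
      using e p by (intro order_tendstoD(2)[OF LIMSEQ_realpow_zero]) auto
    moreover have "\<forall>\<^sub>F j in sequentially. T \<le> real j"
      using filterlim_real_sequentially unfolding filterlim_at_top by blast
    ultimately have "\<forall>\<^sub>F j in sequentially. ?h j < min e p / 5 \<and> T \<le> real j"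
      by eventually_elim simp
    \<comment> \<open>5 = 1 + 4: \<open>?h j\<close> for the distance between \<open>S n\<close> and
      \<open>Z j\<close>, and \<open>4 * ?h j\<close> between \<open>Z j\<close> and I, in the error
      as well as in the probability.\<close>
    then obtain j where j: "?h j < min e p / 5" "T \<le> real j"
      using eventually_happens'[OF sequentially_bot] by blast
    have U: "holds_up_to M (4 * ?h j) (\<lambda>\<omega>. \<forall>t\<in>{0..real j}. \<bar>I t \<omega> - Z j t \<omega>\<bar> \<le> 4 * ?h j)"
      unfolding holds_up_to_def using U_events U_prob close by blast
    show "\<forall>\<^sub>F n in sequentially. holds_up_to M p (\<lambda>\<omega>. \<forall>t\<in>{0..T}. \<bar>S n t \<omega> - I t \<omega>\<bar> \<le> e)"
      using Z[of j]
    proof eventually_elim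
      case (elim n)
      show ?case
      proof (rule holds_up_to_mono[OF holds_up_to_conj[OF elim U]])
        show "?h j + 4 * ?h j \<le> p" using j by simp
        fix \<omega> assume *: "(\<forall>t\<in>{0..real j}. \<bar>S n t \<omega> - Z j t \<omega>\<bar> \<le> ?h j) \<and>
          (\<forall>t\<in>{0..real j}. \<bar>I t \<omega> - Z j t \<omega>\<bar> \<le> 4 * ?h j)"
        show "\<forall>t\<in>{0..T}. \<bar>S n t \<omega> - I t \<omega>\<bar> \<le> e"
        proof
          fix t assume "t \<in> {0..T}"
          then have "\<bar>S n t \<omega> - Z j t \<omega>\<bar> \<le> ?h j" "\<bar>I t \<omega> - Z j t \<omega>\<bar> \<le> 4 * ?h j"
            using * j by auto
          then show "\<bar>S n t \<omega> - I t \<omega>\<bar> \<le> e" using j by linarith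
        qed
      qed
    qed
  qed
  then show ?thesis by blast
qed

section \<open>A maximal inequality for martingale transforms\<close>

lemma (in prob_space) indep_set_mono:
  assumes "indep_set A C" "A' \<subseteq> A" "C' \<subseteq> C"
  shows "indep_set A' C'"
  using assms unfolding indep_sets2_eq by (simp add: subset_iff)

lemma (in prob_space) indep_var_of_indep_set:
  fixes X V :: "'a \<Rightarrow> real" and h :: "real \<Rightarrow> real"
  assumes "subalgebra M G" "indep_set (sets G) (sets (vimage_algebra (space M) V borel))"
    and "X \<in> borel_measurable G" "V \<in> borel_measurable M" "h \<in> borel_measurable borel"
  shows "indep_var borel X borel (\<lambda>\<omega>. h (V \<omega>))"
proof -
  have "sigma_sets (space M) {X -` A \<inter> space M | A. A \<in> sets borel} \<subseteq> sets G"
    using measurable_sets[OF assms(3)] assms(1)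
    by (intro sets.sigma_sets_subset[of _ G, unfolded subalgebra_def[THEN iffD1, OF assms(1), THEN conjunct1]])
      (auto simp: subalgebra_def)
  moreover have "sigma_sets (space M) {V -` A \<inter> space M | A. A \<in> sets borel}
      = sets (vimage_algebra (space M) V borel)"
    by (simp add: sets_vimage_algebra)
  ultimately have "indep_set (sigma_sets (space M) {X -` A \<inter> space M | A. A \<in> sets borel})
      (sigma_sets (space M) {V -` A \<inter> space M | A. A \<in> sets borel})"
    using indep_set_mono[OF assms(2)] by simp
  then have "indep_var borel X borel V"
    unfolding indep_var_eq using measurable_from_subalg[OF assms(1,3)] assms(4) by blast
  from indep_var_compose[OF this measurable_ident assms(5)] show ?thesis
    by (simp add: comp_def)
qed

text \<open>The function h lets one independence hypothesis on V serve both V itself and its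
  square.\<close>

lemma (in prob_space) expectation_mult_indep_set:
  fixes X V :: "'a \<Rightarrow> real" and h :: "real \<Rightarrow> real"
  assumes "subalgebra M G" "indep_set (sets G) (sets (vimage_algebra (space M) V borel))"
    and "X \<in> borel_measurable G" "V \<in> borel_measurable M" "h \<in> borel_measurable borel"
    and "integrable M X" "integrable M (\<lambda>\<omega>. h (V \<omega>))"
  shows "integrable M (\<lambda>\<omega>. X \<omega> * h (V \<omega>))"
    and "expectation (\<lambda>\<omega>. X \<omega> * h (V \<omega>)) = expectation X * expectation (\<lambda>\<omega>. h (V \<omega>))"
  using indep_var_integrable indep_var_lebesgue_integral indep_var_of_indep_set[OF assms(1-5)]
    assms(6,7) by blast+

lemma integrable_square_mult:
  fixes X Y :: "'a \<Rightarrow> real"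
  assumes "X \<in> borel_measurable M" "Y \<in> borel_measurable M"
    and "integrable M (\<lambda>\<omega>. (X \<omega>)\<^sup>2)" "integrable M (\<lambda>\<omega>. (Y \<omega>)\<^sup>2)"
  shows "integrable M (\<lambda>\<omega>. X \<omega> * Y \<omega>)"
proof (rule Bochner_Integration.integrable_bound)
  show "integrable M (\<lambda>\<omega>. (X \<omega>)\<^sup>2 + (Y \<omega>)\<^sup>2)" using assms by simp
  have "\<bar>x * y\<bar> \<le> x\<^sup>2 + y\<^sup>2" for x y :: real
  proof -
    have "2 * (\<bar>x\<bar> * \<bar>y\<bar>) \<le> x\<^sup>2 + y\<^sup>2" using sum_squares_bound[of "\<bar>x\<bar>" "\<bar>y\<bar>"] by (simp add: mult_ac)
    moreover have "0 \<le> \<bar>x\<bar> * \<bar>y\<bar>" by simp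
    ultimately show ?thesis unfolding abs_mult by linarith
  qed
  then show "AE \<omega> in M. norm (X \<omega> * Y \<omega>) \<le> norm ((X \<omega>)\<^sup>2 + (Y \<omega>)\<^sup>2)"
    by (intro AE_I2) (auto intro: order_trans[OF _ abs_ge_self])
qed (use assms in auto)

text \<open>Orthogonality of martingale differences: the partial sum and \<open>u n\<close> are
  known to \<open>G n\<close>, while \<open>v n\<close> is centred and independent of it, so the
  cross term vanishes and the square factors. Listing the earlier terms in \<open>past\<close>,
  instead of fixing a filtration in increasing time, lets the lemma run along reversed time
  too.\<close>

lemma (in prob_space) martingale_square:
  fixes u v :: "nat \<Rightarrow> 'a \<Rightarrow> real" and G :: "nat \<Rightarrow> 'a measure"
  assumes G: "\<And>k. k < K \<Longrightarrow> subalgebra M (G k)"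
    and u: "\<And>k. k < K \<Longrightarrow> u k \<in> borel_measurable (G k)"
    and past: "\<And>j k. j < k \<Longrightarrow> k < K \<Longrightarrow> u j \<in> borel_measurable (G k)"
      "\<And>j k. j < k \<Longrightarrow> k < K \<Longrightarrow> v j \<in> borel_measurable (G k)"
    and v: "\<And>k. k < K \<Longrightarrow> v k \<in> borel_measurable M"
    and indep: "\<And>k. k < K \<Longrightarrow> indep_set (sets (G k)) (sets (vimage_algebra (space M) (v k) borel))"
    and u2: "\<And>k. k < K \<Longrightarrow> integrable M (\<lambda>\<omega>. (u k \<omega>)\<^sup>2)"
    and v2: "\<And>k. k < K \<Longrightarrow> integrable M (\<lambda>\<omega>. (v k \<omega>)\<^sup>2)"
    and v0: "\<And>k. k < K \<Longrightarrow> expectation (v k) = 0"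
  shows "integrable M (\<lambda>\<omega>. (\<Sum>k<K. u k \<omega> * v k \<omega>)\<^sup>2)"
    and "expectation (\<lambda>\<omega>. (\<Sum>k<K. u k \<omega> * v k \<omega>)\<^sup>2)
      = (\<Sum>k<K. expectation (\<lambda>\<omega>. (u k \<omega>)\<^sup>2) * expectation (\<lambda>\<omega>. (v k \<omega>)\<^sup>2))"
proof -
  have "integrable M (\<lambda>\<omega>. (\<Sum>k<n. u k \<omega> * v k \<omega>)\<^sup>2) \<and>
     expectation (\<lambda>\<omega>. (\<Sum>k<n. u k \<omega> * v k \<omega>)\<^sup>2)
      = (\<Sum>k<n. expectation (\<lambda>\<omega>. (u k \<omega>)\<^sup>2) * expectation (\<lambda>\<omega>. (v k \<omega>)\<^sup>2))"
    if "n \<le> K" for n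
    using that
  proof (induction n)
    case 0
    then show ?case by simp
  next
    case (Suc n)
    then have n: "n < K" by simp
    let ?S = "\<lambda>\<omega>. \<Sum>k<n. u k \<omega> * v k \<omega>"
    have IH: "integrable M (\<lambda>\<omega>. (?S \<omega>)\<^sup>2)"
      "expectation (\<lambda>\<omega>. (?S \<omega>)\<^sup>2)
        = (\<Sum>k<n. expectation (\<lambda>\<omega>. (u k \<omega>)\<^sup>2) * expectation (\<lambda>\<omega>. (v k \<omega>)\<^sup>2))"
      using Suc by auto
    have SG: "?S \<in> borel_measurable (G n)"
      using past n by (intro borel_measurable_sum borel_measurable_times) auto
    have Su: "integrable M (\<lambda>\<omega>. ?S \<omega> * u n \<omega>)"
      using IH(1) u2[OF n] measurable_from_subalg[OF G[OF n]] SG u[OF n]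
      by (intro integrable_square_mult) auto
    have vint: "integrable M (v n)"
      using square_integrable_imp_integrable[OF v[OF n] v2[OF n]] .
    note cross = expectation_mult_indep_set[OF G[OF n] indep[OF n] borel_measurable_times[OF SG u[OF n]]
        v[OF n] _ Su, of "\<lambda>x. x", simplified, OF vint]
    have "(\<lambda>\<omega>. (u n \<omega>)\<^sup>2) \<in> borel_measurable (G n)" using u[OF n] by simp
    note sq = expectation_mult_indep_set[OF G[OF n] indep[OF n] this v[OF n] _ u2[OF n] v2[OF n], simplified]
    have eq: "(\<Sum>k<Suc n. u k \<omega> * v k \<omega>)\<^sup>2
        = (?S \<omega>)\<^sup>2 + (2 * (?S \<omega> * u n \<omega> * v n \<omega>) + (u n \<omega>)\<^sup>2 * (v n \<omega>)\<^sup>2)" for \<omega>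
      by (simp add: power2_eq_square algebra_simps)
    show ?case
      unfolding eq using IH cross sq v0[OF n] by simp
  qed
  then show "integrable M (\<lambda>\<omega>. (\<Sum>k<K. u k \<omega> * v k \<omega>)\<^sup>2)"
    and "expectation (\<lambda>\<omega>. (\<Sum>k<K. u k \<omega> * v k \<omega>)\<^sup>2)
      = (\<Sum>k<K. expectation (\<lambda>\<omega>. (u k \<omega>)\<^sup>2) * expectation (\<lambda>\<omega>. (v k \<omega>)\<^sup>2))"
    by auto
qed

text \<open>Stopping the sum at its first passage above \<open>c\<close> keeps the multipliers predictable, so
  Chebyshev's inequality for the stopped sum controls the running maximum.\<close>

lemma (in prob_space) martingale_maximal:
  fixes u v :: "nat \<Rightarrow> 'a \<Rightarrow> real" and G :: "nat \<Rightarrow> 'a measure"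
  assumes G: "\<And>k. k < K \<Longrightarrow> subalgebra M (G k)"
    and u: "\<And>k. k < K \<Longrightarrow> u k \<in> borel_measurable (G k)"
    and past: "\<And>j k. j < k \<Longrightarrow> k < K \<Longrightarrow> u j \<in> borel_measurable (G k)"
      "\<And>j k. j < k \<Longrightarrow> k < K \<Longrightarrow> v j \<in> borel_measurable (G k)"
    and v: "\<And>k. k < K \<Longrightarrow> v k \<in> borel_measurable M"
    and indep: "\<And>k. k < K \<Longrightarrow> indep_set (sets (G k)) (sets (vimage_algebra (space M) (v k) borel))"
    and u2: "\<And>k. k < K \<Longrightarrow> integrable M (\<lambda>\<omega>. (u k \<omega>)\<^sup>2)"
    and v2: "\<And>k. k < K \<Longrightarrow> integrable M (\<lambda>\<omega>. (v k \<omega>)\<^sup>2)"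
    and v0: "\<And>k. k < K \<Longrightarrow> expectation (v k) = 0"
    and c: "0 < c"
    and bound: "(\<Sum>k<K. expectation (\<lambda>\<omega>. (u k \<omega>)\<^sup>2) * expectation (\<lambda>\<omega>. (v k \<omega>)\<^sup>2)) \<le> p * c\<^sup>2"
  shows "holds_up_to M p (\<lambda>\<omega>. \<forall>j\<le>K. \<bar>\<Sum>k<j. u k \<omega> * v k \<omega>\<bar> \<le> c)"
proof -
  define S where "S j \<omega> = (\<Sum>k<j. u k \<omega> * v k \<omega>)" for j \<omega>
  \<comment> \<open>\<open>S k\<close> sums only the terms of index below k. The stopping indicator
    for step k therefore does not involve \<open>v k\<close> and is measurable in
    \<open>G k\<close>.\<close>
  define w where "w k \<omega> = u k \<omega> * (if \<forall>i\<in>{..k}. \<bar>S i \<omega>\<bar> \<le> c then 1 else 0)" for k \<omega>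
  have SG: "S j \<in> borel_measurable (G k)" if "j \<le> k" "k < K" for j k
    unfolding S_def using past that by (intro borel_measurable_sum borel_measurable_times) auto
  have wG: "w j \<in> borel_measurable (G k)" if "j \<le> k" "k < K" for j k
  proof -
    have [measurable]: "u j \<in> borel_measurable (G k)" using past(1)[of j k] u[of k] that by (cases "j = k") auto
    have "{\<omega>\<in>space (G k). \<forall>i\<in>{..j}. \<bar>S i \<omega>\<bar> \<le> c} \<in> sets (G k)"
    proof (rule sets.sets_Collect_finite_All)
      fix i assume "i \<in> {..j}"
      then have [measurable]: "S i \<in> borel_measurable (G k)" using SG that by auto
      show "{\<omega>\<in>space (G k). \<bar>S i \<omega>\<bar> \<le> c} \<in> sets (G k)" by measurable
    qed simp
    then have [measurable]: "Measurable.pred (G k) (\<lambda>\<omega>. \<forall>i\<in>{..j}. \<bar>S i \<omega>\<bar> \<le> c)"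
      by (simp add: pred_def)
    show ?thesis unfolding w_def by measurable
  qed
  have w_le: "(w k \<omega>)\<^sup>2 \<le> (u k \<omega>)\<^sup>2" for k \<omega>
    by (auto simp: w_def)
  have w2: "integrable M (\<lambda>\<omega>. (w k \<omega>)\<^sup>2)" if "k < K" for k
    using u2[OF that] measurable_from_subalg[OF G[OF that] wG[of k k]] that w_le
    by (intro Bochner_Integration.integrable_bound[OF u2[OF that]]) auto
  let ?T = "\<lambda>\<omega>. \<Sum>k<K. w k \<omega> * v k \<omega>"
  have sq: "integrable M (\<lambda>\<omega>. (?T \<omega>)\<^sup>2)"
    "expectation (\<lambda>\<omega>. (?T \<omega>)\<^sup>2) = (\<Sum>k<K. expectation (\<lambda>\<omega>. (w k \<omega>)\<^sup>2) * expectation (\<lambda>\<omega>. (v k \<omega>)\<^sup>2))"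
    using martingale_square[of K G w v] G wG past(2) v indep w2 v2 v0 by auto
  have "expectation (\<lambda>\<omega>. (?T \<omega>)\<^sup>2)
      \<le> (\<Sum>k<K. expectation (\<lambda>\<omega>. (u k \<omega>)\<^sup>2) * expectation (\<lambda>\<omega>. (v k \<omega>)\<^sup>2))"
    unfolding sq(2) using u2 w2 w_le
    by (intro sum_mono mult_right_mono integral_mono) auto
  then have "expectation (\<lambda>\<omega>. (?T \<omega>)\<^sup>2) \<le> p * c\<^sup>2" using bound by linarith
  define A where "A = {\<omega>\<in>space M. \<not> (\<forall>j\<in>{..K}. \<bar>S j \<omega>\<bar> \<le> c)}"
  have SM: "S j \<in> borel_measurable M" if "j \<le> K" for j
    unfolding S_def using that measurable_from_subalg[OF G u] v
    by (intro borel_measurable_sum borel_measurable_times) auto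
  have A_ev: "A \<in> events"
    unfolding A_def
  proof (intro sets.sets_Collect_neg sets.sets_Collect_finite_All)
    fix i assume "i \<in> {..K}"
    then have [measurable]: "S i \<in> borel_measurable M" using SM by auto
    show "{\<omega>\<in>space M. \<bar>S i \<omega>\<bar> \<le> c} \<in> events" by measurable
  qed simp
  have "c\<^sup>2 \<le> (?T \<omega>)\<^sup>2" if "\<omega> \<in> A" for \<omega>
  proof -
    \<comment> \<open>At the first passage index j the indicator switches from 1 to 0 for good, so
      the stopped sum equals \<open>S j\<close> from there on.\<close>
    define j where "j = (LEAST j. c < \<bar>S j \<omega>\<bar>)"
    obtain i where i: "i \<le> K" "c < \<bar>S i \<omega>\<bar>" using \<open>\<omega> \<in> A\<close> by (auto simp: A_def not_le)
    have j: "c < \<bar>S j \<omega>\<bar>" unfolding j_def using i(2) by (rule LeastI)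
    have jK: "j \<le> K" unfolding j_def using i by (metis Least_le order_trans)
    have before: "\<bar>S i \<omega>\<bar> \<le> c" if "i < j" for i
      using not_less_Least[of i "\<lambda>j. c < \<bar>S j \<omega>\<bar>"] that by (simp add: j_def)
    have "?T \<omega> = (\<Sum>k<j. w k \<omega> * v k \<omega>) + (\<Sum>k\<in>{..<K} - {..<j}. w k \<omega> * v k \<omega>)"
      using jK by (subst sum.subset_diff[of "{..<j}" "{..<K}"]) auto
    also have "(\<Sum>k\<in>{..<K} - {..<j}. w k \<omega> * v k \<omega>) = 0"
      using j by (intro sum.neutral) (auto simp: w_def dest: leD)
    also have "(\<Sum>k<j. w k \<omega> * v k \<omega>) = S j \<omega>"
      unfolding S_def[of j] by (intro sum.cong) (auto simp: w_def before)
    finally have "c \<le> \<bar>?T \<omega>\<bar>" using j by simp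
    then show ?thesis
      using c by (metis abs_le_square_iff abs_of_pos)
  qed
  then have "A \<subseteq> {\<omega>\<in>space M. c\<^sup>2 \<le> (?T \<omega>)\<^sup>2}"
    by (auto simp: A_def)
  moreover have "{\<omega>\<in>space M. c\<^sup>2 \<le> (?T \<omega>)\<^sup>2} \<in> events"
    using borel_measurable_integrable[OF sq(1)] by measurable
  ultimately have "prob A \<le> prob {\<omega>\<in>space M. c\<^sup>2 \<le> (?T \<omega>)\<^sup>2}"
    by (rule finite_measure_mono)
  also have "\<dots> \<le> expectation (\<lambda>\<omega>. (?T \<omega>)\<^sup>2) / c\<^sup>2"
    using sq(1) c by (intro integral_Markov_inequality_measure[where A="space M", simplified]) auto
  also have "\<dots> \<le> p"
    using \<open>expectation (\<lambda>\<omega>. (?T \<omega>)\<^sup>2) \<le> p * c\<^sup>2\<close> c by (simp add: divide_le_eq)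
  finally show ?thesis
    unfolding holds_up_to_def using A_ev
    by (intro bexI[of _ A]) (auto simp: A_def S_def)
qed

text \<open>For a, b, v in the three families, \<open>prob (a \<inter> b \<inter> v)\<close> splits
  off \<open>prob v\<close> because a \<inter> b lies in \<F>, and then splits again. So \<A> is
  independent of the pi-system of sets b \<inter> v, hence of what it generates. This is the tool
  for adding one more increment to the future.\<close>

lemma (in prob_space) indep_set_join:
  assumes \<A>\<B>: "indep_set \<A> \<B>" and \<F>: "\<A> \<subseteq> \<F>" "\<B> \<subseteq> \<F>" "Int_stable \<F>"
    and \<F>\<V>: "indep_set \<F> \<V>"
    and st: "Int_stable \<A>" "Int_stable \<B>" "Int_stable \<V>" "space M \<in> \<B>" "space M \<in> \<V>"
  shows "indep_set (sigma_sets (space M) \<A>) (sigma_sets (space M) (\<B> \<union> \<V>))"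
proof -
  let ?J = "{b \<inter> v | b v. b \<in> \<B> \<and> v \<in> \<V>}"
  have ev: "\<A> \<subseteq> events" "\<B> \<subseteq> events" "\<V> \<subseteq> events"
    using \<A>\<B> \<F>\<V> unfolding indep_sets2_eq by auto
  have "indep_set \<A> ?J"
  proof (rule indep_setI)
    fix a j assume a: "a \<in> \<A>" and "j \<in> ?J"
    then obtain b v where j: "j = b \<inter> v" "b \<in> \<B>" "v \<in> \<V>" by blast
    have "a \<inter> b \<in> \<F>" using a j \<F> by (auto intro: Int_stableD)
    then have "prob ((a \<inter> b) \<inter> v) = prob (a \<inter> b) * prob v"
      using indep_setD[OF \<F>\<V>] j by blast
    moreover have "prob (b \<inter> v) = prob b * prob v"
      using indep_setD[OF \<F>\<V>] j \<F> by blast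
    ultimately show "prob (a \<inter> j) = prob a * prob j"
      using indep_setD[OF \<A>\<B> a j(2)] j(1) by (simp add: Int_assoc)
  qed (use ev in auto)
  moreover have "Int_stable ?J"
  proof (rule Int_stableI)
    fix x y assume "x \<in> ?J" "y \<in> ?J"
    then obtain b v b' v' where *: "x = b \<inter> v" "y = b' \<inter> v'" "b \<in> \<B>" "v \<in> \<V>" "b' \<in> \<B>" "v' \<in> \<V>"
      by blast
    have "x \<inter> y = (b \<inter> b') \<inter> (v \<inter> v')" using * by auto
    moreover have "b \<inter> b' \<in> \<B>" "v \<inter> v' \<in> \<V>" using * st by (auto intro: Int_stableD)
    ultimately show "x \<inter> y \<in> ?J" by blast
  qed
  ultimately have *: "indep_set (sigma_sets (space M) \<A>) (sigma_sets (space M) ?J)"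
    using st(1) by (intro indep_set_sigma_sets)
  have "\<B> \<union> \<V> \<subseteq> ?J"
  proof
    fix x assume "x \<in> \<B> \<union> \<V>"
    then have "x = x \<inter> space M" "x = space M \<inter> x" using ev sets.sets_into_space by blast+
    then show "x \<in> ?J" using \<open>x \<in> \<B> \<union> \<V>\<close> st(4,5) by blast
  qed
  then have "sigma_sets (space M) (\<B> \<union> \<V>) \<subseteq> sigma_sets (space M) ?J"
    by (rule sigma_sets_mono')
  with * show ?thesis by (rule indep_set_mono[OF _ order_refl])
qed

section \<open>Brownian motion and its bridges\<close>

locale brownian = usual_filtered_prob_space M F
  for M :: "'a measure" and F +
  fixes B :: "real \<Rightarrow> 'a \<Rightarrow> real"
  assumes brownian: "brownian_motion M F B"
begin

lemma B_0: "\<omega> \<in> space M \<Longrightarrow> B 0 \<omega> = 0"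
  using brownian unfolding brownian_motion_def by blast

lemma B_continuous: "\<omega> \<in> space M \<Longrightarrow> continuous_on {0..} (\<lambda>t. B t \<omega>)"
  using brownian unfolding brownian_motion_def continuous_process_def by blast

lemma B_measurable_F: "0 \<le> s \<Longrightarrow> s \<le> t \<Longrightarrow> B s \<in> borel_measurable (F t)"
proof -
  assume s: "0 \<le> s" "s \<le> t"
  have "B s \<in> borel_measurable (F s)"
    using brownian s unfolding brownian_motion_def adapted_process_def by blast
  then show ?thesis
    using F_mono[OF s] subalgebra_F[of s] subalgebra_F[of t] s
    by (intro measurable_from_subalg[of "F t" "F s"]) (auto simp: subalgebra_def)
qed

lemma B_measurable: "0 \<le> t \<Longrightarrow> B t \<in> borel_measurable M"
  using measurable_from_subalg[OF subalgebra_F B_measurable_F] by blast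

lemma increment_distributed:
  "0 \<le> s \<Longrightarrow> s < t \<Longrightarrow> distributed M lborel (\<lambda>\<omega>. B t \<omega> - B s \<omega>) (normal_density 0 (sqrt (t - s)))"
  using brownian unfolding brownian_motion_def by blast

lemma increment_indep:
  "0 \<le> s \<Longrightarrow> s < t \<Longrightarrow>
    indep_set (sets (F s)) (sets (vimage_algebra (space M) (\<lambda>\<omega>. B t \<omega> - B s \<omega>) borel))"
  using brownian unfolding brownian_motion_def by blast

lemma increment_measurable:
  "0 \<le> s \<Longrightarrow> 0 \<le> t \<Longrightarrow> (\<lambda>\<omega>. B t \<omega> - B s \<omega>) \<in> borel_measurable M"
  using B_measurable by simp

lemma B_distributed:
  assumes "0 < t" shows "distributed M lborel (B t) (normal_density 0 (sqrt t))"
proof -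
  have "distributed M lborel (\<lambda>\<omega>. B t \<omega> - B 0 \<omega>) (normal_density 0 (sqrt t))"
    using increment_distributed[of 0 t] assms by simp
  moreover have "distr M lborel (\<lambda>\<omega>. B t \<omega> - B 0 \<omega>) = distr M lborel (B t)"
    by (rule distr_cong) (auto simp: B_0)
  ultimately show ?thesis
    using B_measurable[of t] assms unfolding distributed_def by simp
qed

lemma increment_moment:
  assumes "0 \<le> s" "s < t"
  shows "integrable M (\<lambda>\<omega>. (B t \<omega> - B s \<omega>) ^ k)"
    and "expectation (\<lambda>\<omega>. B t \<omega> - B s \<omega>) = 0"
    and "expectation (\<lambda>\<omega>. (B t \<omega> - B s \<omega>)\<^sup>2) = t - s"
    and "expectation (\<lambda>\<omega>. (B t \<omega> - B s \<omega>) ^ 4) = 3 * (t - s)\<^sup>2"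
proof -
  note d = increment_distributed[OF assms]
  have \<sigma>: "0 < sqrt (t - s)" using assms by simp
  show "integrable M (\<lambda>\<omega>. (B t \<omega> - B s \<omega>) ^ k)"
    using distributed_integrable[OF d, of "\<lambda>x. x ^ k"] integrable_normal_moment[OF \<sigma>, of 0 k]
    by (simp add: normal_density_nonneg)
  show "expectation (\<lambda>\<omega>. B t \<omega> - B s \<omega>) = 0"
    using normal_distributed_expectation[OF \<sigma> d] .
  have e: "expectation (\<lambda>\<omega>. (B t \<omega> - B s \<omega>) ^ (2 * k)) = fact (2 * k) / ((2 / (sqrt (t - s))\<^sup>2) ^ k * fact k)" for k
    using distributed_integral[OF d, of "\<lambda>x. x ^ (2 * k)"] integral_normal_moment_even[OF \<sigma>, of 0 k]
    by (simp add: normal_density_nonneg)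
  show "expectation (\<lambda>\<omega>. (B t \<omega> - B s \<omega>)\<^sup>2) = t - s"
    using e[of 1] assms by (simp add: fact_numeral)
  show "expectation (\<lambda>\<omega>. (B t \<omega> - B s \<omega>) ^ 4) = 3 * (t - s)\<^sup>2"
    using e[of 2] assms by (simp add: fact_numeral field_simps power2_eq_square)
qed

text \<open>Time 0 is treated apart, because there B is constant and has no density.\<close>

lemma B_square:
  assumes "0 \<le> t"
  shows "integrable M (\<lambda>\<omega>. (B t \<omega>)\<^sup>2)" "expectation (\<lambda>\<omega>. (B t \<omega>)\<^sup>2) = t"
    and "integrable M (B t)" "expectation (B t) = 0"
proof -
  have "integrable M (\<lambda>\<omega>. (B t \<omega>)\<^sup>2) \<and> expectation (\<lambda>\<omega>. (B t \<omega>)\<^sup>2) = t \<and> integrable M (B t) \<and> expectation (B t) = 0"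
  proof (cases "t = 0")
    case True
    have "integrable M (\<lambda>\<omega>. h (B t \<omega>)) \<longleftrightarrow> integrable M (\<lambda>\<omega>. h 0)"
      "expectation (\<lambda>\<omega>. h (B t \<omega>)) = expectation (\<lambda>\<omega>. h 0)" for h :: "real \<Rightarrow> real"
      by (rule Bochner_Integration.integrable_cong Bochner_Integration.integral_cong; simp add: True B_0)+
    from this[of "\<lambda>x. x\<^sup>2"] this[of "\<lambda>x. x"] show ?thesis using True by simp
  next
    case False
    have "integrable M (\<lambda>\<omega>. h (B t \<omega>)) \<longleftrightarrow> integrable M (\<lambda>\<omega>. h (B t \<omega> - B 0 \<omega>))"
      "expectation (\<lambda>\<omega>. h (B t \<omega>)) = expectation (\<lambda>\<omega>. h (B t \<omega> - B 0 \<omega>))" for h :: "real \<Rightarrow> real"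
      by (rule Bochner_Integration.integrable_cong Bochner_Integration.integral_cong; simp add: B_0)+
    from this[of "\<lambda>x. x\<^sup>2"] this[of "\<lambda>x. x"] show ?thesis
      using increment_moment(1)[of 0 t 1] increment_moment(1)[of 0 t 2] increment_moment(2,3)[of 0 t] False assms by simp
  qed
  then show "integrable M (\<lambda>\<omega>. (B t \<omega>)\<^sup>2)" "expectation (\<lambda>\<omega>. (B t \<omega>)\<^sup>2) = t"
    and "integrable M (B t)" "expectation (B t) = 0" by auto
qed

text \<open>The value at time \<open>s\<close> of the Brownian bridge from \<open>(0, 0)\<close> to \<open>(t, 0)\<close>.\<close>

definition bridge :: "real \<Rightarrow> real \<Rightarrow> 'a \<Rightarrow> real" where
  "bridge s t \<omega> = B s \<omega> - s / t * B t \<omega>"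

lemma bridge_measurable: "0 \<le> s \<Longrightarrow> 0 \<le> t \<Longrightarrow> bridge s t \<in> borel_measurable M"
  unfolding bridge_def using B_measurable[of s] B_measurable[of t] by measurable

text \<open>Completing the square: the joint density of \<open>B s\<close> and the following
  increment equals the density of \<open>B t\<close> at z times the conditional density of
  \<open>B s\<close> given \<open>B t\<close> = z, which is normal with mean
  \<open>s / t * z\<close> and variance \<open>s * (t - s) / t\<close>.\<close>

lemma bridge_density:
  fixes s t :: real
  assumes "0 < s" "s < t"
  shows "normal_density 0 (sqrt s) x * normal_density 0 (sqrt (t - s)) (z - x)
    = normal_density 0 (sqrt t) z * normal_density 0 (sqrt (s * (t - s) / t)) (x - s / t * z)"
proof -
  have sq: "sqrt (2 * pi * s) * sqrt (2 * pi * (t - s))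
      = sqrt (2 * pi * t) * sqrt (2 * pi * (s * (t - s) / t))"
    using assms by (simp add: real_sqrt_mult[symmetric])
  have ex: "- x\<^sup>2 / (2 * s) + - (z - x)\<^sup>2 / (2 * (t - s))
      = - z\<^sup>2 / (2 * t) + - (x - s / t * z)\<^sup>2 / (2 * (s * (t - s) / t))"
    using assms by (simp add: divide_simps power2_eq_square) (simp add: algebra_simps)
  have "normal_density 0 (sqrt s) x * normal_density 0 (sqrt (t - s)) (z - x)
      = exp (- x\<^sup>2 / (2 * s) + - (z - x)\<^sup>2 / (2 * (t - s))) / (sqrt (2 * pi * s) * sqrt (2 * pi * (t - s)))"
    using assms by (simp add: normal_density_def mult_exp_exp)
  also have "\<dots> = normal_density 0 (sqrt t) z * normal_density 0 (sqrt (s * (t - s) / t)) (x - s / t * z)"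
    unfolding sq ex using assms by (simp add: normal_density_def mult_exp_exp)
  finally show ?thesis .
qed

text \<open>The substitutions z = x + y and e = \<open>x - s / t * z\<close> are shears with
  Jacobian 1, and after them \<open>bridge_density\<close> separates the variables e and z.\<close>

lemma bridge_joint:
  assumes st: "0 < s" "s < t" and [measurable]: "A \<in> sets borel" "C \<in> sets borel"
  shows "emeasure M {\<omega>\<in>space M. bridge s t \<omega> \<in> A \<and> B t \<omega> \<in> C}
    = (\<integral>\<^sup>+e. ennreal (normal_density 0 (sqrt (s * (t - s) / t)) e) * indicator A e \<partial>lborel)
      * (\<integral>\<^sup>+z. ennreal (normal_density 0 (sqrt t) z) * indicator C z \<partial>lborel)"
proof -
  let ?n = "\<lambda>v x. ennreal (normal_density 0 (sqrt v) x)"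
  let ?V = "\<lambda>\<omega>. B t \<omega> - B s \<omega>"
  have [measurable]: "B s \<in> borel_measurable M" "B t \<in> borel_measurable M" "bridge s t \<in> borel_measurable M"
    using B_measurable bridge_measurable st by auto
  have "indep_var borel (B s) borel ?V"
    using st by (intro indep_var_of_indep_set[OF subalgebra_F increment_indep, where h="\<lambda>x. x"])
      (auto intro: B_measurable_F)
  then have "indep_var lborel (B s) lborel ?V"
    by (simp add: indep_var_eq)
  then have ind: "distr M lborel (B s) \<Otimes>\<^sub>M distr M lborel ?V = distr M (lborel \<Otimes>\<^sub>M lborel) (\<lambda>x. (B s x, ?V x))"
    unfolding indep_var_distribution_eq by blast
  have d: "distributed M (lborel \<Otimes>\<^sub>M lborel) (\<lambda>x. (B s x, ?V x)) (\<lambda>(x, y). ?n s x * ?n (t - s) y)"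
    using st ind
    by (intro distributed_joint_indep' lborel.sigma_finite_measure_axioms B_distributed increment_distributed) auto
  have density: "?n s x * ?n (t - s) (z - x) = ?n t z * ?n (s * (t - s) / t) (x - s / t * z)" for x z
    unfolding ennreal_mult[OF normal_density_nonneg normal_density_nonneg, symmetric] bridge_density[OF st] ..
  let ?h = "\<lambda>(x, y). indicator A (x - s / t * (x + y)) * indicator C (x + y) :: ennreal"
  have "emeasure M {\<omega>\<in>space M. bridge s t \<omega> \<in> A \<and> B t \<omega> \<in> C}
      = (\<integral>\<^sup>+\<omega>. indicator {\<omega>\<in>space M. bridge s t \<omega> \<in> A \<and> B t \<omega> \<in> C} \<omega> \<partial>M)"
    by simp
  also have "\<dots> = (\<integral>\<^sup>+\<omega>. ?h (B s \<omega>, ?V \<omega>) \<partial>M)"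
    by (intro nn_integral_cong) (auto simp: bridge_def indicator_def)
  also have "\<dots> = (\<integral>\<^sup>+p. (case p of (x, y) \<Rightarrow> ?n s x * ?n (t - s) y) * ?h p \<partial>(lborel \<Otimes>\<^sub>M lborel))"
    by (rule distributed_nn_integral[OF d, symmetric]) measurable
  also have "\<dots> = (\<integral>\<^sup>+x. \<integral>\<^sup>+y. ?n s x * ?n (t - s) y * ?h (x, y) \<partial>lborel \<partial>lborel)"
    by (subst lborel.nn_integral_fst[symmetric]) auto
  also have "\<dots> = (\<integral>\<^sup>+x. \<integral>\<^sup>+z. ?n s x * ?n (t - s) (z - x) * (indicator A (x - s / t * z) * indicator C z) \<partial>lborel \<partial>lborel)"
  proof (rule nn_integral_cong)
    fix x :: real
    have "(\<integral>\<^sup>+y. ?n s x * ?n (t - s) y * ?h (x, y) \<partial>lborel)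
        = ennreal \<bar>1\<bar> * (\<integral>\<^sup>+z. ?n s x * ?n (t - s) (- x + 1 * z) * ?h (x, - x + 1 * z) \<partial>lborel)"
      by (rule nn_integral_real_affine) auto
    then show "(\<integral>\<^sup>+y. ?n s x * ?n (t - s) y * ?h (x, y) \<partial>lborel)
        = (\<integral>\<^sup>+z. ?n s x * ?n (t - s) (z - x) * (indicator A (x - s / t * z) * indicator C z) \<partial>lborel)"
      by simp
  qed
  also have "\<dots> = (\<integral>\<^sup>+x. \<integral>\<^sup>+z. ?n t z * ?n (s * (t - s) / t) (x - s / t * z) * (indicator A (x - s / t * z) * indicator C z) \<partial>lborel \<partial>lborel)"
    by (simp only: density)
  also have "\<dots> = (\<integral>\<^sup>+z. \<integral>\<^sup>+x. ?n t z * ?n (s * (t - s) / t) (x - s / t * z) * (indicator A (x - s / t * z) * indicator C z) \<partial>lborel \<partial>lborel)"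
    by (rule lborel_pair.Fubini') measurable
  also have "\<dots> = (\<integral>\<^sup>+z. (\<integral>\<^sup>+e. ?n (s * (t - s) / t) e * indicator A e \<partial>lborel) * (?n t z * indicator C z) \<partial>lborel)"
  proof (rule nn_integral_cong)
    fix z :: real
    have "(\<integral>\<^sup>+x. ?n t z * ?n (s * (t - s) / t) (x - s / t * z) * (indicator A (x - s / t * z) * indicator C z) \<partial>lborel)
      = ennreal \<bar>1\<bar> * (\<integral>\<^sup>+e. ?n t z * ?n (s * (t - s) / t) ((s / t * z + 1 * e) - s / t * z) *
          (indicator A ((s / t * z + 1 * e) - s / t * z) * indicator C z) \<partial>lborel)"
      by (rule nn_integral_real_affine) auto
    also have "\<dots> = (\<integral>\<^sup>+e. (?n (s * (t - s) / t) e * indicator A e) * (?n t z * indicator C z) \<partial>lborel)"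
      by (simp add: mult_ac)
    also have "\<dots> = (\<integral>\<^sup>+e. ?n (s * (t - s) / t) e * indicator A e \<partial>lborel) * (?n t z * indicator C z)"
      by (rule nn_integral_multc) measurable
    finally show "(\<integral>\<^sup>+x. ?n t z * ?n (s * (t - s) / t) (x - s / t * z) * (indicator A (x - s / t * z) * indicator C z) \<partial>lborel)
      = (\<integral>\<^sup>+e. ?n (s * (t - s) / t) e * indicator A e \<partial>lborel) * (?n t z * indicator C z)" .
  qed
  also have "\<dots> = (\<integral>\<^sup>+e. ?n (s * (t - s) / t) e * indicator A e \<partial>lborel) * (\<integral>\<^sup>+z. ?n t z * indicator C z \<partial>lborel)"
    by (rule nn_integral_cmult) measurable
  finally show ?thesis .
qed

lemma bridge_indep:
  assumes "0 \<le> s" "s < t"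
  shows "indep_set (sets (vimage_algebra (space M) (bridge s t) borel)) (sets (vimage_algebra (space M) (B t) borel))"
proof (rule indep_setI)
  have [measurable]: "bridge s t \<in> borel_measurable M" "B t \<in> borel_measurable M"
    using bridge_measurable B_measurable assms by auto
  show "sets (vimage_algebra (space M) (bridge s t) borel) \<subseteq> events"
    "sets (vimage_algebra (space M) (B t) borel) \<subseteq> events"
    by (auto simp: sets_vimage_algebra2)
  fix a b assume "a \<in> sets (vimage_algebra (space M) (bridge s t) borel)"
    "b \<in> sets (vimage_algebra (space M) (B t) borel)"
  then obtain A C where AC: "A \<in> sets borel" "C \<in> sets borel"
    and ab: "a = bridge s t -` A \<inter> space M" "b = B t -` C \<inter> space M"
    by (auto simp: sets_vimage_algebra2)
  have ab': "a = {\<omega>\<in>space M. bridge s t \<omega> \<in> A}" "b = {\<omega>\<in>space M. B t \<omega> \<in> C}" using ab by auto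
  show "prob (a \<inter> b) = prob a * prob b"
  proof (cases "s = 0")
    case True
    \<comment> \<open>At s = 0 the bridge is constantly 0, with no density; its sigma-algebra is
      trivial and hence independent of everything.\<close>
    have "a = (if 0 \<in> A then space M else {})"
      unfolding ab' using True by (auto simp: bridge_def B_0)
    moreover have "b \<subseteq> space M" using ab by auto
    ultimately show ?thesis by (auto simp: prob_space Int_absorb1)
  next
    case False
    then have st: "0 < s" "s < t" using assms by auto
    have U: "UNIV \<in> sets (borel :: real measure)" by simp
    let ?J = "\<lambda>A C. emeasure M {\<omega>\<in>space M. bridge s t \<omega> \<in> A \<and> B t \<omega> \<in> C}"
    have one: "(\<integral>\<^sup>+x. ennreal (normal_density 0 (sqrt v) x) \<partial>lborel) = 1" if "0 < v" for v
      using that by (subst nn_integral_eq_integral) (auto simp: normal_density_nonneg)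
    \<comment> \<open>Each marginal comes from the same product formula with \<open>UNIV\<close> as
      the other set, since both densities have total mass 1.\<close>
    have "?J A C = ?J A UNIV * ?J UNIV C"
      unfolding bridge_joint[OF st AC] bridge_joint[OF st AC(1) U] bridge_joint[OF st U AC(2)]
      using st by (simp add: one)
    moreover have "a \<inter> b = {\<omega>\<in>space M. bridge s t \<omega> \<in> A \<and> B t \<omega> \<in> C}" using ab by auto
    ultimately have "emeasure M (a \<inter> b) = emeasure M a * emeasure M b"
      by (simp add: ab')
    then show ?thesis
      by (simp add: emeasure_eq_measure ennreal_mult[symmetric] measure_nonneg)
  qed
qed

text \<open>The past of the time-reversed motion, seen at partition points only. The finite upper
  index j makes independence provable by adding one point at a time.\<close>

definition later_values :: "(nat \<Rightarrow> real) \<Rightarrow> nat \<Rightarrow> nat \<Rightarrow> 'a measure" where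
  "later_values \<tau> i j = sigma (space M) (\<Union>r\<in>{i..j}. {B (\<tau> r) -` A \<inter> space M | A. A \<in> sets borel})"

lemma sets_later_values:
  "sets (later_values \<tau> i j) = sigma_sets (space M) (\<Union>r\<in>{i..j}. {B (\<tau> r) -` A \<inter> space M | A. A \<in> sets borel})"
  unfolding later_values_def by (intro sets_measure_of) auto

lemma space_later_values [simp]: "space (later_values \<tau> i j) = space M"
  unfolding later_values_def by (intro space_measure_of) auto

lemma later_values_measurable:
  "i \<le> r \<Longrightarrow> r \<le> j \<Longrightarrow> B (\<tau> r) \<in> borel_measurable (later_values \<tau> i j)"
  by (rule measurableI) (auto simp: sets_later_values intro!: sigma_sets.Basic UN_I[of r])

lemma later_values_subset:
  assumes "space N = space M" "\<And>r. i \<le> r \<Longrightarrow> r \<le> j \<Longrightarrow> B (\<tau> r) \<in> borel_measurable N"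
  shows "sets (later_values \<tau> i j) \<subseteq> sets N"
  unfolding sets_later_values assms(1)[symmetric]
  using measurable_sets[OF assms(2)] by (intro sets.sigma_sets_subset) auto

lemma later_values_subalgebra:
  assumes "\<And>r. 0 \<le> \<tau> r" shows "subalgebra M (later_values \<tau> i j)"
  unfolding subalgebra_def using later_values_subset[of M i j \<tau>] B_measurable assms by simp

text \<open>Induction on j. The values up to \<open>\<tau> (Suc j)\<close> are generated by those up
  to \<open>\<tau> j\<close> and the next increment. That increment is independent of
  \<open>F (\<tau> j)\<close>, which contains both the bridge and the earlier values, so
  \<open>indep_set_join\<close> applies.\<close>

lemma bridge_indep_later_values:
  assumes \<tau>: "strict_mono \<tau>" "\<tau> 0 = 0" and "k < j"
  shows "indep_set (sets (vimage_algebra (space M) (bridge (\<tau> k) (\<tau> (Suc k))) borel))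
    (sets (later_values \<tau> (Suc k) j))"
  using \<open>k < j\<close>
proof (induction j)
  case (Suc j)
  let ?\<epsilon> = "sets (vimage_algebra (space M) (bridge (\<tau> k) (\<tau> (Suc k))) borel)"
  have pos: "0 \<le> \<tau> r" for r using \<tau> by (metis strict_mono_less_eq zero_le)
  have less: "\<tau> r < \<tau> (Suc r)" for r using \<tau> by (simp add: strict_mono_less)
  show ?case
  proof (cases "k = j")
    case True
    \<comment> \<open>The true start of the induction: only the value at
      \<open>\<tau> (Suc k)\<close> is present, the endpoint of the bridge.\<close>
    have "sets (later_values \<tau> (Suc k) (Suc j)) \<subseteq> sets (vimage_algebra (space M) (B (\<tau> (Suc k))) borel)"
      using True by (intro later_values_subset) (auto simp: le_Suc_eq intro: measurable_vimage_algebra1)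
    then show ?thesis
      using indep_set_mono[OF bridge_indep[OF pos less] order_refl] by blast
  next
    case False
    then have IH: "indep_set ?\<epsilon> (sets (later_values \<tau> (Suc k) j))" using Suc by simp
    let ?V = "sets (vimage_algebra (space M) (\<lambda>\<omega>. B (\<tau> (Suc j)) \<omega> - B (\<tau> j) \<omega>) borel)"
    have kj: "Suc k \<le> j" using False Suc by simp
    have mono: "\<tau> r \<le> \<tau> j" if "r \<le> j" for r using \<tau> that by (simp add: strict_mono_less_eq)
    have spF: "space (F (\<tau> j)) = space M" using subalgebra_F[OF pos] by (simp add: subalgebra_def)
    have [measurable]: "B (\<tau> k) \<in> borel_measurable (F (\<tau> j))" "B (\<tau> (Suc k)) \<in> borel_measurable (F (\<tau> j))"
      using B_measurable_F[OF pos mono] kj by auto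
    have "bridge (\<tau> k) (\<tau> (Suc k)) \<in> borel_measurable (F (\<tau> j))"
      unfolding bridge_def by measurable
    then have 1: "?\<epsilon> \<subseteq> sets (F (\<tau> j))"
      using spF by (auto simp: sets_vimage_algebra2 dest: measurable_sets)
    have 2: "sets (later_values \<tau> (Suc k) j) \<subseteq> sets (F (\<tau> j))"
      using B_measurable_F[OF pos mono] by (intro later_values_subset spF) auto
    have st: "Int_stable (sets N)" for N :: "'a measure" by (auto intro: Int_stableI)
    have top: "space M \<in> sets (later_values \<tau> (Suc k) j)" "space M \<in> ?V"
      using sets.top[of "later_values \<tau> (Suc k) j"] sets.top[of "vimage_algebra (space M) (\<lambda>\<omega>. B (\<tau> (Suc j)) \<omega> - B (\<tau> j) \<omega>) borel"]
      by auto
    let ?N = "sigma (space M) (sets (later_values \<tau> (Suc k) j) \<union> ?V)"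
    have ind: "indep_set (sigma_sets (space M) ?\<epsilon>) (sigma_sets (space M) (sets (later_values \<tau> (Suc k) j) \<union> ?V))"
      by (rule indep_set_join[OF IH 1 2 st increment_indep[OF pos less] st st st top])
    have sub: "sets (later_values \<tau> (Suc k) j) \<union> ?V \<subseteq> Pow (space M)"
      using sets.sets_into_space[of _ "later_values \<tau> (Suc k) j"]
        sets.sets_into_space[of _ "vimage_algebra (space M) (\<lambda>\<omega>. B (\<tau> (Suc j)) \<omega> - B (\<tau> j) \<omega>) borel"] by auto
    then have sN: "sets ?N = sigma_sets (space M) (sets (later_values \<tau> (Suc k) j) \<union> ?V)" "space ?N = space M"
      by (auto simp: sets_measure_of space_measure_of)
    have "B (\<tau> r) \<in> borel_measurable ?N" if "Suc k \<le> r" "r \<le> j" for r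
      using later_values_measurable[OF that, of \<tau>] sub
      by (intro measurable_from_subalg[of ?N "later_values \<tau> (Suc k) j"]) (auto simp: subalgebra_def sN)
    moreover have "B (\<tau> (Suc j)) \<in> borel_measurable ?N"
    proof -
      \<comment> \<open>The new value is the increment plus \<open>B (\<tau> j)\<close>, which is
        among the generators because \<open>Suc k \<le> j\<close>.\<close>
      have "(\<lambda>\<omega>. B (\<tau> (Suc j)) \<omega> - B (\<tau> j) \<omega>) \<in> borel_measurable ?N"
        by (rule measurable_from_subalg[of ?N "vimage_algebra (space M) (\<lambda>\<omega>. B (\<tau> (Suc j)) \<omega> - B (\<tau> j) \<omega>) borel"])
          (auto simp: subalgebra_def sN intro: measurable_vimage_algebra1)
      from borel_measurable_add[OF this calculation[OF kj order_refl]] show ?thesis by simp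
    qed
    ultimately have "sets (later_values \<tau> (Suc k) (Suc j)) \<subseteq> sets ?N"
      by (intro later_values_subset) (auto simp: sN le_Suc_eq)
    then show ?thesis
      using ind unfolding sN by (rule indep_set_mono[rotated 2]) auto
  qed
qed simp

text \<open>Only the order t - s of the variance matters. The bridge is
  \<open>(t - s) / t * B s\<close> minus s / t times the increment; with the factor 2 from squaring
  a difference, each of the two terms contributes at most \<open>2 * (t - s)\<close>.\<close>

lemma bridge_moment:
  assumes "0 \<le> s" "s < t"
  shows "integrable M (\<lambda>\<omega>. (bridge s t \<omega>)\<^sup>2)" "expectation (bridge s t) = 0"
    and "expectation (\<lambda>\<omega>. (bridge s t \<omega>)\<^sup>2) \<le> 4 * (t - s)"
proof -
  have t: "0 \<le> t" "0 < t" using assms by auto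
  note m = B_square[OF assms(1)] B_square[OF t(1)] increment_moment(1)[OF assms, where k=2] increment_moment(2,3)[OF assms]
  have [measurable]: "bridge s t \<in> borel_measurable M" "B s \<in> borel_measurable M" "B t \<in> borel_measurable M"
    using bridge_measurable B_measurable assms by auto
  show "expectation (bridge s t) = 0"
    unfolding bridge_def using m by simp
  have le: "(bridge s t \<omega>)\<^sup>2 \<le> 2 * (((t - s) / t)\<^sup>2 * (B s \<omega>)\<^sup>2 + (B t \<omega> - B s \<omega>)\<^sup>2)" for \<omega>
  proof -
    define x y c d where "x = B s \<omega>" and "y = B t \<omega> - B s \<omega>" and "c = (t - s) / t" and "d = s / t"
    have "bridge s t \<omega> = c * x - d * y"
      using t by (simp add: bridge_def x_def y_def c_def d_def field_simps)
    moreover have "(c * x - d * y)\<^sup>2 \<le> 2 * ((c * x)\<^sup>2 + (d * y)\<^sup>2)"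
      using sum_squares_bound[of "c * x" "- (d * y)"] by (simp add: power2_eq_square algebra_simps)
    moreover have "d\<^sup>2 \<le> 1" using assms t by (simp add: d_def power_le_one)
    then have "(d * y)\<^sup>2 \<le> y\<^sup>2"
      using mult_right_mono[of "d\<^sup>2" 1 "y\<^sup>2"] by (simp add: power_mult_distrib)
    ultimately have "(bridge s t \<omega>)\<^sup>2 \<le> 2 * ((c * x)\<^sup>2 + y\<^sup>2)" by simp
    then show ?thesis unfolding power_mult_distrib x_def y_def c_def .
  qed
  have int: "integrable M (\<lambda>\<omega>. 2 * (((t - s) / t)\<^sup>2 * (B s \<omega>)\<^sup>2 + (B t \<omega> - B s \<omega>)\<^sup>2))"
    using m by simp
  show b2: "integrable M (\<lambda>\<omega>. (bridge s t \<omega>)\<^sup>2)"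
    by (rule Bochner_Integration.integrable_bound[OF int]) (use le in \<open>auto intro!: AE_I2 order_trans[OF le]\<close>)
  have "expectation (\<lambda>\<omega>. (bridge s t \<omega>)\<^sup>2) \<le> expectation (\<lambda>\<omega>. 2 * (((t - s) / t)\<^sup>2 * (B s \<omega>)\<^sup>2 + (B t \<omega> - B s \<omega>)\<^sup>2))"
    by (intro integral_mono b2 int le)
  also have "\<dots> = 2 * (((t - s) / t)\<^sup>2 * s + (t - s))"
    using m by simp
  also have "((t - s) / t)\<^sup>2 * s \<le> t - s"
  proof -
    have "(t - s) * s \<le> t\<^sup>2" using assms by (simp add: power2_eq_square mult_mono)
    then have "(t - s) * ((t - s) * s) \<le> (t - s) * t\<^sup>2" using assms by (intro mult_left_mono) auto
    moreover have "((t - s) / t)\<^sup>2 * s = (t - s) * ((t - s) * s) / t\<^sup>2"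
      by (simp add: power_divide power2_eq_square)
    ultimately show ?thesis using t by (simp add: pos_divide_le_eq)
  qed
  finally show "expectation (\<lambda>\<omega>. (bridge s t \<omega>)\<^sup>2) \<le> 4 * (t - s)" by simp
qed

end

section \<open>Sums over left and right endpoints\<close>

text \<open>A lower Riemann sum of the decreasing function \<open>x powr (q - 1)\<close>, whose
  integral up to \<open>\<tau> K\<close> is the right-hand side. Evaluation at right endpoints makes
  the bound independent of the partition, even next to the singularity at 0.\<close>

lemma powr_mesh_sum_le:
  fixes q :: real
  assumes q: "0 < q" "q \<le> 1" and \<tau>: "strict_mono \<tau>" "\<tau> 0 = (0::real)"
  shows "(\<Sum>k<K. (\<tau> (Suc k) - \<tau> k) * \<tau> (Suc k) powr (q - 1)) \<le> \<tau> K powr q / q"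
proof (induction K)
  case 0
  then show ?case using \<tau> q by simp
next
  case (Suc K)
  let ?s = "\<tau> K" and ?t = "\<tau> (Suc K)"
  have s: "0 \<le> ?s" using \<tau> by (metis strict_mono_less_eq zero_le)
  have st: "?s < ?t" using \<tau> by (simp add: strict_mono_less)
  have "(?t - ?s) * ?t powr (q - 1) \<le> (?t powr q - ?s powr q) / q"
  \<comment> \<open>The mean value theorem is not applied at 0, where for q < 1 the power has no
    finite derivative. The first interval is computed directly, and q \<le> 1 gives the
    inequality.\<close>
  proof (cases "?s = 0")
    case True
    have "?t * ?t powr (q - 1) = ?t powr q" using True st by (simp add: powr_mult_base)
    then show ?thesis using True q by (simp add: le_divide_eq mult_left_le)
  next
    case False
    have "\<exists>z. ?s < z \<and> z < ?t \<and> ?t powr q - ?s powr q = (?t - ?s) * (q * z powr (q - 1))"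
      using False s by (intro MVT2[OF st]) (auto intro!: derivative_eq_intros simp: field_simps powr_diff)
    then obtain z where z: "?s < z" "z < ?t" "?t powr q - ?s powr q = (?t - ?s) * (q * z powr (q - 1))"
      by blast
    have "?t powr (q - 1) \<le> z powr (q - 1)"
      using z s q by (intro powr_mono2') auto
    then have "(?t - ?s) * ?t powr (q - 1) \<le> (?t - ?s) * z powr (q - 1)"
      using st by (intro mult_left_mono) auto
    also have "\<dots> = (?t powr q - ?s powr q) / q" using z(3) q by simp
    finally show ?thesis .
  qed
  then show ?case using Suc by (simp add: diff_divide_distrib)
qed

text \<open>Sums over the points below t are partial sums, so a bound on the maximum over j is a
  bound uniform in t.\<close>

lemma partition_below:
  fixes \<tau> :: "nat \<Rightarrow> real"
  assumes "strict_mono \<tau>" "finite {k. \<tau> k \<le> t}"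
  obtains j where "{k. \<tau> k < t} = {..<j}"
proof -
  have fin: "finite {k. \<tau> k < t}" using assms(2) by (rule rev_finite_subset) auto
  have "\<exists>j. {k. \<tau> k < t} = {..<j}"
  proof (cases "{k. \<tau> k < t} = {}")
    case False
    define m where "m = Max {k. \<tau> k < t}"
    have m: "\<tau> m < t" using Max_in[OF fin False] by (simp add: m_def)
    have "{k. \<tau> k < t} = {..<Suc m}"
    proof (intro set_eqI iffI)
      fix k assume "k \<in> {k. \<tau> k < t}"
      then show "k \<in> {..<Suc m}" using Max_ge[OF fin] by (simp add: m_def less_Suc_eq_le)
    next
      fix k assume "k \<in> {..<Suc m}"
      then have "\<tau> k \<le> \<tau> m" using assms(1) by (simp add: strict_mono_less_eq)
      then show "k \<in> {k. \<tau> k < t}" using m by simp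
    qed
    then show ?thesis by blast
  qed auto
  then show ?thesis using that by blast
qed

lemma integrable_nonneg_bound:
  fixes X :: "'a \<Rightarrow> real"
  assumes "X \<in> borel_measurable M" "\<And>\<omega>. 0 \<le> X \<omega>" "(\<integral>\<^sup>+\<omega>. ennreal (X \<omega>) \<partial>M) \<le> ennreal c" "0 \<le> c"
  shows "integrable M X" "(\<integral>\<omega>. X \<omega> \<partial>M) \<le> c"
proof -
  have "(\<integral>\<^sup>+\<omega>. ennreal (X \<omega>) \<partial>M) < \<infinity>" using assms(3) by (rule le_less_trans) simp
  then show *: "integrable M X" using assms(1,2) by (intro integrableI_nonneg) auto
  show "(\<integral>\<omega>. X \<omega> \<partial>M) \<le> c"
    using nn_integral_eq_integral[OF *] assms by simp
qed

lemma (in prob_space) indep_set_commute: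
  assumes "indep_set A C" shows "indep_set C A"
proof (rule indep_setI)
  show "prob (c \<inter> a) = prob c * prob a" if "c \<in> C" "a \<in> A" for c a
    using indep_setD[OF assms that(2,1)] by (simp add: Int_commute mult.commute)
qed (use indep_setD_ev1[OF assms] indep_setD_ev2[OF assms] in auto)

context brownian begin

text \<open>The density bound is demanded only where g does not vanish. For g supported away from a,
  this permits a constant that stays finite as t tends to 0.\<close>

lemma B_shift_nn_integral:
  assumes t: "0 < t" and g[measurable]: "g \<in> borel_measurable borel"
    and dens: "\<And>y. g y \<noteq> 0 \<Longrightarrow> normal_density 0 (sqrt t) (y - a) \<le> C"
  shows "(\<integral>\<^sup>+\<omega>. g (B t \<omega> + a) \<partial>M) \<le> ennreal C * (\<integral>\<^sup>+y. g y \<partial>lborel)"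
proof -
  have "(\<integral>\<^sup>+\<omega>. g (B t \<omega> + a) \<partial>M) = (\<integral>\<^sup>+x. ennreal (normal_density 0 (sqrt t) x) * g (x + a) \<partial>lborel)"
    by (rule distributed_nn_integral[OF B_distributed[OF t], of "\<lambda>x. g (x + a)", symmetric]) measurable
  also have "\<dots> = ennreal \<bar>1\<bar> * (\<integral>\<^sup>+y. ennreal (normal_density 0 (sqrt t) (- a + 1 * y)) * g ((- a + 1 * y) + a) \<partial>lborel)"
    by (rule nn_integral_real_affine) auto
  also have "\<dots> = (\<integral>\<^sup>+y. ennreal (normal_density 0 (sqrt t) (y - a)) * g y \<partial>lborel)"
    by simp
  also have "\<dots> \<le> (\<integral>\<^sup>+y. ennreal C * g y \<partial>lborel)"
  proof (rule nn_integral_mono)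
    fix y
    show "ennreal (normal_density 0 (sqrt t) (y - a)) * g y \<le> ennreal C * g y"
      using dens[of y] by (cases "g y = 0") (auto intro!: mult_right_mono ennreal_leI)
  qed
  also have "\<dots> = ennreal C * (\<integral>\<^sup>+y. g y \<partial>lborel)"
    by (rule nn_integral_cmult) measurable
  finally show ?thesis .
qed

lemma B_shift_square_bound:
  fixes g :: "real \<Rightarrow> real"
  assumes t: "0 < t" and g[measurable]: "g \<in> borel_measurable borel"
    and dens: "\<And>y. g y \<noteq> 0 \<Longrightarrow> normal_density 0 (sqrt t) (y - a) \<le> C"
    and N: "(\<integral>\<^sup>+y. ennreal ((g y)\<^sup>2) \<partial>lborel) \<le> ennreal N" "0 \<le> N" "0 \<le> C"
  shows "integrable M (\<lambda>\<omega>. (g (B t \<omega> + a))\<^sup>2)" "expectation (\<lambda>\<omega>. (g (B t \<omega> + a))\<^sup>2) \<le> C * N"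
proof -
  have [measurable]: "B t \<in> borel_measurable M" using B_measurable t by simp
  have "(\<integral>\<^sup>+\<omega>. ennreal ((g (B t \<omega> + a))\<^sup>2) \<partial>M) \<le> ennreal C * (\<integral>\<^sup>+y. ennreal ((g y)\<^sup>2) \<partial>lborel)"
    using dens by (intro B_shift_nn_integral[OF t]) auto
  also have "\<dots> \<le> ennreal (C * N)"
    using N by (simp add: ennreal_mult mult_left_mono)
  finally have *: "(\<integral>\<^sup>+\<omega>. ennreal ((g (B t \<omega> + a))\<^sup>2) \<partial>M) \<le> ennreal (C * N)" .
  show "integrable M (\<lambda>\<omega>. (g (B t \<omega> + a))\<^sup>2)" "expectation (\<lambda>\<omega>. (g (B t \<omega> + a))\<^sup>2) \<le> C * N"
    using integrable_nonneg_bound[OF _ _ *] N by auto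
qed

lemma normal_density_le_sqrt:
  assumes "0 < t" shows "normal_density 0 (sqrt t) x \<le> t powr (- 1/2)"
proof -
  have "1 \<le> 2 * pi" using pi_gt3 by simp
  then have "sqrt t \<le> sqrt (2 * pi * t)" using assms by simp
  then have "1 / sqrt (2 * pi * t) \<le> 1 / sqrt t" using assms by (intro divide_left_mono) auto
  then have "normal_density 0 (sqrt t) x \<le> 1 / sqrt t * 1"
    unfolding normal_density_def using assms by (intro mult_mono) auto
  also have "\<dots> = t powr (- 1/2)" using assms by (simp add: powr_half_sqrt powr_minus_divide)
  finally show ?thesis .
qed

text \<open>With u = \<open>r / sqrt t\<close>, the bound u * exp(-u^2/2) \<le> 1 trades the factor
  \<open>1 / sqrt t\<close> of the density for 1 / r, uniformly in t.\<close>

lemma normal_density_le_away: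
  assumes "0 < t" "0 < r" "r \<le> \<bar>x\<bar>" shows "normal_density 0 (sqrt t) x \<le> 1 / r"
proof -
  define u where "u = r / sqrt t"
  have u: "0 < u" using assms by (simp add: u_def)
  have "u \<le> 1 + u\<^sup>2 / 2" using sum_squares_bound[of u 1] by (simp add: power2_eq_square)
  also have "\<dots> \<le> exp (u\<^sup>2 / 2)" by (rule exp_ge_add_one_self)
  finally have u_le: "exp (- (u\<^sup>2 / 2)) \<le> 1 / u" using u by (simp add: exp_minus field_simps)
  have "r\<^sup>2 \<le> x\<^sup>2" using assms by (metis abs_le_square_iff abs_of_pos)
  then have "u\<^sup>2 \<le> x\<^sup>2 / t" using assms by (simp add: u_def power_divide divide_right_mono)
  then have "exp (- (x\<^sup>2 / (2 * t))) \<le> exp (- (u\<^sup>2 / 2))" by (simp add: field_simps)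
  from order_trans[OF this u_le] have e: "exp (- (x\<^sup>2 / (2 * t))) \<le> 1 / u" .
  have "1 \<le> 2 * pi" using pi_gt3 by simp
  then have "sqrt t \<le> sqrt (2 * pi * t)" using assms by simp
  then have "1 / sqrt (2 * pi * t) \<le> 1 / sqrt t" using assms by (intro divide_left_mono) auto
  then have "normal_density 0 (sqrt t) x \<le> 1 / sqrt t * (1 / u)"
    unfolding normal_density_def using assms e by (intro mult_mono) auto
  also have "\<dots> = 1 / r" using assms by (simp add: u_def)
  finally show ?thesis .
qed

text \<open>The integrand at a left endpoint is known before the increment, so the maximal
  inequality applies along F itself. The sum of second moments stays a hypothesis, because bounding
  it has to cope with the singular density near time 0.\<close>

lemma forward_sum_bound:
  fixes g :: "real \<Rightarrow> real"
  assumes \<tau>: "strict_mono \<tau>" "\<tau> 0 = 0" "\<And>t. finite {k. \<tau> k \<le> t}" and K: "{k. \<tau> k < T} = {..<K}"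
    and g[measurable]: "g \<in> borel_measurable borel"
    and int: "\<And>k. k < K \<Longrightarrow> integrable M (\<lambda>\<omega>. (g (B (\<tau> k) \<omega> + a))\<^sup>2)"
    and c: "0 < c"
    and bound: "(\<Sum>k<K. expectation (\<lambda>\<omega>. (g (B (\<tau> k) \<omega> + a))\<^sup>2) * (\<tau> (Suc k) - \<tau> k)) \<le> p * c\<^sup>2"
  shows "holds_up_to M p (\<lambda>\<omega>. \<forall>t\<in>{0..T}.
    \<bar>\<Sum>k | \<tau> k < t. g (B (\<tau> k) \<omega> + a) * (B (\<tau> (Suc k)) \<omega> - B (\<tau> k) \<omega>)\<bar> \<le> c)"
proof -
  have pos: "0 \<le> \<tau> r" for r using \<tau> by (metis strict_mono_less_eq zero_le)
  have less: "\<tau> r < \<tau> (Suc r)" for r using \<tau> by (simp add: strict_mono_less)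
  have mono: "\<tau> i \<le> \<tau> j" if "i \<le> j" for i j using \<tau> that by (simp add: strict_mono_less_eq)
  have BF: "B (\<tau> i) \<in> borel_measurable (F (\<tau> j))" if "i \<le> j" for i j
    using B_measurable_F[OF pos mono[OF that]] .
  have "holds_up_to M p (\<lambda>\<omega>. \<forall>j\<le>K. \<bar>\<Sum>k<j. g (B (\<tau> k) \<omega> + a) * (B (\<tau> (Suc k)) \<omega> - B (\<tau> k) \<omega>)\<bar> \<le> c)"
  proof (rule martingale_maximal[where G="\<lambda>k. F (\<tau> k)"])
    show "subalgebra M (F (\<tau> k))" for k using subalgebra_F pos by blast
    have *: "(\<lambda>\<omega>. g (B (\<tau> j) \<omega> + a)) \<in> borel_measurable (F (\<tau> k))" if "j \<le> k" for j k
      using BF[OF that] by measurable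
    then show "(\<lambda>\<omega>. g (B (\<tau> k) \<omega> + a)) \<in> borel_measurable (F (\<tau> k))" for k by simp
    show "(\<lambda>\<omega>. g (B (\<tau> j) \<omega> + a)) \<in> borel_measurable (F (\<tau> k))" if "j < k" for j k using * that by simp
    show "(\<lambda>\<omega>. B (\<tau> (Suc j)) \<omega> - B (\<tau> j) \<omega>) \<in> borel_measurable (F (\<tau> k))" if "j < k" for j k
      using BF[of "Suc j" k] BF[of j k] that by simp
  qed (use increment_measurable increment_indep increment_moment pos less int c bound in auto)
  then show ?thesis
  proof (rule holds_up_to_mono[OF _ order_refl])
    fix \<omega> assume *: "\<forall>j\<le>K. \<bar>\<Sum>k<j. g (B (\<tau> k) \<omega> + a) * (B (\<tau> (Suc k)) \<omega> - B (\<tau> k) \<omega>)\<bar> \<le> c"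
    show "\<forall>t\<in>{0..T}. \<bar>\<Sum>k | \<tau> k < t. g (B (\<tau> k) \<omega> + a) * (B (\<tau> (Suc k)) \<omega> - B (\<tau> k) \<omega>)\<bar> \<le> c"
    proof
      fix t assume t: "t \<in> {0..T}"
      obtain j where j: "{k. \<tau> k < t} = {..<j}" using partition_below[OF \<tau>(1,3)] .
      have "{..<j} \<subseteq> {..<K}" unfolding j[symmetric] K[symmetric] using t by auto
      then have "j \<le> K" by simp
      then show "\<bar>\<Sum>k | \<tau> k < t. g (B (\<tau> k) \<omega> + a) * (B (\<tau> (Suc k)) \<omega> - B (\<tau> k) \<omega>)\<bar> \<le> c"
        unfolding j using * by blast
    qed
  qed
qed

text \<open>Writing the increment as \<open>(t - s) / t * B t\<close> minus the bridge value turns a sum with integrands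
  evaluated at the right endpoints into a drift and a martingale run backwards in time.\<close>

lemma backward_sum_bound:
  fixes g :: "real \<Rightarrow> real"
  assumes \<tau>: "strict_mono \<tau>" "\<tau> 0 = 0" "\<And>t. finite {k. \<tau> k \<le> t}" and K: "{k. \<tau> k < T} = {..<K}"
    and mesh: "\<And>k. \<tau> (Suc k) - \<tau> k \<le> 1" and T: "0 \<le> T"
    and g[measurable]: "g \<in> borel_measurable borel"
    and N: "(\<integral>\<^sup>+y. ennreal ((g y)\<^sup>2) \<partial>lborel) \<le> ennreal N" "0 < N"
    and c: "0 < c"
    and bound1: "8 * N * (T + 1) powr (1/2) \<le> p/2 * (c/4)\<^sup>2"
    and bound2: "4 * sqrt N * (T + 1) powr (1/4) \<le> p/2 * (c/2)"
  shows "holds_up_to M p (\<lambda>\<omega>. \<forall>t\<in>{0..T}.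
    \<bar>\<Sum>k | \<tau> k < t. g (B (\<tau> (Suc k)) \<omega> + a) * (B (\<tau> (Suc k)) \<omega> - B (\<tau> k) \<omega>)\<bar> \<le> c)"
proof -
  have pos: "0 \<le> \<tau> r" for r using \<tau> by (metis strict_mono_less_eq zero_le)
  have less: "\<tau> r < \<tau> (Suc r)" for r using \<tau> by (simp add: strict_mono_less)
  have pos': "0 < \<tau> (Suc r)" for r using pos[of r] less[of r] by simp
  have [measurable]: "B (\<tau> r) \<in> borel_measurable M" for r using B_measurable pos by simp
  \<comment> \<open>The last interval starts before T but may reach beyond it by one mesh
    step.\<close>
  have \<tau>K: "\<tau> K \<le> T + 1"
  proof (cases K)
    case 0
    then show ?thesis using \<tau> T by simp
  next
    case (Suc k)
    then have "\<tau> k < T" using K by blast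
    then show ?thesis using mesh[of k] Suc by simp
  qed
  let ?W = "\<lambda>k \<omega>. B (\<tau> k) \<omega> + a"
  have Wint: "integrable M (\<lambda>\<omega>. (g (?W (Suc k) \<omega>))\<^sup>2)"
    and WE: "expectation (\<lambda>\<omega>. (g (?W (Suc k) \<omega>))\<^sup>2) \<le> \<tau> (Suc k) powr (- 1/2) * N" for k
    using B_shift_square_bound[OF pos' g normal_density_le_sqrt[OF pos'] N(1)] N(2) by auto
  define d where "d k \<omega> = g (?W (Suc k) \<omega>) * bridge (\<tau> k) (\<tau> (Suc k)) \<omega>" for k \<omega>
  \<comment> \<open>Step i of reversed time handles the interval with index
    \<open>K - Suc i\<close>. Its multiplier and all terms of earlier steps use only points of index
    at least \<open>K - i\<close>, the past of reversed time.\<close>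
  have mart: "holds_up_to M (p/2) (\<lambda>\<omega>. \<forall>j\<le>K. \<bar>\<Sum>i<j. g (?W (K - i) \<omega>) * bridge (\<tau> (K - Suc i)) (\<tau> (K - i)) \<omega>\<bar> \<le> c/4)"
  proof (rule martingale_maximal[where G="\<lambda>i. later_values \<tau> (K - i) K"])
    fix i assume i: "i < K"
    define k where "k = K - Suc i"
    have k: "K - i = Suc k" "K - Suc i = k" "k < K" using i by (auto simp: k_def)
    show "subalgebra M (later_values \<tau> (K - i) K)" using later_values_subalgebra pos by blast
    show "(\<lambda>\<omega>. g (?W (K - i) \<omega>)) \<in> borel_measurable (later_values \<tau> (K - i) K)"
      using later_values_measurable[of "K - i" "K - i" K \<tau>] by simp
    show "bridge (\<tau> (K - Suc i)) (\<tau> (K - i)) \<in> borel_measurable M"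
      using bridge_measurable pos by blast
    have "indep_set (sets (later_values \<tau> (Suc k) K)) (sets (vimage_algebra (space M) (bridge (\<tau> k) (\<tau> (Suc k))) borel))"
      by (rule indep_set_commute[OF bridge_indep_later_values[OF \<tau>(1,2) k(3)]])
    then show "indep_set (sets (later_values \<tau> (K - i) K)) (sets (vimage_algebra (space M) (bridge (\<tau> (K - Suc i)) (\<tau> (K - i))) borel))"
      unfolding k .
    show "integrable M (\<lambda>\<omega>. (g (?W (K - i) \<omega>))\<^sup>2)" unfolding k by (rule Wint)
    show "integrable M (\<lambda>\<omega>. (bridge (\<tau> (K - Suc i)) (\<tau> (K - i)) \<omega>)\<^sup>2)"
      "expectation (bridge (\<tau> (K - Suc i)) (\<tau> (K - i))) = 0"
      unfolding k using bridge_moment[OF pos less] by auto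
  next
    fix j i assume ij: "j < i" "i < K"
    show "(\<lambda>\<omega>. g (?W (K - j) \<omega>)) \<in> borel_measurable (later_values \<tau> (K - i) K)"
      using later_values_measurable[of "K - i" "K - j" K \<tau>] ij by simp
    show "bridge (\<tau> (K - Suc j)) (\<tau> (K - j)) \<in> borel_measurable (later_values \<tau> (K - i) K)"
      using later_values_measurable[of "K - i" "K - j" K \<tau>] later_values_measurable[of "K - i" "K - Suc j" K \<tau>] ij
      unfolding bridge_def by simp
  next
    have "(\<Sum>i<K. expectation (\<lambda>\<omega>. (g (?W (K - i) \<omega>))\<^sup>2) * expectation (\<lambda>\<omega>. (bridge (\<tau> (K - Suc i)) (\<tau> (K - i)) \<omega>)\<^sup>2))
      = (\<Sum>k<K. expectation (\<lambda>\<omega>. (g (?W (Suc k) \<omega>))\<^sup>2) * expectation (\<lambda>\<omega>. (bridge (\<tau> k) (\<tau> (Suc k)) \<omega>)\<^sup>2))"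
      by (subst sum.nat_diff_reindex[symmetric]) (auto intro!: sum.cong simp: Suc_diff_Suc)
    also have "\<dots> \<le> (\<Sum>k<K. (\<tau> (Suc k) powr (- 1/2) * N) * (4 * (\<tau> (Suc k) - \<tau> k)))"
      using WE bridge_moment(3)[OF pos less] N(2) by (intro sum_mono mult_mono) auto
    also have "\<dots> = 4 * N * (\<Sum>k<K. (\<tau> (Suc k) - \<tau> k) * \<tau> (Suc k) powr (1/2 - 1))"
      unfolding sum_distrib_left by (rule sum.cong) (simp_all add: algebra_simps)
    also have "\<dots> \<le> 4 * N * (\<tau> K powr (1/2) / (1/2))"
      using powr_mesh_sum_le[OF _ _ \<tau>(1,2), of "1/2" K] N(2) by (intro mult_left_mono) auto
    also have "\<dots> \<le> 8 * N * (T + 1) powr (1/2)"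
      using powr_mono2[of "1/2" "\<tau> K" "T + 1"] \<tau>K pos[of K] N(2) by simp
    finally show "(\<Sum>i<K. expectation (\<lambda>\<omega>. (g (?W (K - i) \<omega>))\<^sup>2) * expectation (\<lambda>\<omega>. (bridge (\<tau> (K - Suc i)) (\<tau> (K - i)) \<omega>)\<^sup>2))
      \<le> p/2 * (c/4)\<^sup>2"
      using bound1 by simp
  qed (use c in auto)
  let ?r = "\<lambda>k. (\<tau> (Suc k) - \<tau> k) / \<tau> (Suc k)"
  \<comment> \<open>One nonnegative sum dominates the drift for all t at once, so Markov's
    inequality suffices here instead of a maximal inequality.\<close>
  define R where "R \<omega> = (\<Sum>k<K. ?r k * (\<bar>g (?W (Suc k) \<omega>)\<bar> * \<bar>B (\<tau> (Suc k)) \<omega>\<bar>))" for \<omega>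
  have gB: "integrable M (\<lambda>\<omega>. \<bar>g (?W (Suc k) \<omega>)\<bar> * \<bar>B (\<tau> (Suc k)) \<omega>\<bar>)"
    and gBE: "?r k * expectation (\<lambda>\<omega>. \<bar>g (?W (Suc k) \<omega>)\<bar> * \<bar>B (\<tau> (Suc k)) \<omega>\<bar>)
      \<le> sqrt N * ((\<tau> (Suc k) - \<tau> k) * \<tau> (Suc k) powr (1/4 - 1))" for k
  proof -
    let ?t = "\<tau> (Suc k)"
    \<comment> \<open>The weight balancing the two terms of Young's inequality, whose expectations
      are at most of order \<open>N * ?t powr (-1/2)\<close> and \<open>?t\<close>. The result is
      the Cauchy-Schwarz bound \<open>sqrt N * ?t powr (1/4)\<close>, and dividing by
      \<open>?t\<close> leaves the integrable exponent 1/4 - 1.\<close>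
    define l where "l = ?t powr (3/4) / sqrt N"
    have l: "0 < l" using pos'[of k] N(2) by (simp add: l_def)
    have le: "\<bar>x\<bar> * \<bar>y\<bar> \<le> (l * x\<^sup>2 + y\<^sup>2 / l) / 2" for x y :: real
    proof -
      have "0 \<le> (l * \<bar>x\<bar> - \<bar>y\<bar>)\<^sup>2 / l" using l by simp
      also have "\<dots> = l * x\<^sup>2 + y\<^sup>2 / l - 2 * (\<bar>x\<bar> * \<bar>y\<bar>)"
        using l by (simp add: power2_diff power_mult_distrib field_simps) (simp add: power2_eq_square)
      finally show ?thesis by simp
    qed
    note b = B_square[of ?t, OF less_imp_le[OF pos']]
    show i: "integrable M (\<lambda>\<omega>. \<bar>g (?W (Suc k) \<omega>)\<bar> * \<bar>B ?t \<omega>\<bar>)"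
      using Wint[of k] b(1) by (intro integrable_square_mult) auto
    have "expectation (\<lambda>\<omega>. \<bar>g (?W (Suc k) \<omega>)\<bar> * \<bar>B ?t \<omega>\<bar>)
        \<le> expectation (\<lambda>\<omega>. (l * (g (?W (Suc k) \<omega>))\<^sup>2 + (B ?t \<omega>)\<^sup>2 / l) / 2)"
      using Wint[of k] b(1) le by (intro integral_mono i) auto
    also have "\<dots> = (l * expectation (\<lambda>\<omega>. (g (?W (Suc k) \<omega>))\<^sup>2) + ?t / l) / 2"
      using Wint[of k] b(1,2) by simp
    also have "\<dots> \<le> (l * (?t powr (- 1/2) * N) + ?t / l) / 2"
      using WE[of k] l by simp
    also have "\<dots> = sqrt N * ?t powr (1/4)"
    proof -
      have "l * (?t powr (- 1/2) * N) = (?t powr (3/4) * ?t powr (- 1/2)) * (N / sqrt N)"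
        by (simp add: l_def)
      also have "\<dots> = ?t powr (1/4) * sqrt N"
        using N(2) by (simp add: powr_add[symmetric] real_div_sqrt)
      finally have 1: "l * (?t powr (- 1/2) * N) = ?t powr (1/4) * sqrt N" .
      have "?t / l = sqrt N * (?t powr 1 / ?t powr (3/4))"
        using pos'[of k] by (simp add: l_def)
      also have "\<dots> = sqrt N * ?t powr (1/4)" unfolding powr_diff[symmetric] by simp
      finally show ?thesis using 1 by simp
    qed
    finally have "?r k * expectation (\<lambda>\<omega>. \<bar>g (?W (Suc k) \<omega>)\<bar> * \<bar>B ?t \<omega>\<bar>) \<le> ?r k * (sqrt N * ?t powr (1/4))"
      using less[of k] pos'[of k] by (intro mult_left_mono) auto
    also have "\<dots> = sqrt N * ((?t - \<tau> k) * ?t powr (1/4 - 1))"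
      using pos'[of k] by (simp only: powr_diff) simp
    finally show "?r k * expectation (\<lambda>\<omega>. \<bar>g (?W (Suc k) \<omega>)\<bar> * \<bar>B ?t \<omega>\<bar>)
      \<le> sqrt N * ((?t - \<tau> k) * ?t powr (1/4 - 1))" .
  qed
  have drift: "holds_up_to M (p/2) (\<lambda>\<omega>. R \<omega> \<le> c/2)"
  proof (rule holds_up_to_Markov)
    show "integrable M R" unfolding R_def using gB by (intro Bochner_Integration.integrable_sum integrable_mult_right) auto
    show "0 \<le> R \<omega>" for \<omega> unfolding R_def using less pos' by (intro sum_nonneg mult_nonneg_nonneg divide_nonneg_nonneg) (auto simp: less_imp_le)
    have "expectation R = (\<Sum>k<K. ?r k * expectation (\<lambda>\<omega>. \<bar>g (?W (Suc k) \<omega>)\<bar> * \<bar>B (\<tau> (Suc k)) \<omega>\<bar>))"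
      unfolding R_def using gB by (subst Bochner_Integration.integral_sum) auto
    also have "\<dots> \<le> (\<Sum>k<K. sqrt N * ((\<tau> (Suc k) - \<tau> k) * \<tau> (Suc k) powr (1/4 - 1)))"
      by (intro sum_mono gBE)
    also have "\<dots> = sqrt N * (\<Sum>k<K. (\<tau> (Suc k) - \<tau> k) * \<tau> (Suc k) powr (1/4 - 1))"
      by (simp only: sum_distrib_left)
    also have "\<dots> \<le> sqrt N * (\<tau> K powr (1/4) / (1/4))"
      using powr_mesh_sum_le[OF _ _ \<tau>(1,2), of "1/4" K] N(2) by (intro mult_left_mono) auto
    also have "\<dots> \<le> 4 * sqrt N * (T + 1) powr (1/4)"
      using powr_mono2[of "1/4" "\<tau> K" "T + 1"] \<tau>K pos[of K] N(2) by simp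
    finally show "expectation R \<le> p/2 * (c/2)" using bound2 by simp
  qed (use c in auto)
  show ?thesis
  proof (rule holds_up_to_mono[OF holds_up_to_conj[OF mart drift]])
    fix \<omega> assume *: "(\<forall>j\<le>K. \<bar>\<Sum>i<j. g (?W (K - i) \<omega>) * bridge (\<tau> (K - Suc i)) (\<tau> (K - i)) \<omega>\<bar> \<le> c/4) \<and> R \<omega> \<le> c/2"
    have tail: "\<bar>\<Sum>k\<in>{j..<K}. d k \<omega>\<bar> \<le> c/4" if "j \<le> K" for j
    proof -
      have "(\<Sum>i<K - j. g (?W (K - i) \<omega>) * bridge (\<tau> (K - Suc i)) (\<tau> (K - i)) \<omega>) = (\<Sum>k\<in>{j..<K}. d k \<omega>)"
        by (rule sum.reindex_bij_witness[of _ "\<lambda>k. K - Suc k" "\<lambda>i. K - Suc i"])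
          (auto simp: d_def Suc_diff_Suc)
      then show ?thesis using spec[OF conjunct1[OF *], of "K - j"] by simp
    qed
    \<comment> \<open>The reversed martingale controls tails. A sum from the start is the difference
      of two tails, which turns c/4 into c/2.\<close>
    have head: "\<bar>\<Sum>k<j. d k \<omega>\<bar> \<le> c/2" if "j \<le> K" for j
    proof -
      have "(\<Sum>k\<in>{0..<K}. d k \<omega>) = (\<Sum>k\<in>{0..<j}. d k \<omega>) + (\<Sum>k\<in>{j..<K}. d k \<omega>)"
        using that by (simp add: sum.atLeastLessThan_concat)
      moreover have "\<bar>\<Sum>k\<in>{0..<K}. d k \<omega>\<bar> \<le> c/4" using tail[of 0] by blast
      ultimately show ?thesis using tail[OF that] unfolding atLeast0LessThan by linarith
    qed
    show "\<forall>t\<in>{0..T}. \<bar>\<Sum>k | \<tau> k < t. g (?W (Suc k) \<omega>) * (B (\<tau> (Suc k)) \<omega> - B (\<tau> k) \<omega>)\<bar> \<le> c"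
    proof
      fix t assume t: "t \<in> {0..T}"
      obtain j where j: "{k. \<tau> k < t} = {..<j}" using partition_below[OF \<tau>(1,3)] .
      have "{..<j} \<subseteq> {..<K}" unfolding j[symmetric] K[symmetric] using t by auto
      then have jK: "j \<le> K" by simp
      have "(\<Sum>k<j. g (?W (Suc k) \<omega>) * (B (\<tau> (Suc k)) \<omega> - B (\<tau> k) \<omega>))
          = (\<Sum>k<j. ?r k * (g (?W (Suc k) \<omega>) * B (\<tau> (Suc k)) \<omega>)) - (\<Sum>k<j. d k \<omega>)"
        unfolding sum_subtractf[symmetric]
      proof (rule sum.cong[OF refl])
        fix k
        have "B (\<tau> (Suc k)) \<omega> - B (\<tau> k) \<omega> = ?r k * B (\<tau> (Suc k)) \<omega> - bridge (\<tau> k) (\<tau> (Suc k)) \<omega>"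
          using pos'[of k] by (simp add: bridge_def field_simps)
        then show "g (?W (Suc k) \<omega>) * (B (\<tau> (Suc k)) \<omega> - B (\<tau> k) \<omega>)
            = ?r k * (g (?W (Suc k) \<omega>) * B (\<tau> (Suc k)) \<omega>) - d k \<omega>"
          by (simp only: d_def right_diff_distrib mult_ac)
      qed
      moreover have "\<bar>\<Sum>k<j. ?r k * (g (?W (Suc k) \<omega>) * B (\<tau> (Suc k)) \<omega>)\<bar> \<le> c/2"
      proof -
        have "\<bar>\<Sum>k<j. ?r k * (g (?W (Suc k) \<omega>) * B (\<tau> (Suc k)) \<omega>)\<bar>
            \<le> (\<Sum>k<j. \<bar>?r k * (g (?W (Suc k) \<omega>) * B (\<tau> (Suc k)) \<omega>)\<bar>)" by (rule sum_abs)
        also have "\<dots> = (\<Sum>k<j. ?r k * (\<bar>g (?W (Suc k) \<omega>)\<bar> * \<bar>B (\<tau> (Suc k)) \<omega>\<bar>))"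
          using less pos' by (intro sum.cong) (auto simp: abs_mult less_imp_le)
        also have "\<dots> \<le> R \<omega>" unfolding R_def using jK less pos'
          by (intro sum_mono2 mult_nonneg_nonneg divide_nonneg_nonneg) (auto simp: less_imp_le)
        finally show ?thesis using * by simp
      qed
      ultimately show "\<bar>\<Sum>k | \<tau> k < t. g (?W (Suc k) \<omega>) * (B (\<tau> (Suc k)) \<omega> - B (\<tau> k) \<omega>)\<bar> \<le> c"
        unfolding j using head[OF jK] by linarith
    qed
  qed simp
qed

end

section \<open>Path estimates\<close>

text \<open>The remainders are measured by the oscillation \<eta> of h, since h is merely continuous
  in the application and no third derivative is available. The bound for F follows from the one for
  f by the mean value inequality.\<close>

lemma second_order_step:
  fixes F f h :: "real \<Rightarrow> real"
  assumes F: "\<And>x. (F has_real_derivative f x) (at x)" and f: "\<And>x. (f has_real_derivative h x) (at x)"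
    and osc: "\<And>u. min x y \<le> u \<Longrightarrow> u \<le> max x y \<Longrightarrow> \<bar>h u - h x\<bar> \<le> \<eta>"
  shows "\<bar>f y - f x - h x * (y - x)\<bar> \<le> \<eta> * \<bar>y - x\<bar>"
    and "\<bar>F y - F x - f x * (y - x) - h x * (y - x)\<^sup>2 / 2\<bar> \<le> \<eta> * (y - x)\<^sup>2"
proof -
  have 1: "\<bar>f u - f x - h x * (u - x)\<bar> \<le> \<eta> * \<bar>u - x\<bar>" if "min x y \<le> u" "u \<le> max x y" for u
  proof -
    have "norm ((\<lambda>v. f v - h x * (v - x)) u - (\<lambda>v. f v - h x * (v - x)) x) \<le> \<eta> * norm (u - x)"
    proof (rule field_differentiable_bound[where S="{min x y..max x y}" and f'="\<lambda>v. h v - h x"])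
      show "((\<lambda>v. f v - h x * (v - x)) has_field_derivative h v - h x) (at v within {min x y..max x y})" for v
        by (rule has_field_derivative_at_within) (auto intro!: derivative_eq_intros f)
    qed (use osc that in auto)
    then show ?thesis by (simp add: algebra_simps)
  qed
  then show "\<bar>f y - f x - h x * (y - x)\<bar> \<le> \<eta> * \<bar>y - x\<bar>" by simp
  have \<eta>: "0 \<le> \<eta>" using osc[of x] by auto
  have "norm ((\<lambda>v. F v - f x * (v - x) - h x * (v - x)\<^sup>2 / 2) y - (\<lambda>v. F v - f x * (v - x) - h x * (v - x)\<^sup>2 / 2) x)
      \<le> (\<eta> * \<bar>y - x\<bar>) * norm (y - x)"
  proof (rule field_differentiable_bound[where S="{min x y..max x y}" and f'="\<lambda>v. f v - f x - h x * (v - x)"])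
    show "((\<lambda>v. F v - f x * (v - x) - h x * (v - x)\<^sup>2 / 2) has_field_derivative f v - f x - h x * (v - x))
        (at v within {min x y..max x y})" for v
      by (rule has_field_derivative_at_within) (auto intro!: derivative_eq_intros F)
    show "norm (f v - f x - h x * (v - x)) \<le> \<eta> * \<bar>y - x\<bar>" if "v \<in> {min x y..max x y}" for v
    proof -
      have "\<bar>v - x\<bar> \<le> \<bar>y - x\<bar>" using that by auto
      then show ?thesis using 1[of v] that \<eta> by (auto intro: order_trans mult_left_mono)
    qed
  qed auto
  then show "\<bar>F y - F x - f x * (y - x) - h x * (y - x)\<^sup>2 / 2\<bar> \<le> \<eta> * (y - x)\<^sup>2"
    by (simp add: power2_eq_square algebra_simps abs_mult_self_eq)
qed

text \<open>For left endpoints the second-order term of F survives and becomes the Ito correction.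
  For the trapezoidal sum it cancels against the first-order term of f, which is the reason for the
  chain rule of Stratonovich type. All remainders are of size \<eta> times the quadratic
  sum.\<close>

lemma second_order_sums:
  fixes F f h :: "real \<Rightarrow> real" and x :: "nat \<Rightarrow> real"
  assumes F: "\<And>x. (F has_real_derivative f x) (at x)" and f: "\<And>x. (f has_real_derivative h x) (at x)"
    and osc: "\<And>u v. \<bar>u\<bar> \<le> R \<Longrightarrow> \<bar>v\<bar> \<le> R \<Longrightarrow> \<bar>u - v\<bar> \<le> \<delta> \<Longrightarrow> \<bar>h u - h v\<bar> \<le> \<eta>"
    and x: "\<And>k. k \<le> j \<Longrightarrow> \<bar>x k\<bar> \<le> R" "\<And>k. k < j \<Longrightarrow> \<bar>x (Suc k) - x k\<bar> \<le> \<delta>"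
    and V: "(\<Sum>k<j. (x (Suc k) - x k)\<^sup>2) \<le> V" and \<eta>: "0 \<le> \<eta>"
  shows "\<bar>(\<Sum>k<j. f (x k) * (x (Suc k) - x k)) - (F (x j) - F (x 0)) + (\<Sum>k<j. h (x k) * (x (Suc k) - x k)\<^sup>2) / 2\<bar> \<le> \<eta> * V"
    and "\<bar>(\<Sum>k<j. (f (x k) + f (x (Suc k))) / 2 * (x (Suc k) - x k)) - (F (x j) - F (x 0))\<bar> \<le> 2 * \<eta> * V"
proof -
  let ?d = "\<lambda>k. x (Suc k) - x k"
  define r where "r k = F (x (Suc k)) - F (x k) - f (x k) * ?d k - h (x k) * (?d k)\<^sup>2 / 2" for k
  define q where "q k = f (x (Suc k)) - f (x k) - h (x k) * ?d k" for k
  have step: "\<bar>r k\<bar> \<le> \<eta> * (?d k)\<^sup>2" "\<bar>q k\<bar> \<le> \<eta> * \<bar>?d k\<bar>" if "k < j" for k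
  proof -
    have "\<bar>h u - h (x k)\<bar> \<le> \<eta>" if u: "min (x k) (x (Suc k)) \<le> u" "u \<le> max (x k) (x (Suc k))" for u
      using x(1)[of k] x(1)[of "Suc k"] x(2)[of k] \<open>k < j\<close> u by (intro osc) auto
    from second_order_step[OF F f this] show "\<bar>r k\<bar> \<le> \<eta> * (?d k)\<^sup>2" "\<bar>q k\<bar> \<le> \<eta> * \<bar>?d k\<bar>"
      unfolding r_def q_def by blast+
  qed
  have tele: "(\<Sum>k<j. F (x (Suc k)) - F (x k)) = F (x j) - F (x 0)"
    by (rule sum_lessThan_telescope)
  have V': "(\<Sum>k<j. \<eta> * (?d k)\<^sup>2) \<le> \<eta> * V"
    using V \<eta> by (simp add: sum_distrib_left[symmetric] mult_left_mono)
  have "(\<Sum>k<j. f (x k) * ?d k) - (F (x j) - F (x 0)) + (\<Sum>k<j. h (x k) * (?d k)\<^sup>2) / 2 = - (\<Sum>k<j. r k)"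
    unfolding tele[symmetric] r_def by (simp add: sum.distrib sum_subtractf sum_divide_distrib)
  moreover have "\<bar>\<Sum>k<j. r k\<bar> \<le> (\<Sum>k<j. \<eta> * (?d k)\<^sup>2)"
    using step(1) by (intro sum_abs[THEN order_trans] sum_mono) auto
  ultimately show "\<bar>(\<Sum>k<j. f (x k) * ?d k) - (F (x j) - F (x 0)) + (\<Sum>k<j. h (x k) * (?d k)\<^sup>2) / 2\<bar> \<le> \<eta> * V"
    using V' by linarith
  have "(\<Sum>k<j. (f (x k) + f (x (Suc k))) / 2 * ?d k) - (F (x j) - F (x 0)) = (\<Sum>k<j. q k * ?d k / 2 - r k)"
    unfolding tele[symmetric] sum_subtractf[symmetric]
    by (rule sum.cong) (auto simp: q_def r_def field_simps power2_eq_square)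
  also have "\<bar>\<dots>\<bar> \<le> (\<Sum>k<j. 2 * (\<eta> * (?d k)\<^sup>2))"
  proof (rule sum_abs[THEN order_trans], rule sum_mono)
    fix k assume "k \<in> {..<j}"
    then have k: "k < j" by simp
    have "\<bar>q k * ?d k\<bar> \<le> \<eta> * \<bar>?d k\<bar> * \<bar>?d k\<bar>"
      unfolding abs_mult using step(2)[OF k] by (intro mult_right_mono) auto
    also have "\<dots> = \<eta> * (?d k)\<^sup>2" by (simp add: power2_eq_square)
    finally show "\<bar>q k * ?d k / 2 - r k\<bar> \<le> 2 * (\<eta> * (?d k)\<^sup>2)"
      using step(1)[OF k] by linarith
  qed
  also have "\<dots> = 2 * (\<Sum>k<j. \<eta> * (?d k)\<^sup>2)" by (simp add: sum_distrib_left)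
  finally show "\<bar>(\<Sum>k<j. (f (x k) + f (x (Suc k))) / 2 * ?d k) - (F (x j) - F (x 0))\<bar> \<le> 2 * \<eta> * V"
    using V' by linarith
qed

lemma riemann_sum_bound:
  fixes \<phi> :: "real \<Rightarrow> real"
  assumes \<tau>: "strict_mono \<tau>" "\<tau> 0 = (0::real)" and \<phi>: "continuous_on {0..\<tau> j} \<phi>"
    and osc: "\<And>k s. k < j \<Longrightarrow> \<tau> k \<le> s \<Longrightarrow> s \<le> \<tau> (Suc k) \<Longrightarrow> \<bar>\<phi> s - \<phi> (\<tau> k)\<bar> \<le> \<eta>"
  shows "\<bar>(\<Sum>k<j. \<phi> (\<tau> k) * (\<tau> (Suc k) - \<tau> k)) - integral {0..\<tau> j} \<phi>\<bar> \<le> \<eta> * \<tau> j"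
  using \<phi> osc
proof (induction j)
  case 0
  then show ?case using \<tau> by simp
next
  case (Suc j)
  have pos: "0 \<le> \<tau> r" for r using \<tau> by (metis strict_mono_less_eq zero_le)
  have less: "\<tau> j < \<tau> (Suc j)" using \<tau> by (simp add: strict_mono_less)
  have c: "continuous_on {0..\<tau> j} \<phi>" "continuous_on {\<tau> j..\<tau> (Suc j)} \<phi>"
    using Suc.prems(1) less pos[of j] by (auto elim!: continuous_on_subset)
  have IH: "\<bar>(\<Sum>k<j. \<phi> (\<tau> k) * (\<tau> (Suc k) - \<tau> k)) - integral {0..\<tau> j} \<phi>\<bar> \<le> \<eta> * \<tau> j"
    using Suc c by auto
  have comb: "integral {0..\<tau> j} \<phi> + integral {\<tau> j..\<tau> (Suc j)} \<phi> = integral {0..\<tau> (Suc j)} \<phi>"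
    using pos less integrable_continuous_interval[OF Suc.prems(1)]
    by (intro Henstock_Kurzweil_Integration.integral_combine) auto
  have "norm (integral {\<tau> j..\<tau> (Suc j)} (\<lambda>s. \<phi> s - \<phi> (\<tau> j))) \<le> \<eta> * (\<tau> (Suc j) - \<tau> j)"
    using less Suc.prems(2)[of j] c by (intro integral_bound continuous_intros) auto
  moreover have "integral {\<tau> j..\<tau> (Suc j)} (\<lambda>s. \<phi> s - \<phi> (\<tau> j))
      = integral {\<tau> j..\<tau> (Suc j)} \<phi> - \<phi> (\<tau> j) * (\<tau> (Suc j) - \<tau> j)"
    using integrable_continuous_interval[OF c(2)] less
    by (subst Henstock_Kurzweil_Integration.integral_diff) auto
  ultimately have "\<bar>integral {\<tau> j..\<tau> (Suc j)} \<phi> - \<phi> (\<tau> j) * (\<tau> (Suc j) - \<tau> j)\<bar> \<le> \<eta> * \<tau> (Suc j) - \<eta> * \<tau> j"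
    by (simp add: right_diff_distrib)
  then show ?case using IH comb unfolding sum.lessThan_Suc by linarith
qed

section \<open>Mesh control, and from pathwise statements to events of high probability\<close>

lemma partition_sequence_mesh:
  assumes "partition_sequence D" "0 < m"
  shows "\<forall>\<^sub>F n in sequentially. \<forall>k. D n (Suc k) - D n k \<le> m"
proof -
  have "(\<lambda>n. SUP k. ereal (D n (Suc k) - D n k)) \<longlonglongrightarrow> 0"
    using assms(1) unfolding partition_sequence_def by blast
  then have "\<forall>\<^sub>F n in sequentially. (SUP k. ereal (D n (Suc k) - D n k)) < ereal m"
    using assms(2) by (intro order_tendstoD) auto
  then show ?thesis
  proof eventually_elim
    case (elim n)
    have "ereal (D n (Suc k) - D n k) \<le> ereal m" for k
      using order_trans[OF SUP_upper[of k UNIV "\<lambda>k. ereal (D n (Suc k) - D n k)"] less_imp_le[OF elim]] by simp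
    then show ?case by simp
  qed
qed

text \<open>The unions of the tails of E decrease to the empty set. Thus an index depending on
  \<omega> is replaced by one index valid off a small event.\<close>

lemma (in prob_space) eventually_avoided_event:
  assumes E: "\<And>n::nat. E n \<in> events" and avoid: "\<And>\<omega>. \<omega> \<in> space M \<Longrightarrow> \<forall>\<^sub>F n in sequentially. \<omega> \<notin> E n" and p: "0 < p"
  shows "\<exists>n. prob (E n) \<le> p"
proof -
  define U where "U n = (\<Union>m\<in>{n..}. E m)" for n
  have U: "range U \<subseteq> events" unfolding U_def using E by auto
  have dec: "decseq U" unfolding U_def by (intro decseq_SucI UN_mono) auto
  have "(\<Inter>n. U n) = {}"
  proof (rule ccontr)
    assume "(\<Inter>n. U n) \<noteq> {}"
    then obtain \<omega> where \<omega>: "\<And>n. \<omega> \<in> U n" by blast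
    then have "\<omega> \<in> space M" using U sets.sets_into_space by blast
    from avoid[OF this] obtain N where "\<And>n. N \<le> n \<Longrightarrow> \<omega> \<notin> E n"
      unfolding eventually_sequentially by blast
    then show False using \<omega>[of N] unfolding U_def by auto
  qed
  then have "(\<lambda>n. prob (U n)) \<longlonglongrightarrow> 0"
    using finite_Lim_measure_decseq[OF U dec] by simp
  then have "\<forall>\<^sub>F n in sequentially. prob (U n) < p" using p by (rule order_tendstoD)
  then obtain n where "prob (U n) < p" using eventually_happens'[OF sequentially_bot] by blast
  moreover have "prob (E n) \<le> prob (U n)"
    using U by (intro finite_measure_mono) (auto simp: U_def)
  ultimately show ?thesis by (intro exI[of _ n]) simp
qed

context brownian begin

text \<open>A countable dense subset of \<open>Q n\<close> makes the exceptional event measurable,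
  and path continuity carries the bound over to all of \<open>Q n\<close>. Sets of pairs of times
  cover both boundedness, by pairing with time 0, and the modulus of continuity, by pairs near the
  diagonal.\<close>

lemma path_event:
  assumes Q: "\<And>n::nat. Q n \<subseteq> {0..} \<times> {0..}" and p: "0 < p"
    and ev: "\<And>\<omega>. \<omega> \<in> space M \<Longrightarrow> \<forall>\<^sub>F n in sequentially. \<forall>(s, t)\<in>Q n. \<bar>B s \<omega> - B t \<omega>\<bar> \<le> \<delta> n"
  shows "\<exists>n. holds_up_to M p (\<lambda>\<omega>. \<forall>(s, t)\<in>Q n. \<bar>B s \<omega> - B t \<omega>\<bar> \<le> \<delta> n)"
proof -
  have "\<exists>C. countable C \<and> C \<subseteq> Q n \<and> Q n \<subseteq> closure C" for n
    using separable[of "Q n"] by metis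
  then obtain C where C: "\<And>n. countable (C n)" "\<And>n. C n \<subseteq> Q n" "\<And>n. Q n \<subseteq> closure (C n)"
    by metis
  define E where "E n = {\<omega>\<in>space M. \<exists>c\<in>C n. \<delta> n < \<bar>B (fst c) \<omega> - B (snd c) \<omega>\<bar>}" for n
  have "E n \<in> events" for n
    unfolding E_def
  proof (rule sets.sets_Collect_countable_Ex')
    fix c assume "c \<in> C n"
    then have "0 \<le> fst c" "0 \<le> snd c" using C(2)[of n] Q[of n] by auto
    then have [measurable]: "B (fst c) \<in> borel_measurable M" "B (snd c) \<in> borel_measurable M"
      using B_measurable by auto
    show "{\<omega>\<in>space M. \<delta> n < \<bar>B (fst c) \<omega> - B (snd c) \<omega>\<bar>} \<in> events" by measurable
  qed (rule C)
  moreover have "\<forall>\<^sub>F n in sequentially. \<omega> \<notin> E n" if "\<omega> \<in> space M" for \<omega>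
    using ev[OF that]
  proof eventually_elim
    case (elim n)
    then show ?case unfolding E_def using C(2)[of n] by fastforce
  qed
  ultimately obtain n where n: "E n \<in> events" "prob (E n) \<le> p"
    using eventually_avoided_event[of E p] p by blast
  have "\<forall>(s, t)\<in>Q n. \<bar>B s \<omega> - B t \<omega>\<bar> \<le> \<delta> n" if \<omega>: "\<omega> \<in> space M - E n" for \<omega>
  proof (intro ballI, clarify)
    fix s t assume st: "(s, t) \<in> Q n"
    then have "(s, t) \<in> closure (C n)" using C(3) by blast
    then obtain c where c: "\<And>i. c i \<in> C n" "c \<longlonglongrightarrow> (s, t)"
      unfolding closure_sequential by blast
    have st0: "0 \<le> s" "0 \<le> t" using st Q by auto
    have c0: "0 \<le> fst (c i)" "0 \<le> snd (c i)" for i using c(1)[of i] C(2)[of n] Q[of n] by auto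
    have "(\<lambda>i. B (fst (c i)) \<omega>) \<longlonglongrightarrow> B s \<omega>"
      using B_continuous[of \<omega>] \<omega> st0 c0 tendsto_fst[OF c(2)]
      by (intro continuous_on_tendsto_compose[where f="\<lambda>t. B t \<omega>" and s="{0..}"]) auto
    moreover have "(\<lambda>i. B (snd (c i)) \<omega>) \<longlonglongrightarrow> B t \<omega>"
      using B_continuous[of \<omega>] \<omega> st0 c0 tendsto_snd[OF c(2)]
      by (intro continuous_on_tendsto_compose[where f="\<lambda>t. B t \<omega>" and s="{0..}"]) auto
    ultimately have lim: "(\<lambda>i. \<bar>B (fst (c i)) \<omega> - B (snd (c i)) \<omega>\<bar>) \<longlonglongrightarrow> \<bar>B s \<omega> - B t \<omega>\<bar>"
      by (intro tendsto_intros)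
    have "\<bar>B (fst (c i)) \<omega> - B (snd (c i)) \<omega>\<bar> \<le> \<delta> n" for i
      using \<omega> c(1)[of i] unfolding E_def by (metis (mono_tags, lifting) Diff_iff mem_Collect_eq not_le)
    then show "\<bar>B s \<omega> - B t \<omega>\<bar> \<le> \<delta> n"
      by (intro LIMSEQ_le_const2[OF lim]) auto
  qed
  with n show ?thesis unfolding holds_up_to_def by (intro exI[of _ n] bexI[of _ "E n"]) auto
qed

lemma path_bounded:
  assumes "0 < p"
  shows "\<exists>R. holds_up_to M p (\<lambda>\<omega>. \<forall>t\<in>{0..T}. \<bar>B t \<omega>\<bar> \<le> R)"
proof -
  have "\<exists>n. holds_up_to M p (\<lambda>\<omega>. \<forall>(s, t)\<in>{0..T} \<times> {0}. \<bar>B s \<omega> - B t \<omega>\<bar> \<le> real n)"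
  proof (rule path_event)
    fix \<omega> assume \<omega>: "\<omega> \<in> space M"
    have "bounded ((\<lambda>t. B t \<omega>) ` {0..T})"
      using B_continuous[OF \<omega>] by (intro compact_imp_bounded compact_continuous_image) (auto elim: continuous_on_subset)
    then obtain R where R: "\<And>t. t \<in> {0..T} \<Longrightarrow> \<bar>B t \<omega>\<bar> \<le> R" unfolding bounded_iff by force
    have "\<forall>\<^sub>F n in sequentially. R \<le> real n"
      using filterlim_real_sequentially unfolding filterlim_at_top by blast
    then show "\<forall>\<^sub>F n in sequentially. \<forall>(s, t)\<in>{0..T} \<times> {0}. \<bar>B s \<omega> - B t \<omega>\<bar> \<le> real n"
    proof eventually_elim
      case (elim n)
      show ?case using order_trans[OF R elim] B_0[OF \<omega>] by simp
    qed
  qed (use assms in auto)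
  then obtain n where "holds_up_to M p (\<lambda>\<omega>. \<forall>(s, t)\<in>{0..T} \<times> {0}. \<bar>B s \<omega> - B t \<omega>\<bar> \<le> real n)" by blast
  then have "holds_up_to M p (\<lambda>\<omega>. \<forall>t\<in>{0..T}. \<bar>B t \<omega>\<bar> \<le> real n)"
    by (rule holds_up_to_mono) (auto simp: B_0)
  then show ?thesis by blast
qed

lemma path_modulus:
  assumes "0 < p" "0 < \<delta>"
  shows "\<exists>r>0. holds_up_to M p (\<lambda>\<omega>. \<forall>s\<in>{0..T}. \<forall>t\<in>{0..T}. \<bar>s - t\<bar> < r \<longrightarrow> \<bar>B s \<omega> - B t \<omega>\<bar> \<le> \<delta>)"
proof -
  let ?Q = "\<lambda>n. {(s, t). s \<in> {0..T} \<and> t \<in> {0..T} \<and> \<bar>s - t\<bar> < 1 / real (Suc n)}"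
  have "\<exists>n. holds_up_to M p (\<lambda>\<omega>. \<forall>(s, t)\<in>?Q n. \<bar>B s \<omega> - B t \<omega>\<bar> \<le> \<delta>)"
  proof (rule path_event)
    fix \<omega> assume \<omega>: "\<omega> \<in> space M"
    have "uniformly_continuous_on {0..T} (\<lambda>t. B t \<omega>)"
      using B_continuous[OF \<omega>] by (intro compact_uniformly_continuous) (auto elim: continuous_on_subset)
    then obtain d where d: "0 < d" "\<And>s t. s \<in> {0..T} \<Longrightarrow> t \<in> {0..T} \<Longrightarrow> \<bar>s - t\<bar> < d \<Longrightarrow> \<bar>B s \<omega> - B t \<omega>\<bar> < \<delta>"
      using assms(2) unfolding uniformly_continuous_on_def dist_real_def by (metis abs_minus_commute)
    have "\<forall>\<^sub>F n in sequentially. 1 / real (Suc n) < d"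
      using d(1) by (intro order_tendstoD(2)[OF lim_1_over_n[THEN LIMSEQ_Suc]]) auto
    then show "\<forall>\<^sub>F n in sequentially. \<forall>(s, t)\<in>?Q n. \<bar>B s \<omega> - B t \<omega>\<bar> \<le> \<delta>"
    proof eventually_elim
      case (elim n)
      show ?case
      proof (intro ballI, clarify)
        fix s t assume st: "s \<in> {0..T}" "t \<in> {0..T}" "\<bar>s - t\<bar> < 1 / real (Suc n)"
        show "\<bar>B s \<omega> - B t \<omega>\<bar> \<le> \<delta>"
          using d(2)[OF st(1,2) less_trans[OF st(3) elim]] by simp
      qed
    qed
  qed (use assms in auto)
  then obtain n where "holds_up_to M p (\<lambda>\<omega>. \<forall>(s, t)\<in>?Q n. \<bar>B s \<omega> - B t \<omega>\<bar> \<le> \<delta>)" by blast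
  then have "holds_up_to M p (\<lambda>\<omega>. \<forall>s\<in>{0..T}. \<forall>t\<in>{0..T}. \<bar>s - t\<bar> < 1 / real (Suc n) \<longrightarrow> \<bar>B s \<omega> - B t \<omega>\<bar> \<le> \<delta>)"
    by (rule holds_up_to_mono) auto
  then show ?thesis by (intro exI[of _ "1 / real (Suc n)"]) simp
qed

end

section \<open>Smooth integrands\<close>

context brownian begin

lemma increment_indep_compose:
  assumes "0 \<le> s" "s < t" and h[measurable]: "h \<in> borel_measurable borel"
  shows "indep_set (sets (F s)) (sets (vimage_algebra (space M) (\<lambda>\<omega>. h (B t \<omega> - B s \<omega>) :: real) borel))"
proof (rule indep_set_mono[OF increment_indep[OF assms(1,2)] order_refl])
  let ?N = "vimage_algebra (space M) (\<lambda>\<omega>. B t \<omega> - B s \<omega>) borel"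
  have [measurable]: "(\<lambda>\<omega>. B t \<omega> - B s \<omega>) \<in> borel_measurable ?N"
    by (rule measurable_vimage_algebra1) auto
  have "(\<lambda>\<omega>. h (B t \<omega> - B s \<omega>)) \<in> borel_measurable ?N" by measurable
  from measurable_sets[OF this]
  show "sets (vimage_algebra (space M) (\<lambda>\<omega>. h (B t \<omega> - B s \<omega>)) borel) \<subseteq> sets ?N"
    by (auto simp: sets_vimage_algebra2)
qed

text \<open>The centred squares of the increments are martingale differences with second moment
  \<open>2 * (\<tau> (Suc k) - \<tau> k)\<^sup>2\<close>. One factor of the length goes into the
  mesh, so the total variance is at most \<open>2 * H\<^sup>2 * m * T\<close>.\<close>

lemma quadratic_fluctuation_bound:
  fixes u :: "real \<Rightarrow> real"
  assumes \<tau>: "strict_mono \<tau>" "\<tau> 0 = 0" "\<And>t. finite {k. \<tau> k \<le> t}" and K: "\<tau> K \<le> T"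
    and mesh: "\<And>k. \<tau> (Suc k) - \<tau> k \<le> m"
    and u[measurable]: "u \<in> borel_measurable borel" and H: "\<And>x. \<bar>u x\<bar> \<le> H"
    and c: "0 < c" and bound: "2 * H\<^sup>2 * m * T \<le> p * c\<^sup>2"
  shows "holds_up_to M p (\<lambda>\<omega>. \<forall>j\<le>K.
    \<bar>\<Sum>k<j. u (B (\<tau> k) \<omega>) * ((B (\<tau> (Suc k)) \<omega> - B (\<tau> k) \<omega>)\<^sup>2 - (\<tau> (Suc k) - \<tau> k))\<bar> \<le> c)"
proof -
  have pos: "0 \<le> \<tau> r" for r using \<tau> by (metis strict_mono_less_eq zero_le)
  have less: "\<tau> r < \<tau> (Suc r)" for r using \<tau> by (simp add: strict_mono_less)
  have mono: "\<tau> i \<le> \<tau> j" if "i \<le> j" for i j using \<tau> that by (simp add: strict_mono_less_eq)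
  have BF[measurable]: "B (\<tau> i) \<in> borel_measurable (F (\<tau> j))" if "i \<le> j" for i j
    using B_measurable_F[OF pos mono[OF that]] .
  have [measurable]: "B (\<tau> i) \<in> borel_measurable M" for i using B_measurable pos by simp
  have m0: "0 \<le> m" using mesh[of 0] less[of 0] by simp
  let ?d = "\<lambda>k. \<tau> (Suc k) - \<tau> k"
  let ?v = "\<lambda>k \<omega>. (B (\<tau> (Suc k)) \<omega> - B (\<tau> k) \<omega>)\<^sup>2 - ?d k"
  note mom = increment_moment[OF pos less]
  have sq_shift: "(y\<^sup>2 - c)\<^sup>2 = y ^ 4 - 2 * c * y\<^sup>2 + c\<^sup>2" for y c :: real
    by (simp add: power2_eq_square power4_eq_xxxx algebra_simps)
  have v4: "(?v k \<omega>)\<^sup>2 = (B (\<tau> (Suc k)) \<omega> - B (\<tau> k) \<omega>) ^ 4 - 2 * ?d k * (B (\<tau> (Suc k)) \<omega> - B (\<tau> k) \<omega>)\<^sup>2 + (?d k)\<^sup>2" for k \<omega>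
    using sq_shift by blast
  have v2: "integrable M (\<lambda>\<omega>. (?v k \<omega>)\<^sup>2)" "expectation (\<lambda>\<omega>. (?v k \<omega>)\<^sup>2) = 2 * (?d k)\<^sup>2" for k
  proof -
    note m = mom(1)[of k 4] mom(1)[of k 2] mom(3)[of k] mom(4)[of k]
    show "integrable M (\<lambda>\<omega>. (?v k \<omega>)\<^sup>2)" unfolding v4 using m(1,2) by simp
    have "expectation (\<lambda>\<omega>. (?v k \<omega>)\<^sup>2) = 3 * (?d k)\<^sup>2 - 2 * ?d k * ?d k + (?d k)\<^sup>2"
      unfolding v4 using m by (simp add: prob_space)
    then show "expectation (\<lambda>\<omega>. (?v k \<omega>)\<^sup>2) = 2 * (?d k)\<^sup>2" by (simp add: power2_eq_square)
  qed
  have u2: "(u x)\<^sup>2 \<le> H\<^sup>2" for x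
    using H[of x] abs_le_square_iff[of "u x" H] by (simp add: abs_le_iff)
  have ui: "integrable M (\<lambda>\<omega>. (u (B (\<tau> k) \<omega>))\<^sup>2)" for k
    by (rule integrable_const_bound[where B="H\<^sup>2"], rule AE_I2)
      (simp_all only: real_norm_def abs_power2 u2, measurable)
  have uE: "expectation (\<lambda>\<omega>. (u (B (\<tau> k) \<omega>))\<^sup>2) \<le> H\<^sup>2" for k
  proof -
    have "expectation (\<lambda>\<omega>. (u (B (\<tau> k) \<omega>))\<^sup>2) \<le> expectation (\<lambda>\<omega>. H\<^sup>2)"
      by (intro integral_mono ui u2) simp
    then show ?thesis by (simp add: prob_space)
  qed
  show ?thesis
  proof (rule martingale_maximal[where G="\<lambda>k. F (\<tau> k)"])
    show "subalgebra M (F (\<tau> k))" for k using subalgebra_F pos by blast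
    have *: "(\<lambda>\<omega>. u (B (\<tau> j) \<omega>)) \<in> borel_measurable (F (\<tau> k))" if "j \<le> k" for j k
      using BF[OF that] by measurable
    show "(\<lambda>\<omega>. u (B (\<tau> k) \<omega>)) \<in> borel_measurable (F (\<tau> k))" for k using * by simp
    show "(\<lambda>\<omega>. u (B (\<tau> j) \<omega>)) \<in> borel_measurable (F (\<tau> k))" if "j < k" for j k using * that by simp
    show "?v j \<in> borel_measurable (F (\<tau> k))" if "j < k" for j k
      using BF[of "Suc j" k] BF[of j k] that by simp
    show "?v k \<in> borel_measurable M" for k by measurable
    show "indep_set (sets (F (\<tau> k))) (sets (vimage_algebra (space M) (?v k) borel))" for k
      using increment_indep_compose[OF pos less, of "\<lambda>x. x\<^sup>2 - ?d k"] by simp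
    show "expectation (?v k) = 0" for k using mom(1)[of k 2] mom(3)[of k] by (simp add: prob_space)
    have "(\<Sum>k<K. expectation (\<lambda>\<omega>. (u (B (\<tau> k) \<omega>))\<^sup>2) * expectation (\<lambda>\<omega>. (?v k \<omega>)\<^sup>2))
        \<le> (\<Sum>k<K. H\<^sup>2 * (2 * (m * ?d k)))"
    proof (rule sum_mono)
      fix k
      have "(?d k)\<^sup>2 \<le> m * ?d k" using mesh[of k] less[of k] by (simp add: power2_eq_square)
      then show "expectation (\<lambda>\<omega>. (u (B (\<tau> k) \<omega>))\<^sup>2) * expectation (\<lambda>\<omega>. (?v k \<omega>)\<^sup>2) \<le> H\<^sup>2 * (2 * (m * ?d k))"
        unfolding v2 using uE by (intro mult_mono) auto
    qed
    also have "\<dots> = 2 * H\<^sup>2 * m * (\<Sum>k<K. ?d k)"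
      unfolding sum_distrib_left by (rule sum.cong) (simp_all add: algebra_simps)
    also have "\<dots> \<le> 2 * H\<^sup>2 * m * T"
      using m0 K \<tau>(2) by (intro mult_left_mono) (auto simp: sum_lessThan_telescope)
    finally show "(\<Sum>k<K. expectation (\<lambda>\<omega>. (u (B (\<tau> k) \<omega>))\<^sup>2) * expectation (\<lambda>\<omega>. (?v k \<omega>)\<^sup>2)) \<le> p * c\<^sup>2"
      using bound by simp
  qed (use ui v2 c in auto)
qed

lemma quadratic_variation_bound:
  assumes \<tau>: "strict_mono \<tau>" "\<tau> 0 = 0" and K: "\<tau> K \<le> p * L" and L: "0 < L"
  shows "holds_up_to M p (\<lambda>\<omega>. (\<Sum>k<K. (B (\<tau> (Suc k)) \<omega> - B (\<tau> k) \<omega>)\<^sup>2) \<le> L)"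
proof (rule holds_up_to_Markov[OF _ _ L])
  have pos: "0 \<le> \<tau> r" for r using \<tau> by (metis strict_mono_less_eq zero_le)
  have less: "\<tau> r < \<tau> (Suc r)" for r using \<tau> by (simp add: strict_mono_less)
  note mom = increment_moment(1)[OF pos less, where k=2] increment_moment(3)[OF pos less]
  show "integrable M (\<lambda>\<omega>. \<Sum>k<K. (B (\<tau> (Suc k)) \<omega> - B (\<tau> k) \<omega>)\<^sup>2)"
    using mom by auto
  have "expectation (\<lambda>\<omega>. \<Sum>k<K. (B (\<tau> (Suc k)) \<omega> - B (\<tau> k) \<omega>)\<^sup>2) = (\<Sum>k<K. \<tau> (Suc k) - \<tau> k)"
    using mom by (subst Bochner_Integration.integral_sum) auto
  then show "expectation (\<lambda>\<omega>. \<Sum>k<K. (B (\<tau> (Suc k)) \<omega> - B (\<tau> k) \<omega>)\<^sup>2) \<le> p * L"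
    using K \<tau>(2) by (simp add: sum_lessThan_telescope)
qed (auto intro: sum_nonneg)

text \<open>Four events, each allowed to fail with probability p/4, give bounded paths, a modulus of
  continuity, a bounded quadratic sum and a small quadratic fluctuation. On their intersection the
  rest is a deterministic estimate along one path.\<close>

lemma smooth_sum_limits:
  fixes \<Phi> f h :: "real \<Rightarrow> real"
  assumes D: "partition_sequence D"
    and \<Phi>: "\<And>x. (\<Phi> has_real_derivative f x) (at x)" and f: "\<And>x. (f has_real_derivative h x) (at x)"
    and h: "continuous_on UNIV h"
    and T: "0 \<le> T" and e: "0 < e" and p: "0 < p"
  shows "\<forall>\<^sub>F n in sequentially. holds_up_to M p (\<lambda>\<omega>. \<forall>t\<in>{0..T}.
    \<bar>(\<Sum>k | D n k < t. f (B (D n k) \<omega> + a) * (B (D n (Suc k)) \<omega> - B (D n k) \<omega>))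
       - (\<Phi> (B t \<omega> + a) - \<Phi> a - integral {0..t} (\<lambda>s. h (B s \<omega> + a)) / 2)\<bar> \<le> e \<and>
    \<bar>(\<Sum>k | D n k < t. (f (B (D n k) \<omega> + a) + f (B (D n (Suc k)) \<omega> + a)) / 2 * (B (D n (Suc k)) \<omega> - B (D n k) \<omega>))
       - (\<Phi> (B t \<omega> + a) - \<Phi> a)\<bar> \<le> e)"
proof -
  obtain R0 where R0: "holds_up_to M (p/4) (\<lambda>\<omega>. \<forall>t\<in>{0..T + 1}. \<bar>B t \<omega>\<bar> \<le> R0)"
    using path_bounded[of "p/4" "T + 1"] p by auto
  define R where "R = \<bar>R0\<bar> + \<bar>a\<bar>"
  have R: "0 \<le> R" by (simp add: R_def)
  have "bounded (h ` {-R..R})"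
    using h by (intro compact_imp_bounded compact_continuous_image) (auto elim: continuous_on_subset)
  then obtain H0 where H0: "\<And>x. x \<in> {-R..R} \<Longrightarrow> \<bar>h x\<bar> \<le> H0" unfolding bounded_iff by force
  define H where "H = \<bar>H0\<bar> + 1"
  have H: "0 < H" "\<bar>h x\<bar> \<le> H" if "\<bar>x\<bar> \<le> R" for x
  proof -
    have "x \<in> {-R..R}" using that by (auto simp: abs_le_iff)
    from H0[OF this] show "0 < H" "\<bar>h x\<bar> \<le> H" unfolding H_def by linarith+
  qed
  have H: "0 < H" "\<And>x. \<bar>x\<bar> \<le> R \<Longrightarrow> \<bar>h x\<bar> \<le> H" using H(1)[of 0] H(2) R by auto
  \<comment> \<open>Markov's inequality: the quadratic sum has expectation at most T + 1, so it
    exceeds L with probability at most p/4.\<close>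
  define L where "L = 4 * (T + 1) / p"
  have L: "0 < L" using T p by (simp add: L_def)
  \<comment> \<open>Taylor remainders cost a multiple of \<open>\<eta> * L\<close> and the Riemann
    sum costs \<open>\<eta> * (T + 1)\<close>; together these two amounts are e/4.\<close>
  define \<eta> where "\<eta> = e / (4 * (L + T + 1))"
  have \<eta>: "0 < \<eta>" using e L T by (simp add: \<eta>_def)
  have cancel: "e / (4 * c) * c = e / 4" if "0 < c" for c using that by simp
  have "\<eta> * (L + T + 1) = e / 4" unfolding \<eta>_def by (rule cancel) (use L T in simp)
  then have \<eta>_sum: "\<eta> * L + \<eta> * (T + 1) = e / 4" by (simp add: algebra_simps)
  have \<eta>LT: "\<eta> * L \<le> e / 4" "\<eta> * (T + 1) \<le> e / 4" "0 \<le> \<eta> * L" "0 \<le> \<eta> * (T + 1)"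
  proof -
    show "0 \<le> \<eta> * L" "0 \<le> \<eta> * (T + 1)" using \<eta> L T by auto
    then show "\<eta> * L \<le> e / 4" "\<eta> * (T + 1) \<le> e / 4" using \<eta>_sum by linarith+
  qed
  have "uniformly_continuous_on {-R..R} h"
    using h by (intro compact_uniformly_continuous) (auto elim: continuous_on_subset)
  then obtain d1 where d1: "0 < d1" "\<And>u v. u \<in> {-R..R} \<Longrightarrow> v \<in> {-R..R} \<Longrightarrow> \<bar>u - v\<bar> < d1 \<Longrightarrow> \<bar>h u - h v\<bar> < \<eta>"
    using \<eta> unfolding uniformly_continuous_on_def dist_real_def by (metis abs_minus_commute)
  have "continuous_on {-R..R} \<Phi>"
    using \<Phi> by (meson DERIV_continuous_on has_field_derivative_at_within)
  then have "uniformly_continuous_on {-R..R} \<Phi>"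
    by (intro compact_uniformly_continuous) auto
  moreover have "0 < e/8" using e by simp
  ultimately obtain d2 where d2: "0 < d2" "\<And>u v. u \<in> {-R..R} \<Longrightarrow> v \<in> {-R..R} \<Longrightarrow> \<bar>u - v\<bar> < d2 \<Longrightarrow> \<bar>\<Phi> u - \<Phi> v\<bar> < e/8"
    unfolding uniformly_continuous_on_def dist_real_def by (metis abs_minus_commute)
  define \<delta> where "\<delta> = min d1 d2 / 2"
  have \<delta>: "0 < \<delta>" "\<delta> < d1" "\<delta> < d2" using d1(1) d2(1) by (auto simp: \<delta>_def min_def)
  have h_osc: "\<bar>h u - h v\<bar> \<le> \<eta>" if "\<bar>u\<bar> \<le> R" "\<bar>v\<bar> \<le> R" "\<bar>u - v\<bar> \<le> \<delta>" for u v
    using d1(2)[of u v] that \<delta> by (auto simp: abs_le_iff)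
  have \<Phi>_osc: "\<bar>\<Phi> u - \<Phi> v\<bar> \<le> e/8" if "\<bar>u\<bar> \<le> R" "\<bar>v\<bar> \<le> R" "\<bar>u - v\<bar> \<le> \<delta>" for u v
    using d2(2)[of u v] that \<delta> by (auto simp: abs_le_iff)
  obtain r where r: "0 < r" "holds_up_to M (p/4) (\<lambda>\<omega>. \<forall>s\<in>{0..T + 1}. \<forall>t\<in>{0..T + 1}. \<bar>s - t\<bar> < r \<longrightarrow> \<bar>B s \<omega> - B t \<omega>\<bar> \<le> \<delta>)"
    using path_modulus[of "p/4" \<delta> "T + 1"] p \<delta>(1) by auto
  \<comment> \<open>In this order: the overshoot beyond T stays below 1, neighbouring points fall
    under the modulus of continuity, the integral of h between t and the next partition point is
    small, and the fluctuation bound holds with error e/4 and probability p/4.\<close>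
  define m where "m = Min {1, r/2, e / (8 * H), p/4 * (e/4)\<^sup>2 / (2 * H\<^sup>2 * (T + 1))}"
  have m: "0 < m" "m \<le> 1" "m < r" "H * m \<le> e/8" "2 * H\<^sup>2 * m * (T + 1) \<le> p/4 * (e/4)\<^sup>2"
  proof -
    show "0 < m" unfolding m_def using r(1) e p H T by (auto intro!: divide_pos_pos mult_pos_pos)
    have le: "m \<le> 1" "m \<le> r/2" "m \<le> e / (8 * H)" "m \<le> p/4 * (e/4)\<^sup>2 / (2 * H\<^sup>2 * (T + 1))"
      unfolding m_def by (intro Min_le; simp)+
    then show "m \<le> 1" "m < r" using r(1) by auto
    show "H * m \<le> e/8" using le(3) H(1) by (simp add: field_simps)
    have "0 < 2 * H\<^sup>2 * (T + 1)" using H T by simp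
    from pos_le_divide_eq[THEN iffD1, OF this le(4)]
    show "2 * H\<^sup>2 * m * (T + 1) \<le> p/4 * (e/4)\<^sup>2" by (simp add: mult_ac)
  qed
  show ?thesis
    using partition_sequence_mesh[OF D m(1)]
  proof eventually_elim
    case (elim n)
    define \<tau> where "\<tau> = D n"
    have \<tau>: "strict_mono \<tau>" "\<tau> 0 = 0" "\<And>t. finite {k. \<tau> k \<le> t}"
      using D unfolding partition_sequence_def \<tau>_def by auto
    have mesh: "\<tau> (Suc k) - \<tau> k \<le> m" for k using elim by (simp add: \<tau>_def)
    have pos: "0 \<le> \<tau> r" for r using \<tau> by (metis strict_mono_less_eq zero_le)
    have less: "\<tau> r < \<tau> (Suc r)" for r using \<tau> by (simp add: strict_mono_less)
    have mono: "\<tau> i \<le> \<tau> j" if "i \<le> j" for i j using \<tau> that by (simp add: strict_mono_less_eq)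
    obtain K where K: "{k. \<tau> k < T} = {..<K}" using partition_below[OF \<tau>(1,3)] .
    \<comment> \<open>A sum over the points below t runs up to the first partition point at or after
      t, so it ends within one mesh step of t.\<close>
    have next_point: "t \<le> \<tau> j \<and> \<tau> j \<le> t + m" if "{k. \<tau> k < t} = {..<j}" "0 \<le> t" for t j
    proof
      show "t \<le> \<tau> j" using that by (metis lessThan_iff less_irrefl mem_Collect_eq not_le)
      show "\<tau> j \<le> t + m"
      proof (cases j)
        case 0
        then show ?thesis using \<tau> that m by simp
      next
        case (Suc k)
        then have "\<tau> k < t" using that by blast
        then show ?thesis using mesh[of k] Suc by simp
      qed
    qed
    have \<tau>K: "\<tau> K \<le> T + 1" using next_point[OF K T] m(2) by simp
    \<comment> \<open>The fluctuation bound asks for a weight bounded on the whole line. Clamping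
      the argument to [-R, R] provides it and changes nothing on the good event.\<close>
    define u where "u x = h (max (-R) (min R (x + a)))" for x
    have u_meas: "u \<in> borel_measurable borel"
      unfolding u_def using borel_measurable_continuous_onI[OF h] by measurable
    have u_le: "\<bar>u x\<bar> \<le> H" for x unfolding u_def using R by (intro H(2)) auto
    have fluct: "holds_up_to M (p/4) (\<lambda>\<omega>. \<forall>j\<le>K.
        \<bar>\<Sum>k<j. u (B (\<tau> k) \<omega>) * ((B (\<tau> (Suc k)) \<omega> - B (\<tau> k) \<omega>)\<^sup>2 - (\<tau> (Suc k) - \<tau> k))\<bar> \<le> e/4)"
      using e m(5) by (intro quadratic_fluctuation_bound[OF \<tau> \<tau>K mesh u_meas u_le]) auto
    have qv: "holds_up_to M (p/4) (\<lambda>\<omega>. (\<Sum>k<K. (B (\<tau> (Suc k)) \<omega> - B (\<tau> k) \<omega>)\<^sup>2) \<le> L)"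
      using \<tau>K p by (intro quadratic_variation_bound[OF \<tau>(1,2) _ L]) (simp add: L_def)
    show ?case
      unfolding \<tau>_def[symmetric]
    proof (rule holds_up_to_mono[OF holds_up_to_conj[OF holds_up_to_conj[OF R0 r(2)] holds_up_to_conj[OF fluct qv]]])
      fix \<omega> assume \<omega>: "\<omega> \<in> space M" and good: "((\<forall>t\<in>{0..T + 1}. \<bar>B t \<omega>\<bar> \<le> R0) \<and>
          (\<forall>s\<in>{0..T + 1}. \<forall>t\<in>{0..T + 1}. \<bar>s - t\<bar> < r \<longrightarrow> \<bar>B s \<omega> - B t \<omega>\<bar> \<le> \<delta>)) \<and>
        (\<forall>j\<le>K. \<bar>\<Sum>k<j. u (B (\<tau> k) \<omega>) * ((B (\<tau> (Suc k)) \<omega> - B (\<tau> k) \<omega>)\<^sup>2 - (\<tau> (Suc k) - \<tau> k))\<bar> \<le> e/4) \<and>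
        (\<Sum>k<K. (B (\<tau> (Suc k)) \<omega> - B (\<tau> k) \<omega>)\<^sup>2) \<le> L"
      have bdd: "\<bar>B s \<omega> + a\<bar> \<le> R" if "s \<in> {0..T + 1}" for s
        using good that unfolding R_def by fastforce
      have osc: "\<bar>B s \<omega> - B s' \<omega>\<bar> \<le> \<delta>" if "s \<in> {0..T + 1}" "s' \<in> {0..T + 1}" "\<bar>s - s'\<bar> < r" for s s'
        using good that by blast
      have fluct': "\<bar>\<Sum>k<j. u (B (\<tau> k) \<omega>) * ((B (\<tau> (Suc k)) \<omega> - B (\<tau> k) \<omega>)\<^sup>2 - (\<tau> (Suc k) - \<tau> k))\<bar> \<le> e/4" if "j \<le> K" for j
        using good that by blast
      define x where "x k = B (\<tau> k) \<omega> + a" for k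
      let ?\<phi> = "\<lambda>s. h (B s \<omega> + a)"
      have \<phi>_cont: "continuous_on {0..s} ?\<phi>" for s
        using B_continuous[OF \<omega>]
        by (intro continuous_on_compose2[OF h] continuous_intros) (auto elim: continuous_on_subset)
      show "\<forall>t\<in>{0..T}.
        \<bar>(\<Sum>k | \<tau> k < t. f (B (\<tau> k) \<omega> + a) * (B (\<tau> (Suc k)) \<omega> - B (\<tau> k) \<omega>))
           - (\<Phi> (B t \<omega> + a) - \<Phi> a - integral {0..t} ?\<phi> / 2)\<bar> \<le> e \<and>
        \<bar>(\<Sum>k | \<tau> k < t. (f (B (\<tau> k) \<omega> + a) + f (B (\<tau> (Suc k)) \<omega> + a)) / 2 * (B (\<tau> (Suc k)) \<omega> - B (\<tau> k) \<omega>))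
           - (\<Phi> (B t \<omega> + a) - \<Phi> a)\<bar> \<le> e"
        (is "\<forall>t\<in>{0..T}. ?C t")
      proof
        fix t assume t: "t \<in> {0..T}"
        obtain j where j: "{k. \<tau> k < t} = {..<j}" using partition_below[OF \<tau>(1,3)] .
        have "{..<j} \<subseteq> {..<K}" unfolding j[symmetric] K[symmetric] using t by auto
        then have jK: "j \<le> K" by simp
        have \<tau>j: "t \<le> \<tau> j" "\<tau> j \<le> t + m" using next_point[OF j] t by auto
        have in_range: "\<tau> k \<in> {0..T + 1}" if "k \<le> j" for k
          using pos[of k] mono[OF that] \<tau>j m(2) t by auto
        have x_le: "\<bar>x k\<bar> \<le> R" if "k \<le> j" for k
          unfolding x_def by (rule bdd[OF in_range[OF that]])
        have x_step: "\<bar>x (Suc k) - x k\<bar> \<le> \<delta>" if "k < j" for k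
          using osc[OF in_range in_range, of "Suc k" k] that mesh[of k] less[of k] m(3) by (simp add: x_def)
        have "(\<Sum>k<j. (x (Suc k) - x k)\<^sup>2) \<le> (\<Sum>k<K. (x (Suc k) - x k)\<^sup>2)"
          using jK by (intro sum_mono2) auto
        also have "\<dots> \<le> L" using good by (simp add: x_def)
        finally have V: "(\<Sum>k<j. (x (Suc k) - x k)\<^sup>2) \<le> L" .
        have sums: "\<bar>(\<Sum>k<j. f (x k) * (x (Suc k) - x k)) - (\<Phi> (x j) - \<Phi> (x 0)) + (\<Sum>k<j. h (x k) * (x (Suc k) - x k)\<^sup>2) / 2\<bar> \<le> \<eta> * L"
          "\<bar>(\<Sum>k<j. (f (x k) + f (x (Suc k))) / 2 * (x (Suc k) - x k)) - (\<Phi> (x j) - \<Phi> (x 0))\<bar> \<le> 2 * \<eta> * L"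
          using second_order_sums[OF \<Phi> f h_osc x_le x_step V less_imp_le[OF \<eta>]] by auto
        have x0: "x 0 = a" using B_0[OF \<omega>] \<tau>(2) by (simp add: x_def)
        have tT: "t \<in> {0..T + 1}" using t by auto
        have "\<bar>x j - (B t \<omega> + a)\<bar> \<le> \<delta>"
          using osc[OF in_range[OF order_refl] tT] \<tau>j m(3) by (simp add: x_def)
        then have end_point: "\<bar>\<Phi> (x j) - \<Phi> (B t \<omega> + a)\<bar> \<le> e/8"
          using \<Phi>_osc[OF x_le[OF order_refl] bdd[OF tT]] by blast
        have hx: "u (B (\<tau> k) \<omega>) = h (x k)" if "k < j" for k
        proof -
          have "max (-R) (min R (x k)) = x k" using x_le[of k] that by (auto simp: abs_le_iff)
          then show ?thesis unfolding u_def x_def by simp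
        qed
        have "(\<Sum>k<j. u (B (\<tau> k) \<omega>) * ((B (\<tau> (Suc k)) \<omega> - B (\<tau> k) \<omega>)\<^sup>2 - (\<tau> (Suc k) - \<tau> k)))
            = (\<Sum>k<j. h (x k) * (x (Suc k) - x k)\<^sup>2) - (\<Sum>k<j. h (x k) * (\<tau> (Suc k) - \<tau> k))"
          unfolding sum_subtractf[symmetric]
          by (rule sum.cong) (auto simp: hx x_def right_diff_distrib)
        then have 1: "\<bar>(\<Sum>k<j. h (x k) * (x (Suc k) - x k)\<^sup>2) - (\<Sum>k<j. h (x k) * (\<tau> (Suc k) - \<tau> k))\<bar> \<le> e/4"
          using fluct'[OF jK] by simp
        have "\<bar>(\<Sum>k<j. ?\<phi> (\<tau> k) * (\<tau> (Suc k) - \<tau> k)) - integral {0..\<tau> j} ?\<phi>\<bar> \<le> \<eta> * \<tau> j"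
        proof (rule riemann_sum_bound[OF \<tau>(1,2) \<phi>_cont])
          fix k s assume k: "k < j" and s: "\<tau> k \<le> s" "s \<le> \<tau> (Suc k)"
          have "s \<in> {0..T + 1}" using s in_range[of k] in_range[of "Suc k"] k by auto
          moreover have "\<bar>s - \<tau> k\<bar> < r" using s mesh[of k] m(3) by auto
          ultimately show "\<bar>?\<phi> s - ?\<phi> (\<tau> k)\<bar> \<le> \<eta>"
            using osc[of s "\<tau> k"] in_range[of k] k by (intro h_osc bdd) auto
        qed
        also have "\<eta> * \<tau> j \<le> \<eta> * (T + 1)" using \<eta> in_range[of j] by (intro mult_left_mono) auto
        finally have 2: "\<bar>(\<Sum>k<j. h (x k) * (\<tau> (Suc k) - \<tau> k)) - integral {0..\<tau> j} ?\<phi>\<bar> \<le> e/4"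
          using \<eta>LT(2) unfolding x_def by linarith
        have "integral {0..t} ?\<phi> + integral {t..\<tau> j} ?\<phi> = integral {0..\<tau> j} ?\<phi>"
          using t \<tau>j integrable_continuous_interval[OF \<phi>_cont]
          by (intro Henstock_Kurzweil_Integration.integral_combine) auto
        moreover have "norm (integral {t..\<tau> j} ?\<phi>) \<le> H * (\<tau> j - t)"
        proof (rule integral_bound[OF \<tau>j(1)])
          show "continuous_on {t..\<tau> j} ?\<phi>" using \<phi>_cont[of "\<tau> j"] t by (auto elim: continuous_on_subset)
          show "norm (?\<phi> s) \<le> H" if "s \<in> {t..\<tau> j}" for s
            using that t in_range[of j] by (simp, intro H(2) bdd) auto
        qed
        moreover have "H * (\<tau> j - t) \<le> e/8"
          using \<tau>j(2) H(1) by (intro order_trans[OF mult_left_mono m(4)]) auto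
        ultimately have 3: "\<bar>integral {0..\<tau> j} ?\<phi> - integral {0..t} ?\<phi>\<bar> \<le> e/8" unfolding real_norm_def by linarith
        have ito: "\<bar>(\<Sum>k<j. f (x k) * (x (Suc k) - x k)) - (\<Phi> (B t \<omega> + a) - \<Phi> a - integral {0..t} ?\<phi> / 2)\<bar> \<le> e"
          using sums(1) \<eta>LT(1) end_point 1 2 3 e unfolding x0 by linarith
        have trap: "\<bar>(\<Sum>k<j. (f (x k) + f (x (Suc k))) / 2 * (x (Suc k) - x k)) - (\<Phi> (B t \<omega> + a) - \<Phi> a)\<bar> \<le> e"
          using sums(2) \<eta>LT(1) end_point e unfolding x0 mult.assoc by linarith
        show "?C t"
          using ito trap unfolding j x_def by simp
      qed
    qed simp
  qed
qed

end

section \<open>Smoothing the power function\<close>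

lemma DERIV_if_less:
  fixes p q :: "real \<Rightarrow> real"
  assumes p: "\<And>x. x \<le> c \<Longrightarrow> (p has_real_derivative p' x) (at x)"
    and q: "\<And>x. c \<le> x \<Longrightarrow> (q has_real_derivative q' x) (at x)"
    and eq: "p c = q c" "p' c = q' c"
  shows "((\<lambda>x. if x < c then p x else q x) has_real_derivative (if x < c then p' x else q' x)) (at x)"
proof -
  consider "x < c" | "c < x" | "x = c" by linarith
  then show ?thesis
  proof cases
    case 1
    have "((\<lambda>x. if x < c then p x else q x) has_real_derivative p' x) (at x)"
      by (rule has_field_derivative_transform_within_open[OF p, of _ "{..<c}"]) (use 1 in auto)
    then show ?thesis using 1 by simp
  next
    case 2
    have "((\<lambda>x. if x < c then p x else q x) has_real_derivative q' x) (at x)"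
      by (rule has_field_derivative_transform_within_open[OF q, of _ "{c<..}"]) (use 2 in auto)
    then show ?thesis using 2 by simp
  next
    case 3
    have "((\<lambda>y. ((if y < c then p y else q y) - q c) / (y - c)) \<longlongrightarrow> q' c) (at c)"
    proof (rule tendstoI)
      fix e :: real assume e: "0 < e"
      have "((\<lambda>y. (p y - p c) / (y - c)) \<longlongrightarrow> p' c) (at c)" "((\<lambda>y. (q y - q c) / (y - c)) \<longlongrightarrow> q' c) (at c)"
        using p[of c] q[of c] unfolding has_field_derivative_iff by auto
      from tendstoD[OF this(1) e] tendstoD[OF this(2) e]
      show "\<forall>\<^sub>F y in at c. dist (((if y < c then p y else q y) - q c) / (y - c)) (q' c) < e"
        by eventually_elim (simp add: eq)
    qed
    then show ?thesis unfolding 3 has_field_derivative_iff by simp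
  qed
qed

text \<open>In the variable s = y^2 the function f is q, where q replaces
  \<open>s powr (\<beta>/2)\<close> below \<epsilon>^2 by its tangent line at \<epsilon>^2. An
  antiderivative of the form \<open>y * r (y\<^sup>2)\<close> requires
  \<open>r s + 2 * s * r' s = q s\<close>, which has an affine solution on the inner part and an
  explicit one outside. Working with y^2 keeps f even and smooth across 0.\<close>

lemma power_smoothing:
  fixes \<beta> \<epsilon> :: real
  assumes \<beta>: "- 1/2 < \<beta>" and \<epsilon>: "0 < \<epsilon>"
  shows "\<exists>\<Phi> f h. (\<forall>x. (\<Phi> has_real_derivative f x) (at x)) \<and> (\<forall>x. (f has_real_derivative h x) (at x)) \<and>
    continuous_on UNIV h \<and> (\<forall>y. \<epsilon> \<le> \<bar>y\<bar> \<longrightarrow> f y = \<bar>y\<bar> powr \<beta>) \<and>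
    (\<forall>y. \<bar>y\<bar> < \<epsilon> \<longrightarrow> \<bar>f y\<bar> \<le> (1 + \<bar>\<beta>\<bar>) * \<epsilon> powr \<beta>) \<and>
    (\<forall>y. \<bar>\<Phi> y - signed_powr y (1 + \<beta>) / (1 + \<beta>)\<bar> \<le> (1 + \<bar>\<beta>\<bar> + 1 / (1 + \<beta>)) * \<epsilon> powr (1 + \<beta>))"
proof -
  \<comment> \<open>The coefficient of the homogeneous solution \<open>s powr (-1/2)\<close>,
    determined by continuity of r at \<epsilon>^2; the slopes then match by the differential
    equation. Outside [-\<epsilon>, \<epsilon>] it appears as the constant offset \<kappa> times the
    sign of y in \<Phi>, of order \<open>\<epsilon> powr (1 + \<beta>)\<close>.\<close>
  define \<kappa> where "\<kappa> = \<epsilon> powr (1 + \<beta>) * (1 - \<beta>/3 - 1 / (1 + \<beta>))"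
  define q where "q s = (if s < \<epsilon>\<^sup>2 then \<epsilon> powr \<beta> * (1 + \<beta>/2 * (s / \<epsilon>\<^sup>2 - 1)) else s powr (\<beta>/2))" for s
  \<comment> \<open>The tangent line has the slope at \<epsilon>^2 throughout, so \<open>max\<close>
    merges both branches and makes continuity evident.\<close>
  define q' where "q' s = \<beta>/2 * (max s (\<epsilon>\<^sup>2)) powr (\<beta>/2 - 1)" for s
  define r where "r s = (if s < \<epsilon>\<^sup>2 then \<epsilon> powr \<beta> * ((1 - \<beta>/2) + \<beta>/6 * (s / \<epsilon>\<^sup>2)) else s powr (\<beta>/2) / (1 + \<beta>) + \<kappa> * s powr (-1/2))" for s
  define r' where "r' s = (if s < \<epsilon>\<^sup>2 then \<epsilon> powr \<beta> * (\<beta>/6 / \<epsilon>\<^sup>2) else \<beta>/2 * s powr (\<beta>/2 - 1) / (1 + \<beta>) + \<kappa> * (-1/2 * s powr (-1/2 - 1)))" for s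
  have \<epsilon>2: "0 < \<epsilon>\<^sup>2" using \<epsilon> by simp
  have sq: "(y\<^sup>2) powr b = \<bar>y\<bar> powr (2 * b)" for y b :: real
  proof (cases "y = 0")
    case False
    then have "y\<^sup>2 = \<bar>y\<bar> powr 2" by (simp add: powr_numeral)
    then show ?thesis by (simp only: powr_powr)
  qed simp
  have \<epsilon>sq: "(\<epsilon>\<^sup>2) powr b = \<epsilon> powr (2 * b)" for b using sq[of \<epsilon> b] \<epsilon> by simp
  have \<epsilon>pow: "\<epsilon> powr (\<beta> - 2) = \<epsilon> powr \<beta> / \<epsilon>\<^sup>2" "\<epsilon> powr (1 + \<beta>) = \<epsilon> * \<epsilon> powr \<beta>" "\<epsilon> powr (- 1) = 1 / \<epsilon>" "\<epsilon> powr (- 3) = 1 / \<epsilon> ^ 3"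
    using \<epsilon> by (simp_all add: powr_diff powr_add powr_numeral powr_minus_divide)
  have \<beta>1: "1 + \<beta> \<noteq> 0" "0 < 1 + \<beta>" using \<beta> by auto
  have powr_deriv: "((\<lambda>s. s powr b) has_real_derivative b * s powr (b - 1)) (at s)" if "0 < s" for s b :: real
    using that by (rule has_real_derivative_powr)
  have "(q has_real_derivative (if s < \<epsilon>\<^sup>2 then \<epsilon> powr \<beta> * (\<beta>/2 / \<epsilon>\<^sup>2) else \<beta>/2 * s powr (\<beta>/2 - 1))) (at s)" for s
    unfolding q_def
  proof (rule DERIV_if_less)
    show "\<epsilon> powr \<beta> * (1 + \<beta> / 2 * (\<epsilon>\<^sup>2 / \<epsilon>\<^sup>2 - 1)) = \<epsilon>\<^sup>2 powr (\<beta> / 2)" using \<epsilon> by (simp add: \<epsilon>sq)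
    show "\<epsilon> powr \<beta> * (\<beta>/2 / \<epsilon>\<^sup>2) = \<beta>/2 * \<epsilon>\<^sup>2 powr (\<beta>/2 - 1)"
      by (simp add: \<epsilon>sq right_diff_distrib \<epsilon>pow)
    show "((\<lambda>s. s powr (\<beta>/2)) has_real_derivative \<beta>/2 * s powr (\<beta>/2 - 1)) (at s)" if "\<epsilon>\<^sup>2 \<le> s" for s
      by (rule powr_deriv) (use that \<epsilon>2 in linarith)
    show "((\<lambda>s. \<epsilon> powr \<beta> * (1 + \<beta>/2 * (s / \<epsilon>\<^sup>2 - 1))) has_real_derivative \<epsilon> powr \<beta> * (\<beta>/2 / \<epsilon>\<^sup>2)) (at s)" for s
      using \<epsilon> by (auto intro!: derivative_eq_intros simp: power2_eq_square power4_eq_xxxx)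
  qed
  moreover have "(if s < \<epsilon>\<^sup>2 then \<epsilon> powr \<beta> * (\<beta>/2 / \<epsilon>\<^sup>2) else \<beta>/2 * s powr (\<beta>/2 - 1)) = q' s" for s
    unfolding q'_def by (auto simp: max_def \<epsilon>sq right_diff_distrib \<epsilon>pow)
  ultimately have q: "(q has_real_derivative q' s) (at s)" for s by simp
  have \<kappa>3: "\<kappa> * (1 / \<epsilon> ^ 3) = \<epsilon> powr \<beta> / \<epsilon>\<^sup>2 * (1 - \<beta>/3 - 1 / (1 + \<beta>))"
    using \<epsilon> by (simp add: \<kappa>_def \<epsilon>pow power2_eq_square power3_eq_cube)
  have \<kappa>1: "\<kappa> * (1 / \<epsilon>) = \<epsilon> powr \<beta> * (1 - \<beta>/3 - 1 / (1 + \<beta>))"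
    using \<epsilon> by (simp add: \<kappa>_def \<epsilon>pow)
  have r: "(r has_real_derivative r' s) (at s)" for s
    unfolding r_def r'_def
  proof (rule DERIV_if_less)
    have "\<epsilon>\<^sup>2 powr (\<beta>/2) / (1 + \<beta>) + \<kappa> * \<epsilon>\<^sup>2 powr (-1/2) = \<epsilon> powr \<beta> / (1 + \<beta>) + \<kappa> * (1 / \<epsilon>)"
      using \<epsilon> by (simp add: \<epsilon>sq \<epsilon>pow)
    also have "\<dots> = \<epsilon> powr \<beta> * (1 / (1 + \<beta>) + (1 - \<beta>/3 - 1 / (1 + \<beta>)))"
      unfolding \<kappa>1 by (simp add: algebra_simps)
    finally show "\<epsilon> powr \<beta> * (1 - \<beta>/2 + \<beta>/6 * (\<epsilon>\<^sup>2 / \<epsilon>\<^sup>2)) = \<epsilon>\<^sup>2 powr (\<beta>/2) / (1 + \<beta>) + \<kappa> * \<epsilon>\<^sup>2 powr (-1/2)"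
      using \<epsilon> by simp
    have "\<beta>/2 * \<epsilon>\<^sup>2 powr (\<beta>/2 - 1) / (1 + \<beta>) + \<kappa> * (-1/2 * \<epsilon>\<^sup>2 powr (-1/2 - 1))
        = \<beta>/2 * (\<epsilon> powr \<beta> / \<epsilon>\<^sup>2) / (1 + \<beta>) - 1/2 * (\<kappa> * (1 / \<epsilon> ^ 3))"
      by (simp add: \<epsilon>sq right_diff_distrib \<epsilon>pow)
    also have "\<dots> = \<epsilon> powr \<beta> / \<epsilon>\<^sup>2 * (\<beta>/2 / (1 + \<beta>) - 1/2 * (1 - \<beta>/3 - 1 / (1 + \<beta>)))"
      unfolding \<kappa>3 by (simp add: algebra_simps)
    also have "\<beta>/2 / (1 + \<beta>) - 1/2 * (1 - \<beta>/3 - 1 / (1 + \<beta>)) = \<beta>/6"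
      using \<beta>1 by (simp add: divide_simps) (simp add: algebra_simps)
    finally show "\<epsilon> powr \<beta> * (\<beta>/6 / \<epsilon>\<^sup>2) = \<beta>/2 * \<epsilon>\<^sup>2 powr (\<beta>/2 - 1) / (1 + \<beta>) + \<kappa> * (-1/2 * \<epsilon>\<^sup>2 powr (-1/2 - 1))"
      by simp
    show "((\<lambda>s. s powr (\<beta>/2) / (1 + \<beta>) + \<kappa> * s powr (-1/2)) has_real_derivative
        \<beta>/2 * s powr (\<beta>/2 - 1) / (1 + \<beta>) + \<kappa> * (-1/2 * s powr (-1/2 - 1))) (at s)" if "\<epsilon>\<^sup>2 \<le> s" for s
      using that \<epsilon>2 by (intro DERIV_add DERIV_cdivide DERIV_cmult powr_deriv) linarith+
    show "((\<lambda>s. \<epsilon> powr \<beta> * (1 - \<beta>/2 + \<beta>/6 * (s / \<epsilon>\<^sup>2))) has_real_derivative \<epsilon> powr \<beta> * (\<beta>/6 / \<epsilon>\<^sup>2)) (at s)" for s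
      using \<epsilon> by (auto intro!: derivative_eq_intros simp: power2_eq_square power4_eq_xxxx)
  qed
  have rq: "r s + 2 * s * r' s = q s" for s
  proof (cases "s < \<epsilon>\<^sup>2")
    case True
    then show ?thesis using \<epsilon> by (simp add: r_def r'_def q_def field_simps)
  next
    case False
    then have s: "0 < s" using \<epsilon>2 by linarith
    have "s * s powr (b - 1) = s powr b" for b using s by (simp add: powr_mult_base)
    note p = this[of "\<beta>/2"] this[of "-1/2"]
    have alg: "A / w + k * P + 2 * s * (\<beta>/2 * Q / w + k * (-1/2 * R)) = A / w + k * P + (\<beta> * (s * Q) / w - k * (s * R))"
      for A P Q R w k by (simp add: algebra_simps)
    have "r s + 2 * s * r' s = s powr (\<beta>/2) / (1 + \<beta>) + \<kappa> * s powr (-1/2)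
        + (\<beta> * (s * s powr (\<beta>/2 - 1)) / (1 + \<beta>) - \<kappa> * (s * s powr (-1/2 - 1)))"
      using False by (simp only: r_def r'_def if_False alg)
    also have "\<dots> = s powr (\<beta>/2) * (1 / (1 + \<beta>) + \<beta> / (1 + \<beta>))"
      unfolding p by (simp add: algebra_simps)
    also have "1 / (1 + \<beta>) + \<beta> / (1 + \<beta>) = 1" using \<beta>1 by (simp add: add_divide_distrib[symmetric])
    finally show ?thesis using False by (simp add: q_def)
  qed
  define \<Phi> where "\<Phi> y = y * r (y\<^sup>2)" for y
  define f where "f y = q (y\<^sup>2)" for y
  define h where "h y = q' (y\<^sup>2) * (2 * y)" for y
  have comp: "((\<lambda>y. k (y\<^sup>2)) has_real_derivative k' (y\<^sup>2) * (2 * y)) (at y)"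
    if "\<And>s. (k has_real_derivative k' s) (at s)" for k k' :: "real \<Rightarrow> real" and y
    by (rule DERIV_chain'[of "\<lambda>y. y\<^sup>2" "2 * y" y UNIV k "k' (y\<^sup>2)"]) (auto intro!: derivative_eq_intros that)
  have "(f has_real_derivative h y) (at y)" for y
    unfolding f_def h_def by (rule comp[OF q])
  moreover have "(\<Phi> has_real_derivative f y) (at y)" for y
  proof -
    have "((\<lambda>y. y * r (y\<^sup>2)) has_real_derivative 1 * r (y\<^sup>2) + (r' (y\<^sup>2) * (2 * y)) * y) (at y)"
      by (rule DERIV_mult[OF DERIV_ident comp[OF r]])
    moreover have "1 * r (y\<^sup>2) + (r' (y\<^sup>2) * (2 * y)) * y = f y"
      unfolding f_def rq[symmetric] by (simp add: power2_eq_square)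
    ultimately show ?thesis unfolding \<Phi>_def by simp
  qed
  moreover have "continuous_on UNIV h"
    unfolding h_def q'_def using \<epsilon>2 by (intro continuous_intros) (auto simp: max_def)
  moreover have out: "\<not> y\<^sup>2 < \<epsilon>\<^sup>2" if "\<epsilon> \<le> \<bar>y\<bar>" for y
    using that \<epsilon> by (simp add: not_less abs_le_square_iff[symmetric])
  then have "f y = \<bar>y\<bar> powr \<beta>" if "\<epsilon> \<le> \<bar>y\<bar>" for y
    using that by (simp add: f_def q_def sq)
  moreover have inside: "y\<^sup>2 < \<epsilon>\<^sup>2" "0 \<le> y\<^sup>2 / \<epsilon>\<^sup>2" "y\<^sup>2 / \<epsilon>\<^sup>2 \<le> 1" if "\<bar>y\<bar> < \<epsilon>" for y
  proof -
    show *: "y\<^sup>2 < \<epsilon>\<^sup>2" using that by (metis abs_ge_zero power2_abs power_strict_mono zero_less_numeral)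
    show "0 \<le> y\<^sup>2 / \<epsilon>\<^sup>2" "y\<^sup>2 / \<epsilon>\<^sup>2 \<le> 1" using * \<epsilon>2 by auto
  qed
  have factor: "\<bar>b * x\<bar> \<le> \<bar>b\<bar>" if "\<bar>x\<bar> \<le> 1" for b x :: real
    unfolding abs_mult using that by (simp add: mult_left_le)
  have "\<bar>f y\<bar> \<le> (1 + \<bar>\<beta>\<bar>) * \<epsilon> powr \<beta>" if "\<bar>y\<bar> < \<epsilon>" for y
  proof -
    have "\<bar>\<beta>/2 * (y\<^sup>2 / \<epsilon>\<^sup>2 - 1)\<bar> \<le> \<bar>\<beta>/2\<bar>" using inside[OF that] by (intro factor) auto
    then have "\<bar>1 + \<beta>/2 * (y\<^sup>2 / \<epsilon>\<^sup>2 - 1)\<bar> \<le> 1 + \<bar>\<beta>\<bar>" by linarith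
    then show ?thesis using inside(1)[OF that]
      by (simp add: f_def q_def abs_mult mult.commute mult_left_mono)
  qed
  moreover have "\<bar>\<Phi> y - signed_powr y (1 + \<beta>) / (1 + \<beta>)\<bar> \<le> (1 + \<bar>\<beta>\<bar> + 1 / (1 + \<beta>)) * \<epsilon> powr (1 + \<beta>)" for y
  proof (cases "\<epsilon> \<le> \<bar>y\<bar>")
    case True
    then have y: "y \<noteq> 0" using \<epsilon> by auto
    have "\<Phi> y = y * \<bar>y\<bar> powr \<beta> / (1 + \<beta>) + \<kappa> * (y / \<bar>y\<bar>)"
      using out[OF True] y by (simp add: \<Phi>_def r_def sq powr_minus_divide algebra_simps)
    moreover have "signed_powr y (1 + \<beta>) = y * \<bar>y\<bar> powr \<beta>"
      using y by (simp add: signed_powr_def powr_add abs_mult_sgn mult_ac)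
    ultimately have "\<bar>\<Phi> y - signed_powr y (1 + \<beta>) / (1 + \<beta>)\<bar> = \<bar>\<kappa>\<bar>"
      using y by (simp add: abs_mult)
    also have "\<dots> \<le> \<epsilon> powr (1 + \<beta>) * (1 + \<bar>\<beta>\<bar> + 1 / (1 + \<beta>))"
    proof -
      have "0 < 1 / (1 + \<beta>)" using \<beta>1 by simp
      then have "\<bar>1 - \<beta>/3 - 1 / (1 + \<beta>)\<bar> \<le> 1 + \<bar>\<beta>\<bar> + 1 / (1 + \<beta>)" by linarith
      then show ?thesis unfolding \<kappa>_def abs_mult by (simp add: mult_left_mono)
    qed
    finally show ?thesis by (simp add: mult.commute)
  next
    case False
    then have y: "\<bar>y\<bar> < \<epsilon>" by simp
    have "\<bar>\<beta>/6 * (y\<^sup>2 / \<epsilon>\<^sup>2)\<bar> \<le> \<bar>\<beta>/6\<bar>" using inside[OF y] by (intro factor) auto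
    then have "\<bar>(1 - \<beta>/2) + \<beta>/6 * (y\<^sup>2 / \<epsilon>\<^sup>2)\<bar> \<le> 1 + \<bar>\<beta>\<bar>" by linarith
    then have "\<bar>y\<bar> * (\<epsilon> powr \<beta> * \<bar>(1 - \<beta>/2) + \<beta>/6 * (y\<^sup>2 / \<epsilon>\<^sup>2)\<bar>) \<le> \<epsilon> * (\<epsilon> powr \<beta> * (1 + \<bar>\<beta>\<bar>))"
      using y \<epsilon> by (intro mult_mono) auto
    then have 1: "\<bar>\<Phi> y\<bar> \<le> \<epsilon> powr (1 + \<beta>) * (1 + \<bar>\<beta>\<bar>)"
      using inside(1)[OF y] by (simp add: \<Phi>_def r_def abs_mult \<epsilon>pow mult_ac)
    have "\<bar>signed_powr y (1 + \<beta>)\<bar> \<le> \<bar>y\<bar> powr (1 + \<beta>)"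
      by (simp add: signed_powr_def abs_mult abs_sgn_eq)
    also have "\<dots> \<le> \<epsilon> powr (1 + \<beta>)" using y \<beta>1 by (intro powr_mono2) auto
    finally have "\<bar>signed_powr y (1 + \<beta>) / (1 + \<beta>)\<bar> \<le> \<epsilon> powr (1 + \<beta>) * (1 / (1 + \<beta>))"
      using \<beta>1 by (simp add: divide_right_mono)
    then have "\<bar>\<Phi> y - signed_powr y (1 + \<beta>) / (1 + \<beta>)\<bar> \<le> \<epsilon> powr (1 + \<beta>) * (1 + \<bar>\<beta>\<bar>) + \<epsilon> powr (1 + \<beta>) * (1 / (1 + \<beta>))"
      using 1 by linarith
    also have "\<dots> = (1 + \<bar>\<beta>\<bar> + 1 / (1 + \<beta>)) * \<epsilon> powr (1 + \<beta>)" by (simp only: distrib_left distrib_right mult.commute)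
    finally show ?thesis .
  qed
  ultimately show ?thesis by blast
qed

lemma nn_integral_abs_powr:
  fixes b \<epsilon> :: real
  assumes "- 1 < b" "0 \<le> \<epsilon>"
  shows "(\<integral>\<^sup>+y. ennreal (\<bar>y\<bar> powr b) * indicator {-\<epsilon>..\<epsilon>} y \<partial>lborel) \<le> ennreal (2 * (\<epsilon> powr (b + 1) / (b + 1)))"
proof -
  let ?I = "\<integral>\<^sup>+y. ennreal (\<bar>y\<bar> powr b) * indicator {0..\<epsilon>} y \<partial>lborel"
  have "((\<lambda>x. \<bar>x\<bar> powr b) has_integral (\<epsilon> powr (b + 1) / (b + 1))) {0..\<epsilon>}"
    using has_integral_powr_from_0[OF assms] by (rule has_integral_eq[rotated]) simp
  then have I: "?I = ennreal (\<epsilon> powr (b + 1) / (b + 1))"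
    by (intro nn_integral_has_integral_lebesgue') auto
  have "(\<integral>\<^sup>+y. ennreal (\<bar>y\<bar> powr b) * indicator {-\<epsilon>..\<epsilon>} y \<partial>lborel)
      \<le> (\<integral>\<^sup>+y. ennreal (\<bar>y\<bar> powr b) * indicator {0..\<epsilon>} y + ennreal (\<bar>-y\<bar> powr b) * indicator {0..\<epsilon>} (-y) \<partial>lborel)"
    by (intro nn_integral_mono) (auto simp: indicator_def)
  also have "\<dots> = ?I + (\<integral>\<^sup>+y. ennreal (\<bar>-y\<bar> powr b) * indicator {0..\<epsilon>} (-y) \<partial>lborel)"
    by (rule nn_integral_add) measurable
  also have "(\<integral>\<^sup>+y. ennreal (\<bar>-y\<bar> powr b) * indicator {0..\<epsilon>} (-y) \<partial>lborel) = ?I"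
    using nn_integral_real_affine[of "\<lambda>y. ennreal (\<bar>y\<bar> powr b) * indicator {0..\<epsilon>} y" "-1" 0] by simp
  finally show ?thesis
    unfolding I using assms by (simp add: ennreal_plus[symmetric] del: ennreal_plus)
qed

text \<open>The error lives on [-\<epsilon>, \<epsilon>], where the square of the power integrates
  to order \<open>\<epsilon> powr (2 * \<beta> + 1)\<close> and the square of f is at most of order
  \<open>\<epsilon> powr (2 * \<beta>)\<close> on length \<open>2 * \<epsilon>\<close>. The exponent
  \<open>2 * \<beta> + 1\<close> is positive exactly when \<beta> > -1/2.\<close>

lemma power_smoothing_error:
  fixes f :: "real \<Rightarrow> real"
  assumes \<beta>: "- 1/2 < \<beta>" and \<epsilon>: "0 < \<epsilon>" and f: "f \<in> borel_measurable borel"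
    and out: "\<And>y. \<epsilon> \<le> \<bar>y\<bar> \<Longrightarrow> f y = \<bar>y\<bar> powr \<beta>"
    and inside: "\<And>y. \<bar>y\<bar> < \<epsilon> \<Longrightarrow> \<bar>f y\<bar> \<le> c * \<epsilon> powr \<beta>"
  shows "(\<integral>\<^sup>+y. ennreal ((\<bar>y\<bar> powr \<beta> - f y)\<^sup>2) \<partial>lborel) \<le> ennreal ((4 / (2 * \<beta> + 1) + 4 * c\<^sup>2) * \<epsilon> powr (2 * \<beta> + 1))"
proof -
  have sq: "(x powr \<beta>)\<^sup>2 = x powr (2 * \<beta>)" for x :: real
    by (simp add: power2_eq_square powr_add[symmetric])
  have combine: "ennreal 2 * ennreal (2 * u) + ennreal (2 * c\<^sup>2 * v) * ennreal (2 * w) = ennreal (4 * u + 4 * c\<^sup>2 * (v * w))"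
    if "0 \<le> u" "0 \<le> v" "0 \<le> w" for u v w
  proof -
    have "ennreal 2 * ennreal (2 * u) = ennreal (2 * (2 * u))" using that by (intro ennreal_mult[symmetric]) auto
    moreover have "ennreal (2 * c\<^sup>2 * v) * ennreal (2 * w) = ennreal (2 * c\<^sup>2 * v * (2 * w))"
      using that by (intro ennreal_mult[symmetric]) auto
    moreover have "ennreal (2 * (2 * u)) + ennreal (2 * c\<^sup>2 * v * (2 * w)) = ennreal (2 * (2 * u) + 2 * c\<^sup>2 * v * (2 * w))"
      using that by (intro ennreal_plus[symmetric]) auto
    ultimately show ?thesis by (simp add: mult_ac)
  qed
  have "ennreal ((\<bar>y\<bar> powr \<beta> - f y)\<^sup>2)
      \<le> ennreal 2 * (ennreal (\<bar>y\<bar> powr (2 * \<beta>)) * indicator {-\<epsilon>..\<epsilon>} y) + ennreal (2 * c\<^sup>2 * \<epsilon> powr (2 * \<beta>)) * indicator {-\<epsilon>..\<epsilon>} y" for y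
  proof (cases "\<epsilon> \<le> \<bar>y\<bar>")
    case False
    then have y: "y \<in> {-\<epsilon>..\<epsilon>}" "\<bar>y\<bar> < \<epsilon>" by auto
    have "(\<bar>y\<bar> powr \<beta> - f y)\<^sup>2 \<le> 2 * (\<bar>y\<bar> powr \<beta>)\<^sup>2 + 2 * (f y)\<^sup>2"
      using sum_squares_bound[of "\<bar>y\<bar> powr \<beta>" "- f y"] by (simp add: power2_eq_square algebra_simps)
    moreover have "(f y)\<^sup>2 \<le> (c * \<epsilon> powr \<beta>)\<^sup>2"
      using inside[OF y(2)] by (metis abs_ge_zero power2_abs power_mono)
    ultimately have "(\<bar>y\<bar> powr \<beta> - f y)\<^sup>2 \<le> 2 * \<bar>y\<bar> powr (2 * \<beta>) + 2 * c\<^sup>2 * \<epsilon> powr (2 * \<beta>)"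
      by (simp add: sq power_mult_distrib)
    then have "ennreal ((\<bar>y\<bar> powr \<beta> - f y)\<^sup>2) \<le> ennreal (2 * \<bar>y\<bar> powr (2 * \<beta>) + 2 * c\<^sup>2 * \<epsilon> powr (2 * \<beta>))"
      by (rule ennreal_leI)
    also have "\<dots> = ennreal 2 * ennreal (\<bar>y\<bar> powr (2 * \<beta>)) + ennreal (2 * c\<^sup>2 * \<epsilon> powr (2 * \<beta>))"
      by (subst ennreal_plus) (auto simp: ennreal_mult)
    finally show ?thesis using y(1) by simp
  qed (simp add: out)
  then have "(\<integral>\<^sup>+y. ennreal ((\<bar>y\<bar> powr \<beta> - f y)\<^sup>2) \<partial>lborel)
      \<le> (\<integral>\<^sup>+y. ennreal 2 * (ennreal (\<bar>y\<bar> powr (2 * \<beta>)) * indicator {-\<epsilon>..\<epsilon>} y) + ennreal (2 * c\<^sup>2 * \<epsilon> powr (2 * \<beta>)) * indicator {-\<epsilon>..\<epsilon>} y \<partial>lborel)"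
    by (rule nn_integral_mono)
  also have "\<dots> = ennreal 2 * (\<integral>\<^sup>+y. ennreal (\<bar>y\<bar> powr (2 * \<beta>)) * indicator {-\<epsilon>..\<epsilon>} y \<partial>lborel) + ennreal (2 * c\<^sup>2 * \<epsilon> powr (2 * \<beta>)) * ennreal (2 * \<epsilon>)"
    using \<epsilon> by (subst nn_integral_add) (auto simp: nn_integral_cmult nn_integral_cmult_indicator)
  also have "\<dots> \<le> ennreal 2 * ennreal (2 * (\<epsilon> powr (2 * \<beta> + 1) / (2 * \<beta> + 1))) + ennreal (2 * c\<^sup>2 * \<epsilon> powr (2 * \<beta>)) * ennreal (2 * \<epsilon>)"
    using \<beta> \<epsilon> by (intro add_mono mult_left_mono nn_integral_abs_powr) auto
  also have "\<dots> = ennreal (4 * (\<epsilon> powr (2 * \<beta> + 1) / (2 * \<beta> + 1)) + 4 * c\<^sup>2 * (\<epsilon> powr (2 * \<beta>) * \<epsilon>))"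
    using \<beta> \<epsilon> by (intro combine) auto
  also have "\<epsilon> powr (2 * \<beta>) * \<epsilon> = \<epsilon> powr (2 * \<beta> + 1)" using \<epsilon> by (simp add: powr_add)
  also have "4 * (\<epsilon> powr (2 * \<beta> + 1) / (2 * \<beta> + 1)) + 4 * c\<^sup>2 * \<epsilon> powr (2 * \<beta> + 1) = (4 / (2 * \<beta> + 1) + 4 * c\<^sup>2) * \<epsilon> powr (2 * \<beta> + 1)"
    by (simp add: distrib_right)
  finally show ?thesis .
qed

section \<open>Powers of Brownian motion\<close>

context brownian begin

text \<open>The error \<open>g\<close> of the smoothing has small \<open>L\<^sup>2\<close> norm, but the density of \<open>B t + a\<close> blows up
  like \<open>t powr (- 1/2)\<close> as \<open>t\<close> tends to \<open>0\<close>, which matters for sums over left endpoints. The three cases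
  control this by the ratios of the partition, by the distance of \<open>a\<close> from the support of \<open>g\<close>, and
  by boundedness of \<open>g\<close>.\<close>

lemma left_endpoint_square_sum:
  fixes a \<beta> T s G :: real
  assumes T: "0 \<le> T" and s: "0 < s" and D: "partition_sequence D"
    and cases: "ratio_bounded D \<or> a \<noteq> 0 \<or> 0 \<le> \<beta>"
  shows "\<exists>C\<ge>0. \<exists>\<epsilon>1>0. \<exists>m1>0. \<forall>\<epsilon> g N n K. 0 < \<epsilon> \<longrightarrow> \<epsilon> \<le> \<epsilon>1 \<longrightarrow> g \<in> borel_measurable borel \<longrightarrow>
    (\<forall>y. \<epsilon> \<le> \<bar>y\<bar> \<longrightarrow> g y = 0) \<longrightarrow> (0 \<le> \<beta> \<longrightarrow> (\<forall>y. \<bar>g y\<bar> \<le> G)) \<longrightarrow>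
    (\<integral>\<^sup>+y. ennreal ((g y)\<^sup>2) \<partial>lborel) \<le> ennreal N \<longrightarrow> 0 \<le> N \<longrightarrow>
    (\<forall>k. D n (Suc k) - D n k \<le> m1) \<longrightarrow> {k. D n k < T} = {..<K} \<longrightarrow>
    (\<Sum>k\<in>{1..<K}. expectation (\<lambda>\<omega>. (g (B (D n k) \<omega> + a))\<^sup>2) * (D n (Suc k) - D n k)) \<le> s + C * N"
proof -
  let ?E = "\<lambda>g n k. expectation (\<lambda>\<omega>. (g (B (D n k) \<omega> + a))\<^sup>2) * (D n (Suc k) - D n k)"
  let ?S = "\<lambda>g n K. \<Sum>k\<in>{1..<K}. ?E g n k"
  have part: "strict_mono (D n)" "D n 0 = 0" "\<And>t. finite {k. D n k \<le> t}" for n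
    using D unfolding partition_sequence_def by auto
  have pos: "0 \<le> D n k" for n k using part by (metis strict_mono_less_eq zero_le)
  have less: "D n k < D n (Suc k)" for n k using part by (simp add: strict_mono_less)
  have pos': "0 < D n k" if "1 \<le> k" for n k
    using pos[of n "k - 1"] less[of n "k - 1"] that by simp
  have last: "D n K \<le> t + m" if "{k. D n k < t} = {..<K}" "\<forall>k. D n (Suc k) - D n k \<le> m" "0 \<le> t" "0 < m" for n K t m
  proof (cases K)
    case 0
    then show ?thesis using part that by simp
  next
    case (Suc k)
    then have "D n k < t" using that(1) by blast
    then show ?thesis using spec[OF that(2), of k] Suc by simp
  qed
  have tele: "(\<Sum>k\<in>{1..<K}. D n (Suc k) - D n k) \<le> D n K" for n K
  proof -
    have "(\<Sum>k\<in>{1..<K}. D n (Suc k) - D n k) \<le> (\<Sum>k<K. D n (Suc k) - D n k)"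
      using less by (intro sum_mono2) (auto simp: less_imp_le)
    then show ?thesis using part by (simp add: sum_lessThan_telescope)
  qed
  consider (ratio) "ratio_bounded D" | (away) "a \<noteq> 0" | (bounded) "0 \<le> \<beta>" using cases by blast
  then show ?thesis
  proof cases
    case ratio
    then obtain c0 where c0: "\<And>n k. D n (Suc (Suc k)) \<le> c0 * D n (Suc k)"
      unfolding ratio_bounded_def by blast
    define c where "c = \<bar>c0\<bar>"
    have c: "0 \<le> c" "D n (Suc k) \<le> c * D n k" if "1 \<le> k" for n k
    proof -
      show "0 \<le> c" by (simp add: c_def)
      have "D n (Suc k) \<le> c0 * D n k" using c0[of n "k - 1"] that by simp
      also have "\<dots> \<le> c * D n k" using pos by (intro mult_right_mono) (auto simp: c_def)
      finally show "D n (Suc k) \<le> c * D n k" .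
    qed
    have c_nonneg: "0 \<le> c" by (simp add: c_def)
    show ?thesis
    proof (rule exI[of _ "c powr (1/2) * (2 * (T + 1) powr (1/2))"],
        (rule conjI[OF _ exI[of _ "1::real", OF conjI[OF _ exI[of _ "1::real", OF conjI]]]]; (intro allI impI)?))
      show "0 \<le> c powr (1/2) * (2 * (T + 1) powr (1/2))" by simp
      fix \<epsilon> N :: real and g :: "real \<Rightarrow> real" and n K
      assume g: "g \<in> borel_measurable borel" and N: "(\<integral>\<^sup>+y. ennreal ((g y)\<^sup>2) \<partial>lborel) \<le> ennreal N" "0 \<le> N"
        and mesh: "\<forall>k. D n (Suc k) - D n k \<le> 1" and K: "{k. D n k < T} = {..<K}"
      have "?E g n k
          \<le> N * c powr (1/2) * ((D n (Suc k) - D n k) * D n (Suc k) powr (1/2 - 1))" if k: "k \<in> {1..<K}" for k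
      proof -
        have k1: "1 \<le> k" using k by simp
        note t = pos'[OF k1, of n] pos'[of "Suc k" n]
        \<comment> \<open>Bounded ratios move the singular factor from the left endpoint to the
          right one, at the price of \<open>c powr (1/2)\<close>, which makes
          \<open>powr_mesh_sum_le\<close> applicable.\<close>
        have "D n k powr (-1/2) \<le> c powr (1/2) * D n (Suc k) powr (-1/2)"
        proof -
          have "D n (Suc k) powr (1/2) \<le> (c * D n k) powr (1/2)"
            using c(2)[OF k1, of n] t by (intro powr_mono2) auto
          also have "\<dots> = c powr (1/2) * D n k powr (1/2)"
            using c_nonneg t by (simp add: powr_mult)
          finally show ?thesis using t by (simp add: powr_minus_divide divide_simps mult_ac)
        qed
        moreover have "expectation (\<lambda>\<omega>. (g (B (D n k) \<omega> + a))\<^sup>2) \<le> D n k powr (-1/2) * N"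
          using B_shift_square_bound(2)[OF t(1) g normal_density_le_sqrt[OF t(1)] N] by simp
        ultimately have "expectation (\<lambda>\<omega>. (g (B (D n k) \<omega> + a))\<^sup>2) \<le> (c powr (1/2) * D n (Suc k) powr (-1/2)) * N"
          using N(2) by (meson mult_right_mono order_trans)
        then have "?E g n k
            \<le> (c powr (1/2) * D n (Suc k) powr (-1/2)) * N * (D n (Suc k) - D n k)"
          using less[of n k] by (intro mult_right_mono) auto
        then show ?thesis by (simp add: mult_ac)
      qed
      then have "?S g n K
          \<le> (\<Sum>k\<in>{1..<K}. N * c powr (1/2) * ((D n (Suc k) - D n k) * D n (Suc k) powr (1/2 - 1)))"
        by (rule sum_mono)
      also have "\<dots> \<le> (\<Sum>k<K. N * c powr (1/2) * ((D n (Suc k) - D n k) * D n (Suc k) powr (1/2 - 1)))"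
        using less N(2) by (intro sum_mono2 mult_nonneg_nonneg) (auto simp: less_imp_le)
      also have "\<dots> = N * c powr (1/2) * (\<Sum>k<K. (D n (Suc k) - D n k) * D n (Suc k) powr (1/2 - 1))"
        by (simp only: sum_distrib_left)
      also have "\<dots> \<le> N * c powr (1/2) * (D n K powr (1/2) / (1/2))"
        using powr_mesh_sum_le[OF _ _ part(1)[of n] part(2)[of n], of "1/2" K] N(2) by (intro mult_left_mono) auto
      also have "\<dots> \<le> N * c powr (1/2) * (2 * (T + 1) powr (1/2))"
        using powr_mono2[of "1/2" "D n K" "T + 1"] last[OF K mesh T] pos[of n K] N(2)
        by (intro mult_left_mono) auto
      finally show "?S g n K
          \<le> s + c powr (1/2) * (2 * (T + 1) powr (1/2)) * N"
        using s by (simp add: mult_ac)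
    qed simp_all
  next
    case away
    show ?thesis
    proof (rule exI[of _ "2 / \<bar>a\<bar> * (T + 1)"],
        (rule conjI[OF _ exI[of _ "\<bar>a\<bar> / 2", OF conjI[OF _ exI[of _ "1::real", OF conjI]]]]; (intro allI impI)?))
      show "0 \<le> 2 / \<bar>a\<bar> * (T + 1)" "0 < \<bar>a\<bar> / 2" using T away by auto
      fix \<epsilon> N :: real and g :: "real \<Rightarrow> real" and n K
      assume \<epsilon>: "\<epsilon> \<le> \<bar>a\<bar> / 2" and g: "g \<in> borel_measurable borel" and supp: "\<forall>y. \<epsilon> \<le> \<bar>y\<bar> \<longrightarrow> g y = 0"
        and N: "(\<integral>\<^sup>+y. ennreal ((g y)\<^sup>2) \<partial>lborel) \<le> ennreal N" "0 \<le> N"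
        and mesh: "\<forall>k. D n (Suc k) - D n k \<le> 1" and K: "{k. D n k < T} = {..<K}"
      have "?E g n k
          \<le> 2 / \<bar>a\<bar> * N * (D n (Suc k) - D n k)" if k: "k \<in> {1..<K}" for k
      proof -
        have t: "0 < D n k" using pos'[of k n] k by simp
        \<comment> \<open>With \<epsilon> at most half of \<bar>a\<bar>, the support of g keeps
          distance \<bar>a\<bar>/2 from the starting point.\<close>
        have "normal_density 0 (sqrt (D n k)) (y - a) \<le> 2 / \<bar>a\<bar>" if "g y \<noteq> 0" for y
        proof -
          have "\<bar>y\<bar> < \<epsilon>" using supp that by (meson not_le)
          then have "\<bar>a\<bar> / 2 \<le> \<bar>y - a\<bar>" using \<epsilon> by linarith
          then have "normal_density 0 (sqrt (D n k)) (y - a) \<le> 1 / (\<bar>a\<bar> / 2)"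
            using away by (intro normal_density_le_away[OF t]) auto
          then show ?thesis by simp
        qed
        from B_shift_square_bound(2)[OF t g this N] show ?thesis
          using less[of n k] by (intro mult_right_mono) auto
      qed
      then have "?S g n K
          \<le> (\<Sum>k\<in>{1..<K}. 2 / \<bar>a\<bar> * N * (D n (Suc k) - D n k))"
        by (rule sum_mono)
      also have "\<dots> = 2 / \<bar>a\<bar> * N * (\<Sum>k\<in>{1..<K}. D n (Suc k) - D n k)"
        by (simp only: sum_distrib_left)
      also have "\<dots> \<le> 2 / \<bar>a\<bar> * N * (T + 1)"
        using order_trans[OF tele last[OF K mesh T]] N(2) by (intro mult_left_mono) auto
      finally show "?S g n K
          \<le> s + 2 / \<bar>a\<bar> * (T + 1) * N"
        using s by (simp add: mult_ac)
    qed simp_all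
  next
    case bounded
    \<comment> \<open>Intervals starting before \<theta> have total length at most
      \<open>2 * \<theta>\<close>, one mesh step included, and contribute at most s through the
      bound G. From \<theta> on the density is at most \<open>\<theta> powr (-1/2)\<close>. The
      added 1 covers G = 0.\<close>
    define \<theta> where "\<theta> = s / (2 * (G\<^sup>2 + 1))"
    have G1: "0 < G\<^sup>2 + 1" by (simp add: add_nonneg_pos)
    have \<theta>: "0 < \<theta>" using s G1 by (simp add: \<theta>_def)
    have \<theta>s: "G\<^sup>2 * (\<theta> + \<theta>) \<le> s"
    proof -
      have "c * (s / (2 * c) + s / (2 * c)) = s" if "0 < c" for c using that by (simp add: field_simps)
      then have "(G\<^sup>2 + 1) * (\<theta> + \<theta>) = s" unfolding \<theta>_def using G1 by blast
      then show ?thesis using \<theta> by (simp add: distrib_right)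
    qed
    show ?thesis
    proof (rule exI[of _ "\<theta> powr (-1/2) * (T + \<theta>)"],
        (rule conjI[OF _ exI[of _ "1::real", OF conjI[OF _ exI[of _ \<theta>, OF conjI]]]]; (intro allI impI)?))
      show "0 \<le> \<theta> powr (-1/2) * (T + \<theta>)" "0 < \<theta>" using T \<theta> by auto
      fix \<epsilon> N :: real and g :: "real \<Rightarrow> real" and n K
      assume g: "g \<in> borel_measurable borel" and "0 \<le> \<beta> \<longrightarrow> (\<forall>y. \<bar>g y\<bar> \<le> G)"
        and N: "(\<integral>\<^sup>+y. ennreal ((g y)\<^sup>2) \<partial>lborel) \<le> ennreal N" "0 \<le> N"
        and mesh: "\<forall>k. D n (Suc k) - D n k \<le> \<theta>" and K: "{k. D n k < T} = {..<K}"
      then have G: "\<bar>g y\<bar> \<le> G" for y using bounded by simp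
      obtain j where j: "{k. D n k < \<theta>} = {..<j}" using partition_below[OF part(1,3)] .
      have le: "?E g n k
          \<le> G\<^sup>2 * (if k < j then D n (Suc k) - D n k else 0) + \<theta> powr (-1/2) * N * (D n (Suc k) - D n k)" if k: "k \<in> {1..<K}" for k
      proof -
        have t: "0 < D n k" using pos'[of k n] k by simp
        note b = B_shift_square_bound[OF t g normal_density_le_sqrt[OF t] N, of a]
        have "expectation (\<lambda>\<omega>. (g (B (D n k) \<omega> + a))\<^sup>2) \<le> G\<^sup>2 * (if k < j then 1 else 0) + \<theta> powr (-1/2) * N"
        proof (cases "k < j")
          case True
          have "expectation (\<lambda>\<omega>. (g (B (D n k) \<omega> + a))\<^sup>2) \<le> expectation (\<lambda>\<omega>. G\<^sup>2)"
            using b(1) G by (intro integral_mono) (auto intro: power_mono[of "\<bar>g _\<bar>" G 2, simplified])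
          then show ?thesis using True N(2) by (simp add: prob_space add_increasing2)
        next
          case False
          then have "k \<notin> {k. D n k < \<theta>}" using j by simp
          then have "D n k powr (-1/2) \<le> \<theta> powr (-1/2)" using \<theta> by (intro powr_mono2') auto
          then have "D n k powr (-1/2) * N \<le> \<theta> powr (-1/2) * N" using N(2) by (rule mult_right_mono)
          then show ?thesis using b(2) False by simp
        qed
        then have "?E g n k
            \<le> (G\<^sup>2 * (if k < j then 1 else 0) + \<theta> powr (-1/2) * N) * (D n (Suc k) - D n k)"
          using less[of n k] by (intro mult_right_mono) auto
        then show ?thesis by (simp add: distrib_right split: if_splits)
      qed
      have "(\<Sum>k\<in>{1..<K}. if k < j then D n (Suc k) - D n k else 0) \<le> (\<Sum>k<j. D n (Suc k) - D n k)"
        by (subst sum.inter_filter[symmetric]) (use less in \<open>auto intro!: sum_mono2 simp: less_imp_le\<close>)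
      also have "\<dots> \<le> \<theta> + \<theta>" using last[OF j mesh] \<theta> part(2)[of n] by (simp add: sum_lessThan_telescope)
      finally have small: "G\<^sup>2 * (\<Sum>k\<in>{1..<K}. if k < j then D n (Suc k) - D n k else 0) \<le> s"
        using \<theta>s mult_left_mono[of _ "\<theta> + \<theta>" "G\<^sup>2"] by (meson order_trans zero_le_power2)
      have "?S g n K
          \<le> (\<Sum>k\<in>{1..<K}. G\<^sup>2 * (if k < j then D n (Suc k) - D n k else 0) + \<theta> powr (-1/2) * N * (D n (Suc k) - D n k))"
        by (rule sum_mono[OF le])
      also have "\<dots> = G\<^sup>2 * (\<Sum>k\<in>{1..<K}. if k < j then D n (Suc k) - D n k else 0)
          + \<theta> powr (-1/2) * N * (\<Sum>k\<in>{1..<K}. D n (Suc k) - D n k)"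
        by (simp only: sum.distrib sum_distrib_left)
      also have "\<dots> \<le> s + \<theta> powr (-1/2) * N * (T + \<theta>)"
        using order_trans[OF tele last[OF K mesh T \<theta>]] N(2) by (intro add_mono small mult_left_mono) auto
      finally show "?S g n K
          \<le> s + \<theta> powr (-1/2) * (T + \<theta>) * N"
        by (simp add: mult_ac)
    qed simp_all
  qed
qed


text \<open>Splitting the power as f + g, the smooth part converges and both endpoint sums of g are
  small uniformly in n. Z is the Ito limit for one smoothing only and so depends on e and p, as
  \<open>ucp_limit_exists\<close> allows; the trapezoidal limit is explicit and free of the
  smoothing.\<close>

lemma power_sum_limits:
  fixes a \<beta> T e p :: real
  assumes D: "partition_sequence D" and \<beta>: "- 1/2 < \<beta>"
    and cases: "ratio_bounded D \<or> a \<noteq> 0 \<or> 0 \<le> \<beta>"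
    and T: "0 \<le> T" and e: "0 < e" and p: "0 < p"
  shows "\<exists>Z. \<forall>\<^sub>F n in sequentially. holds_up_to M p (\<lambda>\<omega>. \<forall>t\<in>{0..T}.
    \<bar>(\<Sum>k | D n k < t. \<bar>B (D n k) \<omega> + a\<bar> powr \<beta> * (B (D n (Suc k)) \<omega> - B (D n k) \<omega>)) - Z t \<omega>\<bar> \<le> e \<and>
    \<bar>(\<Sum>k | D n k < t. (\<bar>B (D n k) \<omega> + a\<bar> powr \<beta> + \<bar>B (D n (Suc k)) \<omega> + a\<bar> powr \<beta>) / 2 * (B (D n (Suc k)) \<omega> - B (D n k) \<omega>))
       - (signed_powr (B t \<omega> + a) (1 + \<beta>) - signed_powr a (1 + \<beta>)) / (1 + \<beta>)\<bar> \<le> e)"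
    (is "\<exists>Z. ?E Z")
proof -
  define b where "b = 1 + \<bar>\<beta>\<bar>"
  have b: "1 \<le> b" by (simp add: b_def)
  define \<nu> where "\<nu> = 4 / (2 * \<beta> + 1) + 4 * b\<^sup>2"
  have \<nu>: "0 < \<nu>" using \<beta> b by (simp add: \<nu>_def add_pos_pos)
  define N where "N \<epsilon> = \<nu> * \<epsilon> powr (2 * \<beta> + 1)" for \<epsilon>
  \<comment> \<open>A third of the second moment allowed in \<open>forward_sum_bound\<close>: one
    share for the summand at time 0, one for the additive s of the endpoint estimate, one for
    \<open>C * N \<epsilon>\<close>.\<close>
  define s where "s = p/3 * (e/4)\<^sup>2 / 3"
  have s: "0 < s" using p e by (simp add: s_def)
  obtain C \<epsilon>1 m1 where C: "0 \<le> C" and \<epsilon>1: "0 < \<epsilon>1" and m1: "0 < m1"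
    and sums: "\<And>\<epsilon> g N n K. 0 < \<epsilon> \<Longrightarrow> \<epsilon> \<le> \<epsilon>1 \<Longrightarrow> g \<in> borel_measurable borel \<Longrightarrow>
      (\<forall>y. \<epsilon> \<le> \<bar>y\<bar> \<longrightarrow> g y = 0) \<Longrightarrow> (0 \<le> \<beta> \<longrightarrow> (\<forall>y. \<bar>g y\<bar> \<le> 1 + b)) \<Longrightarrow>
      (\<integral>\<^sup>+y. ennreal ((g y)\<^sup>2) \<partial>lborel) \<le> ennreal N \<Longrightarrow> 0 \<le> N \<Longrightarrow>
      (\<forall>k. D n (Suc k) - D n k \<le> m1) \<Longrightarrow> {k. D n k < T} = {..<K} \<Longrightarrow>
      (\<Sum>k\<in>{1..<K}. expectation (\<lambda>\<omega>. (g (B (D n k) \<omega> + a))\<^sup>2) * (D n (Suc k) - D n k)) \<le> s + C * N"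
    using left_endpoint_square_sum[OF T s D cases, of "1 + b"] by blast
  have powr0: "((\<lambda>\<epsilon>::real. \<epsilon> powr q) \<longlongrightarrow> 0) (at_right 0)" if "0 < q" for q
    using that by (intro tendsto_zero_powrI[of _ _ "\<lambda>_. q" q]) (auto simp: eventually_at_filter)
  have N0: "(N \<longlongrightarrow> 0) (at_right 0)"
    unfolding N_def using tendsto_mult_right_zero[OF powr0, of "2 * \<beta> + 1" \<nu>] \<beta> by simp
  \<comment> \<open>The conditions are the three budgets: left endpoints, the two bounds of
    \<open>backward_sum_bound\<close>, and the distance of \<Phi> from the exact antiderivative. All
    hold for small \<epsilon> because \<open>2 * \<beta> + 1\<close> and \<open>1 + \<beta>\<close>
    are positive.\<close>
  have ev: "\<forall>\<^sub>F \<epsilon> in at_right 0. (0 < \<epsilon> \<and> \<epsilon> < min 1 \<epsilon>1) \<and> C * N \<epsilon> < s \<and>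
      8 * N \<epsilon> * (T + 1) powr (1/2) < (p/3)/2 * ((e/4)/4)\<^sup>2 \<and>
      4 * sqrt (N \<epsilon>) * (T + 1) powr (1/4) < (p/3)/2 * ((e/4)/2) \<and>
      (b + 1 / (1 + \<beta>)) * \<epsilon> powr (1 + \<beta>) < e/8"
  proof (intro eventually_conj)
    show "\<forall>\<^sub>F \<epsilon> in at_right 0. 0 < (\<epsilon>::real)" by (auto simp: eventually_at_filter)
    show "\<forall>\<^sub>F \<epsilon> in at_right 0. \<epsilon> < min 1 \<epsilon>1" using \<epsilon>1 by (intro order_tendstoD(2)[OF tendsto_ident_at]) auto
    show "\<forall>\<^sub>F \<epsilon> in at_right 0. C * N \<epsilon> < s"
      using s by (intro order_tendstoD(2)[OF tendsto_mult_right_zero[OF N0]])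
    have "((\<lambda>\<epsilon>. 8 * N \<epsilon> * (T + 1) powr (1/2)) \<longlongrightarrow> 8 * 0 * (T + 1) powr (1/2)) (at_right 0)"
      by (intro tendsto_mult tendsto_const N0)
    then show "\<forall>\<^sub>F \<epsilon> in at_right 0. 8 * N \<epsilon> * (T + 1) powr (1/2) < (p/3)/2 * ((e/4)/4)\<^sup>2"
      by (rule order_tendstoD(2)) (use p e in simp)
    have "((\<lambda>\<epsilon>. 4 * sqrt (N \<epsilon>) * (T + 1) powr (1/4)) \<longlongrightarrow> 4 * sqrt 0 * (T + 1) powr (1/4)) (at_right 0)"
      by (intro tendsto_mult tendsto_const tendsto_real_sqrt N0)
    then show "\<forall>\<^sub>F \<epsilon> in at_right 0. 4 * sqrt (N \<epsilon>) * (T + 1) powr (1/4) < (p/3)/2 * ((e/4)/2)"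
      by (rule order_tendstoD(2)) (use p e in simp)
    have "((\<lambda>\<epsilon>. (b + 1 / (1 + \<beta>)) * \<epsilon> powr (1 + \<beta>)) \<longlongrightarrow> (b + 1 / (1 + \<beta>)) * 0) (at_right 0)"
      using \<beta> by (intro tendsto_mult tendsto_const powr0) auto
    then show "\<forall>\<^sub>F \<epsilon> in at_right 0. (b + 1 / (1 + \<beta>)) * \<epsilon> powr (1 + \<beta>) < e/8"
      by (rule order_tendstoD(2)) (use e in simp)
  qed
  obtain \<epsilon> where \<epsilon>: "0 < \<epsilon>" "\<epsilon> < 1" "\<epsilon> \<le> \<epsilon>1" "C * N \<epsilon> \<le> s"
      "8 * N \<epsilon> * (T + 1) powr (1/2) \<le> (p/3)/2 * ((e/4)/4)\<^sup>2"
      "4 * sqrt (N \<epsilon>) * (T + 1) powr (1/4) \<le> (p/3)/2 * ((e/4)/2)"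
      "(b + 1 / (1 + \<beta>)) * \<epsilon> powr (1 + \<beta>) \<le> e/8"
    using eventually_happens'[OF trivial_limit_at_right_real ev] by auto
  obtain \<Phi> f h where smooth: "\<forall>x. (\<Phi> has_real_derivative f x) (at x)" "\<forall>x. (f has_real_derivative h x) (at x)"
    and h: "continuous_on UNIV h" and near: "\<forall>y. \<epsilon> \<le> \<bar>y\<bar> \<longrightarrow> f y = \<bar>y\<bar> powr \<beta>"
      "\<forall>y. \<bar>y\<bar> < \<epsilon> \<longrightarrow> \<bar>f y\<bar> \<le> b * \<epsilon> powr \<beta>"
    and \<Phi>_close: "\<forall>y. \<bar>\<Phi> y - signed_powr y (1 + \<beta>) / (1 + \<beta>)\<bar> \<le> (b + 1 / (1 + \<beta>)) * \<epsilon> powr (1 + \<beta>)"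
    using power_smoothing[OF \<beta> \<epsilon>(1), folded b_def] by (elim exE conjE) (rule that)
  note \<Phi> = smooth(1)[rule_format] and f = smooth(2)[rule_format] and out = near(1)[rule_format]
    and inside = near(2)[rule_format]
  have f_meas: "f \<in> borel_measurable borel"
    by (rule borel_measurable_continuous_onI, rule DERIV_continuous_on, rule has_field_derivative_at_within, rule f)
  define g where "g y = \<bar>y\<bar> powr \<beta> - f y" for y
  have g_meas: "g \<in> borel_measurable borel" unfolding g_def using f_meas by measurable
  have g_out: "\<forall>y. \<epsilon> \<le> \<bar>y\<bar> \<longrightarrow> g y = 0" using out by (simp add: g_def)
  have g_N: "(\<integral>\<^sup>+y. ennreal ((g y)\<^sup>2) \<partial>lborel) \<le> ennreal (N \<epsilon>)"
    unfolding g_def N_def \<nu>_def using power_smoothing_error[OF \<beta> \<epsilon>(1) f_meas out inside] .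
  have N: "0 < N \<epsilon>" using \<nu> \<epsilon>(1) by (simp add: N_def)
  have g_bdd: "0 \<le> \<beta> \<longrightarrow> (\<forall>y. \<bar>g y\<bar> \<le> 1 + b)"
  proof (intro impI allI)
    fix y assume \<beta>0: "0 \<le> \<beta>"
    show "\<bar>g y\<bar> \<le> 1 + b"
    proof (cases "\<epsilon> \<le> \<bar>y\<bar>")
      case True
      then show ?thesis using g_out b by simp
    next
      case False
      have le1: "x powr \<beta> \<le> 1" if "0 \<le> x" "x \<le> 1" for x
        using powr_mono2[OF \<beta>0 that] by simp
      have "b * \<epsilon> powr \<beta> \<le> b" using le1[of \<epsilon>] \<epsilon> b by (simp add: mult_left_le)
      then have "\<bar>f y\<bar> \<le> b" using inside[of y] False by linarith
      moreover have "\<bar>y\<bar> powr \<beta> \<le> 1" "0 \<le> \<bar>y\<bar> powr \<beta>" using le1[of "\<bar>y\<bar>"] False \<epsilon>(2) by auto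
      ultimately show ?thesis unfolding g_def by linarith
    qed
  qed
  \<comment> \<open>At time 0 the motion has no density, but the summand is the deterministic
    \<open>(g a)\<^sup>2\<close> times the first interval, so a small mesh controls it. Since g
    depends on \<epsilon>, this mesh is chosen after \<epsilon>.\<close>
  define m2 where "m2 = min 1 (min m1 (s / ((g a)\<^sup>2 + 1)))"
  have ga: "0 < (g a)\<^sup>2 + 1" by (simp add: add_nonneg_pos)
  have m2: "0 < m2" "m2 \<le> 1" "m2 \<le> m1" "m2 \<le> s / ((g a)\<^sup>2 + 1)" using m1 s ga by (auto simp: m2_def)
  have "((g a)\<^sup>2 + 1) * m2 \<le> s" using m2(4) ga by (simp add: pos_le_divide_eq mult.commute)
  then have m2a: "(g a)\<^sup>2 * m2 \<le> s" using m2(1) by (simp add: distrib_right)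
  define Z where "Z t \<omega> = \<Phi> (B t \<omega> + a) - \<Phi> a - integral {0..t} (\<lambda>s. h (B s \<omega> + a)) / 2" for t \<omega>
  have e4: "0 < e/4" and p3: "0 < p/3" using e p by auto
  have "?E Z"
    using partition_sequence_mesh[OF D m2(1)] smooth_sum_limits[OF D \<Phi> f h T e4 p3, of a]
  proof eventually_elim
    case (elim n)
    define \<tau> where "\<tau> = D n"
    have \<tau>: "strict_mono \<tau>" "\<tau> 0 = 0" "\<And>t. finite {k. \<tau> k \<le> t}"
      using D unfolding partition_sequence_def \<tau>_def by auto
    have pos: "0 \<le> \<tau> r" for r using \<tau> by (metis strict_mono_less_eq zero_le)
    have less: "\<tau> r < \<tau> (Suc r)" for r using \<tau> by (simp add: strict_mono_less)
    have mesh: "\<tau> (Suc k) - \<tau> k \<le> m2" for k using elim(1) by (simp add: \<tau>_def)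
    obtain K where K: "{k. \<tau> k < T} = {..<K}" using partition_below[OF \<tau>(1,3)] .
    have at0: "integrable M (\<lambda>\<omega>. (g (B (\<tau> 0) \<omega> + a))\<^sup>2)" "expectation (\<lambda>\<omega>. (g (B (\<tau> 0) \<omega> + a))\<^sup>2) = (g a)\<^sup>2"
    proof -
      have "integrable M (\<lambda>\<omega>. (g (B (\<tau> 0) \<omega> + a))\<^sup>2) \<longleftrightarrow> integrable M (\<lambda>\<omega>. (g a)\<^sup>2)"
        by (rule Bochner_Integration.integrable_cong) (auto simp: \<tau>(2) B_0)
      then show "integrable M (\<lambda>\<omega>. (g (B (\<tau> 0) \<omega> + a))\<^sup>2)" by simp
      have "expectation (\<lambda>\<omega>. (g (B (\<tau> 0) \<omega> + a))\<^sup>2) = expectation (\<lambda>\<omega>. (g a)\<^sup>2)"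
        by (rule Bochner_Integration.integral_cong) (auto simp: \<tau>(2) B_0)
      then show "expectation (\<lambda>\<omega>. (g (B (\<tau> 0) \<omega> + a))\<^sup>2) = (g a)\<^sup>2" by (simp add: prob_space)
    qed
    have int: "integrable M (\<lambda>\<omega>. (g (B (\<tau> k) \<omega> + a))\<^sup>2)" for k
    proof (cases k)
      case 0
      then show ?thesis using at0 by simp
    next
      case (Suc j)
      have "0 < \<tau> k" using pos[of j] less[of j] Suc by simp
      from B_shift_square_bound(1)[OF this g_meas normal_density_le_sqrt[OF this] g_N] show ?thesis
        using N by simp
    qed
    have "(\<Sum>k<K. expectation (\<lambda>\<omega>. (g (B (\<tau> k) \<omega> + a))\<^sup>2) * (\<tau> (Suc k) - \<tau> k))
        \<le> (g a)\<^sup>2 * m2 + (\<Sum>k\<in>{1..<K}. expectation (\<lambda>\<omega>. (g (B (\<tau> k) \<omega> + a))\<^sup>2) * (\<tau> (Suc k) - \<tau> k))"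
    proof (cases K)
      case 0
      then show ?thesis using m2(1) by simp
    next
      case (Suc j)
      have "{..<K} = insert 0 {1..<K}" using Suc by auto
      moreover have "(g a)\<^sup>2 * (\<tau> (Suc 0) - \<tau> 0) \<le> (g a)\<^sup>2 * m2" using mesh by (intro mult_left_mono) auto
      ultimately show ?thesis using at0(2) by simp
    qed
    also have "\<dots> \<le> s + (s + C * N \<epsilon>)"
    proof (intro add_mono m2a)
      show "(\<Sum>k\<in>{1..<K}. expectation (\<lambda>\<omega>. (g (B (\<tau> k) \<omega> + a))\<^sup>2) * (\<tau> (Suc k) - \<tau> k)) \<le> s + C * N \<epsilon>"
        unfolding \<tau>_def
        by (rule sums[OF \<epsilon>(1,3) g_meas g_out g_bdd g_N less_imp_le[OF N]])
          (use mesh m2(3) K in \<open>auto simp: \<tau>_def intro: order_trans\<close>)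
    qed
    also have "\<dots> \<le> p/3 * (e/4)\<^sup>2" using \<epsilon>(4) by (simp add: s_def)
    finally have fw: "holds_up_to M (p/3) (\<lambda>\<omega>. \<forall>t\<in>{0..T}.
        \<bar>\<Sum>k | \<tau> k < t. g (B (\<tau> k) \<omega> + a) * (B (\<tau> (Suc k)) \<omega> - B (\<tau> k) \<omega>)\<bar> \<le> e/4)"
      by (rule forward_sum_bound[OF \<tau> K g_meas int e4])
    have mesh1: "\<tau> (Suc k) - \<tau> k \<le> 1" for k using mesh[of k] m2(2) by simp
    have bw: "holds_up_to M (p/3) (\<lambda>\<omega>. \<forall>t\<in>{0..T}.
        \<bar>\<Sum>k | \<tau> k < t. g (B (\<tau> (Suc k)) \<omega> + a) * (B (\<tau> (Suc k)) \<omega> - B (\<tau> k) \<omega>)\<bar> \<le> e/4)"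
      by (rule backward_sum_bound[OF \<tau> K mesh1 T g_meas g_N N e4 \<epsilon>(5,6)])
    show ?case
      unfolding \<tau>_def[symmetric]
    proof (rule holds_up_to_mono[OF holds_up_to_conj[OF holds_up_to_conj[OF fw bw] elim(2)[folded \<tau>_def Z_def]]])
      let ?dB = "\<lambda>k \<omega>. B (\<tau> (Suc k)) \<omega> - B (\<tau> k) \<omega>"
      let ?W = "\<lambda>k \<omega>. B (\<tau> k) \<omega> + a"
      fix \<omega> assume *: "((\<forall>t\<in>{0..T}. \<bar>\<Sum>k | \<tau> k < t. g (?W k \<omega>) * ?dB k \<omega>\<bar> \<le> e/4) \<and>
          (\<forall>t\<in>{0..T}. \<bar>\<Sum>k | \<tau> k < t. g (?W (Suc k) \<omega>) * ?dB k \<omega>\<bar> \<le> e/4)) \<and>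
        (\<forall>t\<in>{0..T}. \<bar>(\<Sum>k | \<tau> k < t. f (?W k \<omega>) * ?dB k \<omega>) - Z t \<omega>\<bar> \<le> e/4 \<and>
          \<bar>(\<Sum>k | \<tau> k < t. (f (?W k \<omega>) + f (?W (Suc k) \<omega>)) / 2 * ?dB k \<omega>) - (\<Phi> (B t \<omega> + a) - \<Phi> a)\<bar> \<le> e/4)"
      show "\<forall>t\<in>{0..T}. \<bar>(\<Sum>k | \<tau> k < t. \<bar>?W k \<omega>\<bar> powr \<beta> * ?dB k \<omega>) - Z t \<omega>\<bar> \<le> e \<and>
        \<bar>(\<Sum>k | \<tau> k < t. (\<bar>?W k \<omega>\<bar> powr \<beta> + \<bar>?W (Suc k) \<omega>\<bar> powr \<beta>) / 2 * ?dB k \<omega>)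
          - (signed_powr (B t \<omega> + a) (1 + \<beta>) - signed_powr a (1 + \<beta>)) / (1 + \<beta>)\<bar> \<le> e"
        (is "\<forall>t\<in>{0..T}. ?C t")
      proof
        fix t assume t: "t \<in> {0..T}"
        define Gf Gb where "Gf = (\<Sum>k | \<tau> k < t. g (?W k \<omega>) * ?dB k \<omega>)"
          and "Gb = (\<Sum>k | \<tau> k < t. g (?W (Suc k) \<omega>) * ?dB k \<omega>)"
        define If Tf where "If = (\<Sum>k | \<tau> k < t. f (?W k \<omega>) * ?dB k \<omega>)"
          and "Tf = (\<Sum>k | \<tau> k < t. (f (?W k \<omega>) + f (?W (Suc k) \<omega>)) / 2 * ?dB k \<omega>)"
        have small: "\<bar>Gf\<bar> \<le> e/4" "\<bar>Gb\<bar> \<le> e/4" "\<bar>If - Z t \<omega>\<bar> \<le> e/4" "\<bar>Tf - (\<Phi> (B t \<omega> + a) - \<Phi> a)\<bar> \<le> e/4"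
          using * t unfolding Gf_def Gb_def If_def Tf_def by blast+
        have total: "\<bar>S - (u - v)\<bar> \<le> e"
          if "S = Tf + (Gf + Gb) / 2" "\<bar>x - u\<bar> \<le> e/8" "\<bar>y - v\<bar> \<le> e/8" "\<bar>Tf - (x - y)\<bar> \<le> e/4" for S u v x y
        proof -
          have "\<bar>Tf - (u - v)\<bar> \<le> e/2" using that(2-4) by linarith
          moreover have "\<bar>Gf + Gb\<bar> \<le> e/4 + e/4"
            by (rule order_trans[OF abs_triangle_ineq add_mono[OF small(1,2)]])
          then have "\<bar>(Gf + Gb) / 2\<bar> \<le> e/4" by simp
          ultimately show ?thesis using that(1) e by linarith
        qed
        have pw: "\<bar>y\<bar> powr \<beta> = f y + g y" for y by (simp add: g_def)
        have "(\<Sum>k | \<tau> k < t. \<bar>?W k \<omega>\<bar> powr \<beta> * ?dB k \<omega>) = If + Gf"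
          unfolding pw If_def Gf_def by (simp add: distrib_right sum.distrib)
        then have 1: "\<bar>(\<Sum>k | \<tau> k < t. \<bar>?W k \<omega>\<bar> powr \<beta> * ?dB k \<omega>) - Z t \<omega>\<bar> \<le> e"
          using small e by linarith
        have "(\<Sum>k | \<tau> k < t. (\<bar>?W k \<omega>\<bar> powr \<beta> + \<bar>?W (Suc k) \<omega>\<bar> powr \<beta>) / 2 * ?dB k \<omega>) = Tf + (Gf + Gb) / 2"
          unfolding pw Tf_def Gf_def Gb_def sum.distrib[symmetric] sum_divide_distrib
          by (rule sum.cong) (auto simp: field_simps)
        moreover have "\<bar>\<Phi> (B t \<omega> + a) - signed_powr (B t \<omega> + a) (1 + \<beta>) / (1 + \<beta>)\<bar> \<le> e/8"
          "\<bar>\<Phi> a - signed_powr a (1 + \<beta>) / (1 + \<beta>)\<bar> \<le> e/8"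
          using spec[OF \<Phi>_close, of "B t \<omega> + a"] spec[OF \<Phi>_close, of a] \<epsilon>(7) by linarith+
        ultimately have 2: "\<bar>(\<Sum>k | \<tau> k < t. (\<bar>?W k \<omega>\<bar> powr \<beta> + \<bar>?W (Suc k) \<omega>\<bar> powr \<beta>) / 2 * ?dB k \<omega>)
          - (signed_powr (B t \<omega> + a) (1 + \<beta>) - signed_powr a (1 + \<beta>)) / (1 + \<beta>)\<bar> \<le> e"
          unfolding diff_divide_distrib using small(4) by (rule total)
        show "?C t"
          using 1 2 by blast
      qed
    qed simp
  qed
  then show ?thesis by blast
qed

text \<open>Term by term, the covariation sums are twice the trapezoidal minus twice the Ito sums,
  so the covariation exists once both converge. In the Stratonovich combination the unidentified Ito
  limit cancels and only the trapezoidal limit is left.\<close>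

lemma power_stratonovich:
  fixes a \<beta> c :: real
  assumes D: "partition_sequence D" and \<beta>: "- 1/2 < \<beta>"
    and cases: "ratio_bounded D \<or> a \<noteq> 0 \<or> 0 \<le> \<beta>"
  shows "has_stratonovich_integral M D (\<lambda>s \<omega>. c * \<bar>B s \<omega> + a\<bar> powr \<beta>) B
    (\<lambda>t \<omega>. c * (signed_powr (B t \<omega> + a) (1 + \<beta>) - signed_powr a (1 + \<beta>)) / (1 + \<beta>))"
proof -
  let ?f = "\<lambda>s \<omega>. \<bar>B s \<omega> + a\<bar> powr \<beta>"
  let ?A = "\<lambda>n t \<omega>. \<Sum>k | D n k < t. ?f (D n k) \<omega> * (B (D n (Suc k)) \<omega> - B (D n k) \<omega>)"
  let ?R = "\<lambda>n t \<omega>. \<Sum>k | D n k < t. (?f (D n k) \<omega> + ?f (D n (Suc k)) \<omega>) / 2 * (B (D n (Suc k)) \<omega> - B (D n k) \<omega>)"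
  let ?\<Psi> = "\<lambda>t \<omega>. (signed_powr (B t \<omega> + a) (1 + \<beta>) - signed_powr a (1 + \<beta>)) / (1 + \<beta>)"
  have "\<exists>I. ucp_limit M ?A I"
  proof (rule ucp_limit_exists)
    fix T e p :: real assume "0 \<le> T" "0 < e" "0 < p"
    from power_sum_limits[OF D \<beta> cases this]
    show "\<exists>Z. \<forall>\<^sub>F n in sequentially. holds_up_to M p (\<lambda>\<omega>. \<forall>t\<in>{0..T}. \<bar>?A n t \<omega> - Z t \<omega>\<bar> \<le> e)"
      by (elim exE, intro exI) (erule eventually_mono, erule holds_up_to_mono, auto)
  qed
  then obtain I where I: "ucp_limit M ?A I" by blast
  have R: "ucp_limit M ?R ?\<Psi>"
    unfolding ucp_limit_iff
  proof (intro allI impI)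
    fix T e p :: real assume "0 \<le> T" "0 < e" "0 < p"
    from power_sum_limits[OF D \<beta> cases this]
    show "\<forall>\<^sub>F n in sequentially. holds_up_to M p (\<lambda>\<omega>. \<forall>t\<in>{0..T}. \<bar>?R n t \<omega> - ?\<Psi> t \<omega>\<bar> \<le> e)"
      by (elim exE) (erule eventually_mono, erule holds_up_to_mono, auto)
  qed
  have "(\<lambda>n t \<omega>. \<Sum>k | D n k < t. c * ?f (D n k) \<omega> * (B (D n (Suc k)) \<omega> - B (D n k) \<omega>)) = (\<lambda>n t \<omega>. c * ?A n t \<omega> + 0 * ?A n t \<omega>)"
    by (simp add: sum_distrib_left mult.assoc)
  then have ito: "has_ito_integral M D (\<lambda>s \<omega>. c * ?f s \<omega>) B (\<lambda>t \<omega>. c * I t \<omega>)"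
    unfolding has_ito_integral_def using ucp_limit_lincomb[OF I I, of c 0] by simp
  have "(\<lambda>n t \<omega>. \<Sum>k | D n k < t. (c * ?f (D n (Suc k)) \<omega> - c * ?f (D n k) \<omega>) * (B (D n (Suc k)) \<omega> - B (D n k) \<omega>))
      = (\<lambda>n t \<omega>. 2 * c * ?R n t \<omega> + - 2 * c * ?A n t \<omega>)"
    unfolding sum_distrib_left sum.distrib[symmetric] by (intro ext sum.cong) (auto simp: field_simps)
  then have cov: "has_covariation M D (\<lambda>s \<omega>. c * ?f s \<omega>) B (\<lambda>t \<omega>. 2 * c * ?\<Psi> t \<omega> + - 2 * c * I t \<omega>)"
    unfolding has_covariation_def using ucp_limit_lincomb[OF R I, of "2 * c" "- 2 * c"] by simp
  show ?thesis
    unfolding has_stratonovich_integral_def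
  proof (intro exI conjI)
    have "c * x + 1 / 2 * (2 * c * y + - 2 * c * x) = c * y" for x y by (simp add: algebra_simps)
    then show "(\<lambda>t \<omega>. c * (signed_powr (B t \<omega> + a) (1 + \<beta>) - signed_powr a (1 + \<beta>)) / (1 + \<beta>))
        = (\<lambda>t \<omega>. c * I t \<omega> + 1 / 2 * (2 * c * ?\<Psi> t \<omega> + - 2 * c * I t \<omega>))"
      by (simp only: times_divide_eq_right[symmetric])
  qed (rule ito cov)+
qed

end

section \<open>Signed powers and the solution formula\<close>

lemma signed_powr_mult:
  "0 < c \<Longrightarrow> signed_powr (c * x) p = c powr p * signed_powr x p"
  by (simp add: signed_powr_def abs_mult powr_mult sgn_mult)

lemma signed_powr_signed_powr:
  "signed_powr (signed_powr x p) q = signed_powr x (p * q)"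
  by (cases "x = 0") (simp_all add: signed_powr_def abs_mult sgn_mult powr_powr abs_sgn_eq)

lemma abs_signed_powr: "\<bar>signed_powr x p\<bar> = \<bar>x\<bar> powr p"
  by (cases "x = 0") (simp_all add: signed_powr_def abs_mult abs_sgn_eq)

text \<open>Writing the signed power by positive and negative parts removes the jump of
  \<open>sgn\<close> at 0.\<close>

lemma continuous_signed_powr:
  assumes "0 < p" shows "continuous_on UNIV (\<lambda>x. signed_powr x p)"
proof -
  have "signed_powr x p = (max 0 x) powr p - (max 0 (- x)) powr p" for x
    using assms by (auto simp: signed_powr_def sgn_if max_def)
  moreover have "continuous_on UNIV (\<lambda>x::real. (max 0 x) powr p - (max 0 (- x)) powr p)"
    using assms by (intro continuous_on_diff continuous_on_powr' continuous_intros) auto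
  ultimately show ?thesis by simp
qed

lemma borel_measurable_augmented_natural_filtration:
  assumes "0 \<le> t"
  shows "B t \<in> borel_measurable (augmented_natural_filtration M B t)"
proof -
  let ?G = "{B s -` A \<inter> space M | s A. 0 \<le> s \<and> s \<le> t \<and> A \<in> sets borel} \<union> null_sets M"
  have "?G \<subseteq> Pow (space M)" using sets.sets_into_space by (auto simp: null_sets_def)
  then have "space (augmented_natural_filtration M B t) = space M"
    "sets (augmented_natural_filtration M B t) = sigma_sets (space M) ?G"
    unfolding augmented_natural_filtration_def by (simp_all add: space_measure_of sets_measure_of)
  then show ?thesis
    using assms by (intro measurableI) (auto intro!: sigma_sets.Basic)
qed

theorem theorem3p3:
  fixes M :: "'a measure" and F :: "real \<Rightarrow> 'a measure" and B :: "real \<Rightarrow> 'a \<Rightarrow> real"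
    and D :: "nat \<Rightarrow> nat \<Rightarrow> real" and \<alpha> X0 :: real
  assumes "usual_filtered_prob_space M F"
    and "brownian_motion M F B"
    and "partition_sequence D"
    and "\<alpha> < 0 \<and> X0 = 0 \<Longrightarrow> ratio_bounded D"
    and "-1 < \<alpha>" and "\<alpha> < 1"
  shows "strong_solution M D B \<alpha> X0
           (\<lambda>t \<omega>. signed_powr ((1 - \<alpha>) * B t \<omega> + signed_powr X0 (1 - \<alpha>)) (1 / (1 - \<alpha>)))"
proof -
  interpret brownian M F B
    using assms(1,2) by (simp add: brownian_def brownian_axioms_def)
  define \<beta> where "\<beta> = \<alpha> / (1 - \<alpha>)"
  define a where "a = signed_powr X0 (1 - \<alpha>) / (1 - \<alpha>)"
  have \<alpha>: "0 < 1 - \<alpha>" using assms by simp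
  have \<beta>1: "1 / (1 - \<alpha>) = 1 + \<beta>" using \<alpha> by (simp add: \<beta>_def field_simps)
  have \<beta>: "- 1/2 < \<beta>" using \<alpha> assms by (simp add: \<beta>_def field_simps)
  have \<beta>\<alpha>: "(1 + \<beta>) * \<alpha> = \<beta>" using \<alpha> by (simp add: \<beta>_def field_simps)
  have inv: "(1 - \<alpha>) * (1 + \<beta>) = 1" using \<alpha> by (simp add: \<beta>1[symmetric])
  \<comment> \<open>If the last two alternatives fail, then X0 = 0 and \<alpha> < 0, precisely the
    case in which the hypothesis supplies \<open>ratio_bounded\<close>.\<close>
  have "ratio_bounded D \<or> a \<noteq> 0 \<or> 0 \<le> \<beta>"
  proof (rule ccontr)
    assume neg: "\<not> (ratio_bounded D \<or> a \<noteq> 0 \<or> 0 \<le> \<beta>)"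
    then have "\<bar>X0\<bar> powr (1 - \<alpha>) = 0" using \<alpha> abs_signed_powr[of X0 "1 - \<alpha>"] by (simp add: a_def)
    then have "X0 = 0" by simp
    moreover have "\<alpha> < 0" using neg \<alpha> by (simp add: \<beta>_def zero_le_divide_iff)
    ultimately show False using assms(4) neg by blast
  qed
  note strat = power_stratonovich[OF assms(3) \<beta> this, of "(1 - \<alpha>) powr \<beta>"]
  let ?X = "\<lambda>t \<omega>. signed_powr ((1 - \<alpha>) * B t \<omega> + signed_powr X0 (1 - \<alpha>)) (1 / (1 - \<alpha>))"
  have X: "?X t \<omega> = (1 - \<alpha>) powr (1 + \<beta>) * signed_powr (B t \<omega> + a) (1 + \<beta>)" for t \<omega>
  proof -
    have "(1 - \<alpha>) * B t \<omega> + signed_powr X0 (1 - \<alpha>) = (1 - \<alpha>) * (B t \<omega> + a)"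
      using \<alpha> by (simp add: a_def field_simps)
    then show ?thesis using signed_powr_mult[OF \<alpha>] \<beta>1 by simp
  qed
  have X0: "X0 = (1 - \<alpha>) powr (1 + \<beta>) * signed_powr a (1 + \<beta>)"
  proof -
    have "(1 - \<alpha>) powr (1 + \<beta>) * signed_powr a (1 + \<beta>) = signed_powr (signed_powr X0 (1 - \<alpha>)) (1 + \<beta>)"
      using signed_powr_mult[OF \<alpha>, of a "1 + \<beta>"] \<alpha> by (simp add: a_def)
    also have "\<dots> = X0" unfolding signed_powr_signed_powr inv by (simp add: signed_powr_def abs_mult_sgn)
    finally show ?thesis by simp
  qed
  \<comment> \<open>The exponents multiply to \<open>(1 + \<beta>) * \<alpha> = \<beta>\<close>. The
    identity also holds at zeros of X, where both sides are 0 because 0 to any power is 0.\<close>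
  have abs_X: "\<bar>?X t \<omega>\<bar> powr \<alpha> = (1 - \<alpha>) powr \<beta> * \<bar>B t \<omega> + a\<bar> powr \<beta>" for t \<omega>
    unfolding X abs_mult abs_signed_powr using \<alpha> by (simp add: powr_mult powr_powr \<beta>\<alpha>)
  have coeff: "(1 - \<alpha>) powr \<beta> / (1 + \<beta>) = (1 - \<alpha>) powr (1 + \<beta>)"
  proof -
    have "1 / (1 + \<beta>) = 1 - \<alpha>" by (simp add: \<beta>1[symmetric])
    then have "(1 - \<alpha>) powr \<beta> / (1 + \<beta>) = (1 - \<alpha>) powr \<beta> * (1 - \<alpha>)"
      by (metis mult.right_neutral times_divide_eq_right)
    then show ?thesis using \<alpha> by (simp add: powr_add)
  qed
  have "continuous_process M ?X"
    unfolding continuous_process_def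
  proof
    fix \<omega> assume "\<omega> \<in> space M"
    then show "continuous_on {0..} (\<lambda>t. ?X t \<omega>)"
      using \<alpha> B_continuous
      by (intro continuous_on_compose2[OF continuous_signed_powr] continuous_intros) auto
  qed
  moreover have "adapted_process (augmented_natural_filtration M B) ?X"
    unfolding adapted_process_def
  proof (intro allI impI)
    fix t :: real assume "0 \<le> t"
    note [measurable] = borel_measurable_augmented_natural_filtration[OF this, of B M]
    have [measurable]: "(\<lambda>x. signed_powr x (1 / (1 - \<alpha>))) \<in> borel_measurable borel"
      using \<alpha> by (intro borel_measurable_continuous_onI continuous_signed_powr) simp
    show "?X t \<in> borel_measurable (augmented_natural_filtration M B t)" by measurable
  qed
  moreover have "?X t \<omega> = X0 + (1 - \<alpha>) powr \<beta> * (signed_powr (B t \<omega> + a) (1 + \<beta>) - signed_powr a (1 + \<beta>)) / (1 + \<beta>)" for t \<omega>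
  proof -
    have "(1 - \<alpha>) powr \<beta> * (signed_powr (B t \<omega> + a) (1 + \<beta>) - signed_powr a (1 + \<beta>)) / (1 + \<beta>)
      = (1 - \<alpha>) powr \<beta> / (1 + \<beta>) * (signed_powr (B t \<omega> + a) (1 + \<beta>) - signed_powr a (1 + \<beta>))" by simp
    also have "\<dots> = ?X t \<omega> - X0" unfolding coeff right_diff_distrib X[symmetric] X0[symmetric] ..
    finally show ?thesis by simp
  qed
  ultimately show ?thesis
    unfolding strong_solution_def abs_X using strat by blast
qed

end
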